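(* Let $\mathfrak g$ be a non-abelian symplectic real Lie algebra of dimension four. Then $\mathfrak g$ is isomorphic to one of the following Lie algebras (brackets given in the context), whose symplectic forms are the forms $\omega$ listed, where the $a_{ij},a,b$ are real numbers subject to the indicated condition: - $\mathfrak{rh}_3$: $\omega=a_{12}e^1\wedge e^2+a_{13}e^1\wedge e^3+a_{14}e^1\wedge e^4+a_{23}e^2\wedge e^3+a_{24}e^2\wedge e^4$, with $a_{14}a_{23}-a_{13}a_{24}\neq 0$; - $\mathfrak{rr}_{3,0}$: $\omega=a_{12}e^1\wedge e^2+a_{13}e^1\wedge e^3+a_{14}e^1\wedge e^4+a_{34}e^3\wedge e^4$, with $a_{12}a_{34}\neq 0$; - $\mathfrak{rr}_{3,-1}$: $\omega=a_{12}e^1\wedge e^2+a_{13}e^1\wedge e^3+a_{14}e^1\wedge e^4+a_{23}e^2\wedge e^3$, with $a_{14}a_{23}\neq 0$; - $\mathfrak{rr}'_{3,0}$: $\omega=a_{12}e^1\wedge e^2+a_{13}e^1\wedge e^3+a_{14}e^1\wedge e^4+a_{23}e^2\wedge e^3$, with $a_{14}a_{23}\neq 0$; - $\mathfrak r_2\mathfrak r_2$: $\omega=a_{12}e^1\wedge e^2+a_{13}e^1\wedge e^3+a_{34}e^3\wedge e^4$, with $a_{12}a_{34}\neq 0$; - $\mathfrak r_2'$: $\omega=a_{12}e^1\wedge e^2+a(e^1\wedge e^3-e^2\wedge e^4)+b(e^1\wedge e^4+e^2\wedge e^3)$, with $a^2+b^2\neq 0$; - $\mathfrak n_4$: $\omega=a_{12}e^1\wedge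 e^2+a_{14}e^1\wedge e^4+a_{24}e^2\wedge e^4+a_{34}e^3\wedge e^4$, with $a_{12}a_{34}\neq 0$; - $\mathfrak r_{4,0}$: $\omega=a_{14}e^1\wedge e^4+a_{23}e^2\wedge e^3+a_{24}e^2\wedge e^4+a_{34}e^3\wedge e^4$, with $a_{14}a_{23}\neq 0$; - $\mathfrak r_{4,-1}$: $\omega=a_{13}e^1\wedge e^3+a_{14}e^1\wedge e^4+a_{24}e^2\wedge e^4+a_{34}e^3\wedge e^4$, with $a_{13}a_{24}\neq 0$; - $\mathfrak r_{4,-1,\beta}$, $-1<\beta<0$: $\omega=a_{12}e^1\wedge e^2+a_{14}e^1\wedge e^4+a_{24}e^2\wedge e^4+a_{34}e^3\wedge e^4$, with $a_{12}a_{34}\neq 0$; - $\mathfrak r_{4,-1,-1}$: $\omega=a_{12}e^1\wedge e^2+a_{13}e^1\wedge e^3+a_{14}e^1\wedge e^4+a_{24}e^2\wedge e^4+a_{34}e^3\wedge e^4$, with $a_{12}a_{34}-a_{13}a_{24}\neq 0$; - $\mathfrak r_{4,\alpha,-\alpha}$, $-1<\alpha<0$: $\omega=a_{14}e^1\wedge e^4+a_{23}e^2\wedge e^3+a_{24}e^2\wedge e^4+a_{34}e^3\wedge e^4$, with $a_{14}a_{23}\neq 0$; - $\mathfrak r'_{4,0,\delta}$, $\delta>0$: $\omega=a_{14}e^1\wedge e^4+a_{23}e^2\wedge e^3+a_{24}e^2\wedge e^4+a_{34}e^3\wedge e^4$, with $a_{14}a_{23}\neq 0$; - $\mathfrak d_{4,1}$: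 $\omega=a(e^1\wedge e^2-e^3\wedge e^4)+a_{14}e^1\wedge e^4+a_{24}e^2\wedge e^4$, with $a\neq 0$; - $\mathfrak d_{4,2}$: $\omega=a(e^1\wedge e^2-e^3\wedge e^4)+a_{14}e^1\wedge e^4+a_{23}e^2\wedge e^3+a_{24}e^2\wedge e^4$, with $-a^2+a_{14}a_{23}\neq 0$; - $\mathfrak d_{4,\lambda}$, $\lambda\ge\frac12$, $\lambda\neq 1,2$: $\omega=a(e^1\wedge e^2-e^3\wedge e^4)+a_{14}e^1\wedge e^4+a_{24}e^2\wedge e^4$, with $a\neq 0$; - $\mathfrak d'_{4,\delta}$, $\delta>0$: $\omega=a(e^1\wedge e^2-\delta e^3\wedge e^4)+a_{14}e^1\wedge e^4+a_{24}e^2\wedge e^4$, with $a\neq 0$; - $\mathfrak h_4$: $\omega=a(e^1\wedge e^2-e^3\wedge e^4)+a_{14}e^1\wedge e^4+a_{24}e^2\wedge e^4$, with $a\neq 0$.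
   Context: A symplectic structure (form) on a $2n$-dimensional real Lie algebra $\mathfrak g$ is a 2-form $\omega\in\Lambda^2(\mathfrak g^* )$ that is closed for the Chevalley–Eilenberg differential (trivial coefficients) and satisfies $\omega^n\neq 0$; $\mathfrak g$ is symplectic if it admits one. Each algebra below has basis $e_1,\dots,e_4$ with dual basis $e^1,\dots,e^4$; brackets of basis elements not determined by those listed are zero. - $\mathfrak{rh}_3$: $[e_1,e_2]=e_3$. - $\mathfrak{rr}_{3,\lambda}$: $[e_1,e_2]=e_2$, $[e_1,e_3]=\lambda e_3$. - $\mathfrak{rr}'_{3,0}$: $[e_1,e_2]=-e_3$, $[e_1,e_3]=e_2$. - $\mathfrak r_2\mathfrak r_2$: $[e_1,e_2]=e_2$, $[e_3,e_4]=e_4$. - $\mathfrak r_2'$: $[e_1,e_3]=e_3$, $[e_1,e_4]=e_4$, $[e_2,e_3]=e_4$, $[e_2,e_4]=-e_3$. - $\mathfrak n_4$: $[e_4,e_1]=e_2$, $[e_4,e_2]=e_3$. - $\mathfrak r_{4,\mu}$: $[e_4,e_1]=e_1$, $[e_4,e_2]=\mu e_2$, $[e_4,e_3]=e_2+\mu e_3$. - $\mathfrak r_{4,\alpha,\beta}$: $[e_4,e_1]=e_1$, $[e_4,e_2]=\alpha e_2$, $[e_4,e_3]=\beta e_3$. - $\mathfrak r'_{4,\gamma,\delta}$: $[e_4,e_1]=e_1$, $[e_4,e_2]=\gamma e_2-\delta e_3$, $[e_4,e_3]=\delta e_2+\gamma e_3$. - $\mathfrak d_{4,\lambda}$: $[e_1,e_2]=e_3$,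 $[e_4,e_3]=e_3$, $[e_4,e_1]=\lambda e_1$, $[e_4,e_2]=(1-\lambda)e_2$. - $\mathfrak d'_{4,\delta}$: $[e_1,e_2]=e_3$, $[e_4,e_1]=\frac{\delta}{2}e_1-e_2$, $[e_4,e_3]=\delta e_3$, $[e_4,e_2]=e_1+\frac{\delta}{2}e_2$. - $\mathfrak h_4$: $[e_1,e_2]=e_3$, $[e_4,e_3]=e_3$, $[e_4,e_1]=\frac12 e_1$, $[e_4,e_2]=e_1+\frac12 e_2$. *)

theory Defs
  imports "HOL-Analysis.Analysis"
begin

definition lie_algebra :: "('a::real_vector \<Rightarrow> 'a \<Rightarrow> 'a) \<Rightarrow> bool" where
  "lie_algebra br \<longleftrightarrow>
     bilinear br \<and> (\<forall>x. br x x = 0) \<and>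
     (\<forall>x y z. br x (br y z) + br y (br z x) + br z (br x y) = 0)"

definition lie_isomorphic ::
    "('a::real_vector \<Rightarrow> 'a \<Rightarrow> 'a) \<Rightarrow> ('b::real_vector \<Rightarrow> 'b \<Rightarrow> 'b) \<Rightarrow> bool" where
  "lie_isomorphic br br' \<longleftrightarrow>
     (\<exists>f. linear f \<and> bij f \<and> (\<forall>x y. f (br x y) = br' (f x) (f y)))"

text \<open>A k-form is a real-valued function on lists of vectors. It is required to vanish off the
  lists of length k, so that equality of k-forms is equality of functions and the degree of a form
  need not be passed to the operations below.\<close>

type_synonym 'a form = "'a list \<Rightarrow> real"

definition alternating_form :: "nat \<Rightarrow> 'a::real_vector form \<Rightarrow> bool" where
  "alternating_form k \<omega> \<longleftrightarrow>
     (\<forall>xs. length xs \<noteq> k \<longrightarrow> \<omega> xs = 0) \<and>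
     (\<forall>xs i. length xs = k \<and> i < k \<longrightarrow> linear (\<lambda>x. \<omega> (xs[i := x]))) \<and>
     (\<forall>xs. \<not> distinct xs \<longrightarrow> \<omega> xs = 0)"

text \<open>The exterior product is the signed sum over all ways of distributing the arguments, in their
  given order, over the two factors (the shuffle formula), so that
  \<open>(\<alpha> \<and> \<beta>)(x, y) = \<alpha>(x) \<beta>(y) - \<alpha>(y) \<beta>(x)\<close> for 1-forms.
  The set I holds the positions that go to the first factor; the exponent counts the inversions of
  the corresponding shuffle.\<close>

definition wedge :: "'a form \<Rightarrow> 'a form \<Rightarrow> 'a form" where
  "wedge \<alpha> \<beta> xs =
     (\<Sum>I\<in>Pow {..<length xs}.
        (- 1) ^ card {(i, j). i \<in> I \<and> j \<in> {..<length xs} - I \<and> j < i} *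
        \<alpha> (nths xs I) * \<beta> (nths xs (- I)))"

primrec wedge_power :: "'a form \<Rightarrow> nat \<Rightarrow> 'a form" where
  "wedge_power \<omega> 0 = (\<lambda>xs. if xs = [] then 1 else 0)"
| "wedge_power \<omega> (Suc n) = wedge \<omega> (wedge_power \<omega> n)"

text \<open>The Chevalley--Eilenberg differential with trivial coefficients:
  \<open>d\<omega>(x\<^sub>0, \<dots>, x\<^sub>k) = \<Sum> i < j. (-1)^(i+j) \<omega>([x\<^sub>i, x\<^sub>j], x\<^sub>0, \<dots>, x\<^sub>k)\<close> with
  \<open>x\<^sub>i\<close> and \<open>x\<^sub>j\<close> omitted from the remaining arguments.\<close>

definition ce_diff :: "('a \<Rightarrow> 'a \<Rightarrow> 'a) \<Rightarrow> 'a form \<Rightarrow> 'a form" where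
  "ce_diff br \<omega> xs =
     (\<Sum>(i, j)\<in>{(i, j). i < j \<and> j < length xs}.
        (- 1) ^ (i + j) * \<omega> (br (xs ! i) (xs ! j) # nths xs (- {i, j})))"

text \<open>Finite-dimensionality is stated separately because \<^const>\<open>dim\<close> is 0 on
  infinite-dimensional spaces.\<close>

definition symplectic_form :: "('a::real_vector \<Rightarrow> 'a \<Rightarrow> 'a) \<Rightarrow> 'a form \<Rightarrow> bool" where
  "symplectic_form br \<omega> \<longleftrightarrow>
     alternating_form 2 \<omega> \<and> ce_diff br \<omega> = (\<lambda>xs. 0) \<and>
     (\<exists>B. finite B \<and> span B = (UNIV :: 'a set)) \<and>
     (\<exists>n. dim (UNIV :: 'a set) = 2 * n \<and> wedge_power \<omega> n \<noteq> (\<lambda>xs. 0))"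

definition symplectic :: "('a::real_vector \<Rightarrow> 'a \<Rightarrow> 'a) \<Rightarrow> bool" where
  "symplectic br \<longleftrightarrow> (\<exists>\<omega>. symplectic_form br \<omega>)"

definition abelian :: "('a::real_vector \<Rightarrow> 'a \<Rightarrow> 'a) \<Rightarrow> bool" where
  "abelian br \<longleftrightarrow> (\<forall>x y. br x y = 0)"

abbreviation e :: "4 \<Rightarrow> real^4" where
  "e i \<equiv> axis i 1"

definition dual_e :: "4 \<Rightarrow> (real^4) form" where
  "dual_e i xs = (case xs of [x] \<Rightarrow> x $ i | _ \<Rightarrow> 0)"

abbreviation ew :: "4 \<Rightarrow> 4 \<Rightarrow> (real^4) form" where
  "ew i j \<equiv> wedge (dual_e i) (dual_e j)"

text \<open>The bilinear alternating map with the listed values \<open>[e\<^sub>i, e\<^sub>j] = v\<close>, for entries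
  \<open>(i, j, v)\<close>, that is zero on the pairs of basis vectors not determined by them. No pair
  \<open>{i, j}\<close> may be listed twice.\<close>

definition bracket :: "(4 \<times> 4 \<times> (real^4)) list \<Rightarrow> real^4 \<Rightarrow> real^4 \<Rightarrow> real^4" where
  "bracket L x y = (\<Sum>(i, j, v)\<leftarrow>L. (x $ i * y $ j - x $ j * y $ i) *\<^sub>R v)"

definition rh3 :: "real^4 \<Rightarrow> real^4 \<Rightarrow> real^4" where
  "rh3 = bracket [(1, 2, e 3)]"

definition rr3 :: "real \<Rightarrow> real^4 \<Rightarrow> real^4 \<Rightarrow> real^4" where
  "rr3 l = bracket [(1, 2, e 2), (1, 3, l *\<^sub>R e 3)]"

definition rr3'_0 :: "real^4 \<Rightarrow> real^4 \<Rightarrow> real^4" where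
  "rr3'_0 = bracket [(1, 2, - e 3), (1, 3, e 2)]"

definition r2r2 :: "real^4 \<Rightarrow> real^4 \<Rightarrow> real^4" where
  "r2r2 = bracket [(1, 2, e 2), (3, 4, e 4)]"

definition r2' :: "real^4 \<Rightarrow> real^4 \<Rightarrow> real^4" where
  "r2' = bracket [(1, 3, e 3), (1, 4, e 4), (2, 3, e 4), (2, 4, - e 3)]"

definition n4 :: "real^4 \<Rightarrow> real^4 \<Rightarrow> real^4" where
  "n4 = bracket [(4, 1, e 2), (4, 2, e 3)]"

definition r4_mu :: "real \<Rightarrow> real^4 \<Rightarrow> real^4 \<Rightarrow> real^4" where
  "r4_mu m = bracket [(4, 1, e 1), (4, 2, m *\<^sub>R e 2), (4, 3, e 2 + m *\<^sub>R e 3)]"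

definition r4_alpha_beta :: "real \<Rightarrow> real \<Rightarrow> real^4 \<Rightarrow> real^4 \<Rightarrow> real^4" where
  "r4_alpha_beta \<alpha> \<beta> = bracket [(4, 1, e 1), (4, 2, \<alpha> *\<^sub>R e 2), (4, 3, \<beta> *\<^sub>R e 3)]"

definition r4' :: "real \<Rightarrow> real \<Rightarrow> real^4 \<Rightarrow> real^4 \<Rightarrow> real^4" where
  "r4' \<gamma> \<delta> = bracket [(4, 1, e 1), (4, 2, \<gamma> *\<^sub>R e 2 - \<delta> *\<^sub>R e 3),
                     (4, 3, \<delta> *\<^sub>R e 2 + \<gamma> *\<^sub>R e 3)]"

definition d4 :: "real \<Rightarrow> real^4 \<Rightarrow> real^4 \<Rightarrow> real^4" where
  "d4 l = bracket [(1, 2, e 3), (4, 3, e 3), (4, 1, l *\<^sub>R e 1), (4, 2, (1 - l) *\<^sub>R e 2)]"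

definition d4' :: "real \<Rightarrow> real^4 \<Rightarrow> real^4 \<Rightarrow> real^4" where
  "d4' \<delta> = bracket [(1, 2, e 3), (4, 1, (\<delta> / 2) *\<^sub>R e 1 - e 2), (4, 3, \<delta> *\<^sub>R e 3),
                   (4, 2, e 1 + (\<delta> / 2) *\<^sub>R e 2)]"

definition h4 :: "real^4 \<Rightarrow> real^4 \<Rightarrow> real^4" where
  "h4 = bracket [(1, 2, e 3), (4, 3, e 3), (4, 1, (1 / 2) *\<^sub>R e 1),
                 (4, 2, e 1 + (1 / 2) *\<^sub>R e 2)]"

text \<open>The table of the classification: \<open>listed br S\<close> holds if br is the bracket of an entry
  and S is the set of 2-forms given for that entry.\<close>

inductive listed :: "(real^4 \<Rightarrow> real^4 \<Rightarrow> real^4) \<Rightarrow> (real^4) form set \<Rightarrow> bool" where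
  rh3: "listed rh3
    {(\<lambda>v. a12 * ew 1 2 v + a13 * ew 1 3 v + a14 * ew 1 4 v + a23 * ew 2 3 v + a24 * ew 2 4 v)
      | a12 a13 a14 a23 a24. a14 * a23 - a13 * a24 \<noteq> 0}"
| rr3_0: "listed (rr3 0)
    {(\<lambda>v. a12 * ew 1 2 v + a13 * ew 1 3 v + a14 * ew 1 4 v + a34 * ew 3 4 v)
      | a12 a13 a14 a34. a12 * a34 \<noteq> 0}"
| rr3_m1: "listed (rr3 (- 1))
    {(\<lambda>v. a12 * ew 1 2 v + a13 * ew 1 3 v + a14 * ew 1 4 v + a23 * ew 2 3 v)
      | a12 a13 a14 a23. a14 * a23 \<noteq> 0}"
| rr3'_0: "listed rr3'_0
    {(\<lambda>v. a12 * ew 1 2 v + a13 * ew 1 3 v + a14 * ew 1 4 v + a23 * ew 2 3 v)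
      | a12 a13 a14 a23. a14 * a23 \<noteq> 0}"
| r2r2: "listed r2r2
    {(\<lambda>v. a12 * ew 1 2 v + a13 * ew 1 3 v + a34 * ew 3 4 v)
      | a12 a13 a34. a12 * a34 \<noteq> 0}"
| r2': "listed r2'
    {(\<lambda>v. a12 * ew 1 2 v + a * (ew 1 3 v - ew 2 4 v) + b * (ew 1 4 v + ew 2 3 v))
      | a12 a b. a\<^sup>2 + b\<^sup>2 \<noteq> 0}"
| n4: "listed n4
    {(\<lambda>v. a12 * ew 1 2 v + a14 * ew 1 4 v + a24 * ew 2 4 v + a34 * ew 3 4 v)
      | a12 a14 a24 a34. a12 * a34 \<noteq> 0}"
| r4_0: "listed (r4_mu 0)
    {(\<lambda>v. a14 * ew 1 4 v + a23 * ew 2 3 v + a24 * ew 2 4 v + a34 * ew 3 4 v)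
      | a14 a23 a24 a34. a14 * a23 \<noteq> 0}"
| r4_m1: "listed (r4_mu (- 1))
    {(\<lambda>v. a13 * ew 1 3 v + a14 * ew 1 4 v + a24 * ew 2 4 v + a34 * ew 3 4 v)
      | a13 a14 a24 a34. a13 * a24 \<noteq> 0}"
| r4_m1_beta: "- 1 < \<beta> \<Longrightarrow> \<beta> < 0 \<Longrightarrow> listed (r4_alpha_beta (- 1) \<beta>)
    {(\<lambda>v. a12 * ew 1 2 v + a14 * ew 1 4 v + a24 * ew 2 4 v + a34 * ew 3 4 v)
      | a12 a14 a24 a34. a12 * a34 \<noteq> 0}"
| r4_m1_m1: "listed (r4_alpha_beta (- 1) (- 1))
    {(\<lambda>v. a12 * ew 1 2 v + a13 * ew 1 3 v + a14 * ew 1 4 v + a24 * ew 2 4 v + a34 * ew 3 4 v)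
      | a12 a13 a14 a24 a34. a12 * a34 - a13 * a24 \<noteq> 0}"
| r4_alpha_malpha: "- 1 < \<alpha> \<Longrightarrow> \<alpha> < 0 \<Longrightarrow> listed (r4_alpha_beta \<alpha> (- \<alpha>))
    {(\<lambda>v. a14 * ew 1 4 v + a23 * ew 2 3 v + a24 * ew 2 4 v + a34 * ew 3 4 v)
      | a14 a23 a24 a34. a14 * a23 \<noteq> 0}"
| r4'_0_delta: "\<delta> > 0 \<Longrightarrow> listed (r4' 0 \<delta>)
    {(\<lambda>v. a14 * ew 1 4 v + a23 * ew 2 3 v + a24 * ew 2 4 v + a34 * ew 3 4 v)
      | a14 a23 a24 a34. a14 * a23 \<noteq> 0}"
| d4_1: "listed (d4 1)
    {(\<lambda>v. a * (ew 1 2 v - ew 3 4 v) + a14 * ew 1 4 v + a24 * ew 2 4 v)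
      | a a14 a24. a \<noteq> 0}"
| d4_2: "listed (d4 2)
    {(\<lambda>v. a * (ew 1 2 v - ew 3 4 v) + a14 * ew 1 4 v + a23 * ew 2 3 v + a24 * ew 2 4 v)
      | a a14 a23 a24. - (a\<^sup>2) + a14 * a23 \<noteq> 0}"
| d4_lambda: "l \<ge> 1 / 2 \<Longrightarrow> l \<noteq> 1 \<Longrightarrow> l \<noteq> 2 \<Longrightarrow> listed (d4 l)
    {(\<lambda>v. a * (ew 1 2 v - ew 3 4 v) + a14 * ew 1 4 v + a24 * ew 2 4 v)
      | a a14 a24. a \<noteq> 0}"
| d4'_delta: "\<delta> > 0 \<Longrightarrow> listed (d4' \<delta>)
    {(\<lambda>v. a * (ew 1 2 v - \<delta> * ew 3 4 v) + a14 * ew 1 4 v + a24 * ew 2 4 v)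
      | a a14 a24. a \<noteq> 0}"
| h4: "listed h4
    {(\<lambda>v. a * (ew 1 2 v - ew 3 4 v) + a14 * ew 1 4 v + a24 * ew 2 4 v)
      | a a14 a24. a \<noteq> 0}"

end

theory Submission
  imports Defs
begin

text \<open>
  Two things are to be shown: that the table is correct, and that it is complete.

  Correctness is linear algebra. A 2-form on \<open>\<real>\<^sup>4\<close> is given by six coefficients. It is closed iff the cyclic
  sum of \<open>\<omega>([x, y], z)\<close> vanishes, which is a trilinear alternating condition and so amounts to four
  linear equations, one for each triple of basis vectors; and \<open>\<omega> \<and> \<omega>\<close> is nonzero iff the Pfaffian
  \<open>a12 a34 - a13 a24 + a14 a23\<close> is (\<open>symplectic_forms_eq\<close>). Solving the system for each bracket gives the
  listed forms (\<open>listed_symplectic_forms\<close>), and the Jacobi identity is checked in the same way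
  (\<open>listed_lie_algebra\<close>).

  Completeness avoids the structure theory of solvable Lie algebras. There are three reductions.

  First, every real Lie algebra of dimension four has an ideal h of dimension three that is
  unimodular (\<open>unimodular_ideal\<close>). If the trace of the adjoint representation is not zero, its kernel is
  such an ideal. If it is zero, then \<open>d\<alpha> \<and> d\<beta> = d(\<alpha> \<and> d\<beta>) = 0\<close> for all 1-forms, so the exact 2-forms are
  an isotropic subspace for the wedge pairing on the six-dimensional space of 2-forms. That pairing
  has signature (3, 3), so d cannot be injective on the four-dimensional space of 1-forms, and a closed
  1-form has an ideal as its kernel.

  Second, the bracket of the unimodular algebra h is \<open>[u, v] = S (u \<times> v)\<close> with S symmetric. The
  symplectic form makes S singular (\<open>symmetric3_kernel\<close>): for invertible S every derivation of h is
  skew with respect to the form defined by S, and this forces the Pfaffian of a closed form to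
  vanish. Hence \<open>[h, h]\<close> lies in a plane, and by unimodularity this plane is abelian and the rest of h acts
  on it by a matrix of trace zero (\<open>abelian_plane\<close>).

  Third, a real 2 by 2 matrix of trace zero is zero, nilpotent, diagonalizable with eigenvalues \<open>\<plusminus>k\<close>, or k
  times a rotation by a right angle (\<open>traceless2_normal_form\<close>). In the last two cases the action of
  the complement of h can be normalized completely (\<open>hyperbolic_case\<close>, \<open>elliptic_case\<close>). In the
  nilpotent case h is the Heisenberg algebra and the complement acts by a derivation which is, up to
  inner derivations, determined by a 2 by 2 matrix; the trace of this matrix is either normalized to 1 or zero, and the
  normal form is applied to its traceless part (\<open>heisenberg_case\<close>). In the zero case h is abelian;
  the restriction of the symplectic form to h, read as a vector of h, is an eigenvector of the acting
  matrix with eigenvalue the trace of that matrix, so the induced action on the quotient by this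
  vector again has trace zero (\<open>eigenvector_frame\<close>, \<open>abelian_ideal_case\<close>).
\<close>

section \<open>Wedge products and differentials of 2-forms\<close>

text \<open>One half of the value of \<open>\<omega> \<and> \<omega>\<close> on four vectors, where w is the bilinear function of \<open>\<omega>\<close>.\<close>

definition pfaffian :: "('a \<Rightarrow> 'a \<Rightarrow> real) \<Rightarrow> 'a \<Rightarrow> 'a \<Rightarrow> 'a \<Rightarrow> 'a \<Rightarrow> real" where
  "pfaffian w x y z u = w x y * w z u - w x z * w y u + w x u * w y z"

lemma length_nths_add: "length (nths xs I) + length (nths xs (- I)) = length xs"
proof -
  have "length xs = card {i. i < length xs}" by simp
  also have "{i. i < length xs} = {i. i < length xs \<and> i \<in> I} \<union> {i. i < length xs \<and> i \<in> - I}"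
    by auto
  also have "card \<dots> = card {i. i < length xs \<and> i \<in> I} + card {i. i < length xs \<and> i \<in> - I}"
    by (rule card_Un_disjoint) auto
  finally show ?thesis by (simp add: length_nths)
qed

text \<open>The second factor is nonzero only on the empty list, so the only surviving summand is the one that
  sends all positions to the first factor. This makes the empty power a unit and the second wedge
  power of \<open>\<omega>\<close> equal to \<open>\<omega> \<and> \<omega>\<close>.\<close>

lemma wedge_unit: "wedge \<omega> (\<lambda>xs. if xs = [] then 1 else 0) = \<omega>"
proof
  fix xs :: "'a list"
  let ?n = "length xs"
  let ?f = "\<lambda>I. (- 1) ^ card {(i, j). i \<in> I \<and> j \<in> {..<?n} - I \<and> j < i} *
        \<omega> (nths xs I) * (if nths xs (- I) = [] then 1 else (0::real))"
  have "wedge \<omega> (\<lambda>xs. if xs = [] then 1 else 0) xs = sum ?f (Pow {..<?n})"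
    by (simp add: wedge_def)
  also have "\<dots> = sum ?f {{..<?n}}"
  proof (rule sum.mono_neutral_right)
    show "\<forall>I\<in>Pow {..<?n} - {{..<?n}}. ?f I = 0"
    proof
      fix I assume "I \<in> Pow {..<?n} - {{..<?n}}"
      then obtain j where "j < ?n" "j \<notin> I" by auto
      then have "xs ! j \<in> set (nths xs (- I))" by (auto simp: set_nths)
      then show "?f I = 0" by auto
    qed
  qed auto
  also have "\<dots> = \<omega> xs"
  proof -
    have "nths xs (- {..<?n}) = []"
      by (simp add: length_0_conv[symmetric] length_nths del: length_0_conv)
    moreover have "nths xs {..<?n} = xs" by (simp add: nths_all)
    ultimately show ?thesis by simp
  qed
  finally show "wedge \<omega> (\<lambda>xs. if xs = [] then 1 else 0) xs = \<omega> xs" .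
qed

lemma wedge_length:
  assumes "\<And>xs. length xs \<noteq> k \<Longrightarrow> \<alpha> xs = 0" "\<And>xs. length xs \<noteq> l \<Longrightarrow> \<beta> xs = 0"
    and "length xs \<noteq> k + l"
  shows "wedge \<alpha> \<beta> xs = 0"
  unfolding wedge_def
proof (rule sum.neutral, rule ballI)
  fix I
  have "length (nths xs I) \<noteq> k \<or> length (nths xs (- I)) \<noteq> l"
    using length_nths_add[of xs I] assms(3) by linarith
  then show "(- 1) ^ card {(i, j). i \<in> I \<and> j \<in> {..<length xs} - I \<and> j < i} *
        \<alpha> (nths xs I) * \<beta> (nths xs (- I)) = 0"
    using assms(1,2) by auto
qed

lemma inversions_eq: "{(i, j). i \<in> I \<and> j \<in> J \<and> j < i} = Set.filter (\<lambda>(i, j). j < (i::nat)) (I \<times> J)"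
  by auto

text \<open>Reduces the sign of a shuffle to writing down its inversions.\<close>

lemma inversion_number:
  assumes "Set.filter (\<lambda>(i, j). j < i) (I \<times> (J - I)) = A" "card A = n"
  shows "card {(i, j). i \<in> I \<and> j \<in> J - I \<and> j < (i::nat)} = n"
  using assms inversions_eq[of I "J - I"] by simp

lemma wedge_one_forms:
  assumes "\<alpha> [] = 0" "\<beta> [] = 0"
  shows "wedge \<alpha> \<beta> [x, y] = \<alpha> [x] * \<beta> [y] - \<alpha> [y] * \<beta> [x]"
proof -
  let ?xs = "[x, y]"
  let ?f = "\<lambda>I. (- 1) ^ card {(i, j). i \<in> I \<and> j \<in> {..<2} - I \<and> j < i} *
        \<alpha> (nths ?xs I) * \<beta> (nths ?xs (- I))"
  have n2: "{..<2::nat} = {0, 1}" by auto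
  have Pow2: "Pow {..<2::nat} = {{}, {0}, {1}, {0, 1}}" by (auto simp: n2 Pow_insert)
  have "card {(i, j). i \<in> {0} \<and> j \<in> {..<2} - {0} \<and> j < (i::nat)} = 0"
       "card {(i, j). i \<in> {1} \<and> j \<in> {..<2} - {1} \<and> j < (i::nat)} = 1"
    by (rule inversion_number[of _ _ "{}"], force, simp)
       (rule inversion_number[of _ _ "{(1, 0)}"], force simp: n2, simp)
  moreover have "wedge \<alpha> \<beta> ?xs = sum ?f (Pow {..<2})" by (simp add: wedge_def numeral_2_eq_2)
  moreover have "\<dots> = ?f {} + ?f {0} + ?f {1} + ?f {0, 1}"
    unfolding Pow2 by simp
  ultimately show ?thesis using assms by (simp add: nths_Cons)
qed

text \<open>Only the six subsets with two elements contribute, and complementary subsets contribute equally;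
  this is the origin of the factor 2.\<close>

lemma wedge_two_forms:
  fixes \<omega> :: "'a form"
  assumes \<omega>: "\<And>xs. length xs \<noteq> 2 \<Longrightarrow> \<omega> xs = 0" and sk: "\<And>x y. \<omega> [x, y] = - \<omega> [y, x]"
  shows "wedge \<omega> \<omega> [x, y, z, u] = 2 * pfaffian (\<lambda>x y. \<omega> [x, y]) x y z u"
proof -
  let ?xs = "[x, y, z, u]"
  let ?f = "\<lambda>I. (- 1) ^ card {(i, j). i \<in> I \<and> j \<in> {..<4} - I \<and> j < i} *
        \<omega> (nths ?xs I) * \<omega> (nths ?xs (- I))"
  let ?P = "{{0, 1}, {0, 2}, {0, 3}, {1, 2}, {1, 3}, {2, 3::nat}}"
  have n4: "{..<4::nat} = {0, 1, 2, 3}" by auto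
  have "wedge \<omega> \<omega> ?xs = sum ?f (Pow {..<4})" by (simp add: wedge_def numeral_eq_Suc)
  also have "\<dots> = sum ?f ?P"
  proof (rule sum.mono_neutral_right)
    show "\<forall>I\<in>Pow {..<4} - ?P. ?f I = 0"
    proof
      fix I assume "I \<in> Pow {..<4} - ?P"
      then have "I \<in> {{}, {0}, {1}, {2}, {3}, {0,1,2}, {0,1,3}, {0,2,3}, {1,2,3}, {0,1,2,3}}"
        by (simp add: n4 Pow_insert) (elim conjE disjE; simp)
      then have "length (nths ?xs I) \<noteq> 2"
        by (elim insertE emptyE) (simp_all add: nths_Cons)
      then show "?f I = 0" using \<omega> by simp
    qed
  qed auto
  also have "\<dots> = ?f {0, 1} + ?f {0, 2} + ?f {0, 3} + ?f {1, 2} + ?f {1, 3} + ?f {2, 3}"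
    by (simp add: doubleton_eq_iff)
  also have "\<dots> = 2 * pfaffian (\<lambda>x y. \<omega> [x, y]) x y z u"
  proof -
    have "card {(i, j). i \<in> {0, 1} \<and> j \<in> {..<4} - {0, 1} \<and> j < (i::nat)} = 0"
         "card {(i, j). i \<in> {0, 2} \<and> j \<in> {..<4} - {0, 2} \<and> j < (i::nat)} = 1"
         "card {(i, j). i \<in> {0, 3} \<and> j \<in> {..<4} - {0, 3} \<and> j < (i::nat)} = 2"
         "card {(i, j). i \<in> {1, 2} \<and> j \<in> {..<4} - {1, 2} \<and> j < (i::nat)} = 2"
         "card {(i, j). i \<in> {1, 3} \<and> j \<in> {..<4} - {1, 3} \<and> j < (i::nat)} = 3"
         "card {(i, j). i \<in> {2, 3} \<and> j \<in> {..<4} - {2, 3} \<and> j < (i::nat)} = 4"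
      apply (rule inversion_number[of _ _ "{}"], force simp: n4, simp)
      apply (rule inversion_number[of _ _ "{(2,1)}"], force simp: n4, simp)
      apply (rule inversion_number[of _ _ "{(3,1),(3,2)}"], force simp: n4, simp)
      apply (rule inversion_number[of _ _ "{(1,0),(2,0)}"], force simp: n4, simp)
      apply (rule inversion_number[of _ _ "{(1,0),(3,0),(3,2)}"], force simp: n4, simp)
      apply (rule inversion_number[of _ _ "{(2,0),(2,1),(3,0),(3,1)}"], force simp: n4, simp)
      done
    then show ?thesis
      by (simp add: nths_Cons pfaffian_def sk[of z x] sk[of u x] sk[of y x] sk[of z y] sk[of u y] sk[of u z])
  qed
  finally show ?thesis .
qed

lemma ce_diff_length:
  assumes "\<And>xs. length xs \<noteq> 2 \<Longrightarrow> \<omega> xs = 0" "length xs \<noteq> 3"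
  shows "ce_diff br \<omega> xs = 0"
  unfolding ce_diff_def
proof (rule sum.neutral, rule ballI)
  fix p assume "p \<in> {(i, j). i < j \<and> j < length xs}"
  then obtain i j where p: "p = (i, j)" and ij: "i < j" "j < length xs" by auto
  have "length (nths xs {i, j}) = card {i, j}"
    unfolding length_nths by (rule arg_cong[of _ _ card]) (use ij in auto)
  then have "length (nths xs (- {i, j})) \<noteq> 1"
    using length_nths_add[of xs "{i, j}"] assms(2) ij by auto
  then show "(case p of (i, j) \<Rightarrow> (- 1) ^ (i + j) * \<omega> (br (xs ! i) (xs ! j) # nths xs (- {i, j}))) = 0"
    using assms(1) p by auto
qed

lemma ce_diff_three:
  "ce_diff br \<omega> [x, y, z] = - \<omega> [br x y, z] + \<omega> [br x z, y] - \<omega> [br y z, x]"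
proof -
  have "{(i, j). i < j \<and> j < length [x, y, z]} = {(0, 1), (0, 2), (1, 2)}" by auto
  then show ?thesis by (simp add: ce_diff_def nths_Cons)
qed

lemma alternating_formD:
  fixes \<omega> :: "'a::real_vector form"
  assumes "alternating_form 2 \<omega>"
  shows "\<And>xs. length xs \<noteq> 2 \<Longrightarrow> \<omega> xs = 0" "bilinear (\<lambda>x y. \<omega> [x, y])"
    "\<And>x. \<omega> [x, x] = 0" "\<And>x y. \<omega> [x, y] = - \<omega> [y, x]"
proof -
  show "\<And>xs. length xs \<noteq> 2 \<Longrightarrow> \<omega> xs = 0" using assms by (simp add: alternating_form_def)
  have lin: "linear (\<lambda>x. \<omega> (xs[i := x]))" if "length xs = 2" "i < 2" for xs i
    using assms that by (simp add: alternating_form_def)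
  have l1: "linear (\<lambda>x. \<omega> [x, y])" for y using lin[of "[y, y]" 0] by simp
  have l2: "linear (\<lambda>y. \<omega> [x, y])" for x using lin[of "[x, x]" 1] by simp
  show "bilinear (\<lambda>x y. \<omega> [x, y])" using l1 l2 by (simp add: bilinear_def)
  have z: "\<omega> [x, x] = 0" for x using assms by (simp add: alternating_form_def)
  then show "\<And>x. \<omega> [x, x] = 0" .
  show "\<omega> [x, y] = - \<omega> [y, x]" for x y
    using z[of "x + y"] z[of x] z[of y]
    by (simp add: linear_add[OF l1] linear_add[OF l2])
qed

lemma finite_spanning_set:
  assumes "dim (UNIV :: 'a::real_vector set) = Suc n"
  shows "\<exists>B. finite B \<and> span B = (UNIV :: 'a set)"
proof -
  obtain B where "independent B" "span B = (UNIV :: 'a set)" "card B = Suc n"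
    using basis_exists[of "UNIV :: 'a set"] assms by (metis UNIV_I subsetI subset_antisym)
  then show ?thesis by (metis card.infinite nat.distinct(1))
qed

text \<open>This replaces forms on lists by their bilinear functions: closedness becomes the cyclic identity and
  nondegeneracy a condition on the Pfaffian.\<close>

lemma symplectic_form_iff:
  fixes br :: "'a::real_vector \<Rightarrow> 'a \<Rightarrow> 'a"
  assumes d: "dim (UNIV :: 'a set) = 4" 
  shows "symplectic_form br \<omega> \<longleftrightarrow> alternating_form 2 \<omega> \<and>
    (\<forall>x y z. \<omega> [br x y, z] - \<omega> [br x z, y] + \<omega> [br y z, x] = 0) \<and>
    (\<exists>x y z u. pfaffian (\<lambda>x y. \<omega> [x, y]) x y z u \<noteq> 0)"
proof (cases "alternating_form 2 \<omega>")
  case True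
  note alt = alternating_formD[OF True]
  have ce0: "(ce_diff br \<omega> = (\<lambda>xs. 0)) \<longleftrightarrow> (\<forall>x y z. ce_diff br \<omega> [x, y, z] = 0)"
  proof
    assume R: "\<forall>x y z. ce_diff br \<omega> [x, y, z] = 0"
    show "ce_diff br \<omega> = (\<lambda>xs. 0)"
    proof
      fix xs show "ce_diff br \<omega> xs = 0"
        using R ce_diff_length[of \<omega> xs br] alt(1)
        by (cases "length xs = 3") (auto simp: numeral_eq_Suc length_Suc_conv)
    qed
  qed simp
  have closed: "(ce_diff br \<omega> = (\<lambda>xs. 0)) \<longleftrightarrow> (\<forall>x y z. \<omega> [br x y, z] - \<omega> [br x z, y] + \<omega> [br y z, x] = 0)"
  proof -
    have "ce_diff br \<omega> [x, y, z] = 0 \<longleftrightarrow> \<omega> [br x y, z] - \<omega> [br x z, y] + \<omega> [br y z, x] = 0" for x y z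
      unfolding ce_diff_three by linarith
    then show ?thesis unfolding ce0 by blast
  qed
  have "wedge_power \<omega> 2 = wedge \<omega> \<omega>" by (simp add: numeral_2_eq_2 wedge_unit)
  moreover have "wedge \<omega> \<omega> = (\<lambda>xs. 0) \<longleftrightarrow> (\<forall>x y z u. wedge \<omega> \<omega> [x, y, z, u] = 0)"
  proof
    assume R: "\<forall>x y z u. wedge \<omega> \<omega> [x, y, z, u] = 0"
    show "wedge \<omega> \<omega> = (\<lambda>xs. 0)"
    proof
      fix xs show "wedge \<omega> \<omega> xs = 0"
        using R wedge_length[of 2 \<omega> 2 \<omega> xs] alt(1)
        by (cases "length xs = 4") (auto simp: numeral_eq_Suc length_Suc_conv)
    qed
  qed simp
  ultimately have "wedge_power \<omega> 2 \<noteq> (\<lambda>xs. 0) \<longleftrightarrow>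
      (\<exists>x y z u. pfaffian (\<lambda>x y. \<omega> [x, y]) x y z u \<noteq> 0)"
    using wedge_two_forms[of \<omega>, OF alt(1) alt(4)] by simp
  moreover have "(\<exists>n. dim (UNIV :: 'a set) = 2 * n \<and> wedge_power \<omega> n \<noteq> (\<lambda>xs. 0)) \<longleftrightarrow>
      wedge_power \<omega> 2 \<noteq> (\<lambda>xs. 0)"
  proof -
    have "4 = 2 * n \<longleftrightarrow> n = 2" for n :: nat by auto
    then show ?thesis using d by auto
  qed
  moreover have "\<exists>B. finite B \<and> span B = (UNIV :: 'a set)"
    using finite_spanning_set[of 3] d by simp
  ultimately show ?thesis
    unfolding symplectic_form_def closed using True by simp
qed (simp add: symplectic_form_def)

section \<open>Symplectic forms on four-dimensional space\<close>

lemma alternating_skew: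
  fixes f :: "'a::real_vector \<Rightarrow> 'a \<Rightarrow> 'b::real_vector"
  assumes "bilinear f" "\<And>x. f x x = 0"
  shows "f y x = - f x y"
  using assms(2)[of "x + y"] assms(2)[of x] assms(2)[of y]
  by (simp add: bilinear_ladd[OF assms(1)] bilinear_radd[OF assms(1)] eq_neg_iff_add_eq_0)

text \<open>The Pfaffian is multilinear and alternating in its four arguments, hence a multiple of the
  determinant with respect to the given basis. So nondegeneracy can be tested on any basis.\<close>

lemma pfaffian_zero:
  fixes w :: "'a::real_vector \<Rightarrow> 'a \<Rightarrow> real"
  assumes w: "bilinear w" and sk: "\<And>x y. w x y = - w y x"
    and sp: "span {b1, b2, b3, b4} = UNIV" and z: "pfaffian w b1 b2 b3 b4 = 0"
  shows "pfaffian w x y z u = 0"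
proof -
  have diag: "w x x = 0" for x using sk[of x x] by simp
  have l1: "linear (\<lambda>x. w x y)" and l2: "linear (\<lambda>y. w x y)" for x y
    using w by (simp_all add: bilinear_def)
  let ?B = "{b1, b2, b3, b4}"
  have lin: "linear (\<lambda>x. pfaffian w x y z u)" "linear (\<lambda>y. pfaffian w x y z u)"
    "linear (\<lambda>z. pfaffian w x y z u)" "linear (\<lambda>u. pfaffian w x y z u)" for x y z u
    by (rule linearI; simp add: pfaffian_def linear_add[OF l1] linear_add[OF l2]
          linear_cmul[OF l1] linear_cmul[OF l2] algebra_simps)+
  have swap: "pfaffian w y x z u = 0 \<longleftrightarrow> pfaffian w x y z u = 0"
    "pfaffian w x z y u = 0 \<longleftrightarrow> pfaffian w x y z u = 0"
    "pfaffian w x y u z = 0 \<longleftrightarrow> pfaffian w x y z u = 0" for x y z u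
    unfolding pfaffian_def using sk[of y x] sk[of z y] sk[of u z] by (auto simp: algebra_simps)
  have rep: "pfaffian w x x z u = 0" "pfaffian w x y y u = 0" "pfaffian w x y z z = 0" for x y z u
    using sk[of y x] by (simp_all add: pfaffian_def diag)
  have base: "pfaffian w x y z u = 0" if "x \<in> ?B" "y \<in> ?B" "z \<in> ?B" "u \<in> ?B" for x y z u
    using that z by (elim insertE emptyE) (simp_all add: swap rep)
  have span: "x \<in> span ?B" for x using sp by simp
  have 1: "pfaffian w x y z u = 0" if "y \<in> ?B" "z \<in> ?B" "u \<in> ?B" for x y z u
    by (rule linear_eq_0_on_span[OF lin(1) _ span]) (rule base[OF _ that])
  have 2: "pfaffian w x y z u = 0" if "z \<in> ?B" "u \<in> ?B" for x y z u
    by (rule linear_eq_0_on_span[OF lin(2) _ span]) (rule 1[OF _ that])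
  have 3: "pfaffian w x y z u = 0" if "u \<in> ?B" for x y z u
    by (rule linear_eq_0_on_span[OF lin(3) _ span]) (rule 2[OF _ that])
  show ?thesis
    by (rule linear_eq_0_on_span[OF lin(4) _ span]) (rule 3)
qed

definition two_form :: "real \<Rightarrow> real \<Rightarrow> real \<Rightarrow> real \<Rightarrow> real \<Rightarrow> real \<Rightarrow> (real^4) form" where
  "two_form a12 a13 a14 a23 a24 a34 = (\<lambda>v. a12 * ew 1 2 v + a13 * ew 1 3 v + a14 * ew 1 4 v
     + a23 * ew 2 3 v + a24 * ew 2 4 v + a34 * ew 3 4 v)"

lemma ew_pair: "ew i j [x, y] = x $ i * y $ j - y $ i * x $ j"
  by (simp add: wedge_one_forms dual_e_def)

lemma ew_length: "length xs \<noteq> 2 \<Longrightarrow> ew i j xs = 0"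
  by (rule wedge_length[where k = 1 and l = 1]) (auto simp: dual_e_def split: list.splits)

lemma two_form_pair: "two_form a12 a13 a14 a23 a24 a34 [x, y] =
    a12 * (x $ 1 * y $ 2 - y $ 1 * x $ 2) + a13 * (x $ 1 * y $ 3 - y $ 1 * x $ 3)
  + a14 * (x $ 1 * y $ 4 - y $ 1 * x $ 4) + a23 * (x $ 2 * y $ 3 - y $ 2 * x $ 3)
  + a24 * (x $ 2 * y $ 4 - y $ 2 * x $ 4) + a34 * (x $ 3 * y $ 4 - y $ 3 * x $ 4)"
  by (simp add: two_form_def ew_pair)

lemma length_2_conv: "length xs = 2 \<longleftrightarrow> (\<exists>x y. xs = [x, y])"
  by (auto simp: numeral_2_eq_2 length_Suc_conv)

lemma alternating_two_form: "alternating_form 2 (two_form a12 a13 a14 a23 a24 a34)"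
  unfolding alternating_form_def
proof (intro conjI allI impI)
  fix xs :: "(real^4) list" assume "length xs \<noteq> 2"
  then show "two_form a12 a13 a14 a23 a24 a34 xs = 0" by (simp add: two_form_def ew_length)
next
  fix xs :: "(real^4) list" and i :: nat assume "length xs = 2 \<and> i < 2"
  moreover from this obtain x y where "xs = [x, y]" by (auto simp: length_2_conv)
  moreover have "linear (\<lambda>x. two_form a12 a13 a14 a23 a24 a34 [x, y])"
    "linear (\<lambda>y. two_form a12 a13 a14 a23 a24 a34 [x, y])"
    by (rule linearI; simp add: two_form_pair algebra_simps)+
  ultimately show "linear (\<lambda>x. two_form a12 a13 a14 a23 a24 a34 (xs[i := x]))"
    by (auto simp: less_2_cases_iff)
next
  fix xs :: "(real^4) list" assume nd: "\<not> distinct xs"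
  show "two_form a12 a13 a14 a23 a24 a34 xs = 0"
  proof (cases "length xs = 2")
    case True
    then show ?thesis using nd by (auto simp: length_2_conv two_form_pair)
  qed (simp add: two_form_def ew_length)
qed

lemma span_axis4: "span {e 1, e 2, e 3, e 4} = UNIV"
proof -
  have "x \<in> span {e 1, e 2, e 3, e 4}" for x :: "real^4"
  proof -
    have "x = (\<Sum>i\<in>UNIV. x $ i *\<^sub>R e i)"
      by (simp add: basis_expansion scalar_mult_eq_scaleR[symmetric])
    also have "\<dots> = x $ 1 *\<^sub>R e 1 + x $ 2 *\<^sub>R e 2 + x $ 3 *\<^sub>R e 3 + x $ 4 *\<^sub>R e 4"
      by (simp add: sum_4)
    also have "\<dots> \<in> span {e 1, e 2, e 3, e 4}"
      by (intro span_add span_mul span_base) auto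
    finally show ?thesis .
  qed
  then show ?thesis by auto
qed

lemma axis4 [simp]:
  "e 1 $ 1 = 1" "e 1 $ 2 = 0" "e 1 $ 3 = 0" "e 1 $ 4 = 0"
  "e 2 $ 1 = 0" "e 2 $ 2 = 1" "e 2 $ 3 = 0" "e 2 $ 4 = 0"
  "e 3 $ 1 = 0" "e 3 $ 2 = 0" "e 3 $ 3 = 1" "e 3 $ 4 = 0"
  "e 4 $ 1 = 0" "e 4 $ 2 = 0" "e 4 $ 3 = 0" "e 4 $ 4 = 1"
  by (simp_all add: axis_def)

lemma bilinear_eqI_axis:
  fixes w w' :: "real^4 \<Rightarrow> real^4 \<Rightarrow> 'b::real_vector"
  assumes w: "bilinear w" "\<And>x. w x x = 0" and w': "bilinear w'" "\<And>x. w' x x = 0"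
    and "w (e 1) (e 2) = w' (e 1) (e 2)" "w (e 1) (e 3) = w' (e 1) (e 3)"
    "w (e 1) (e 4) = w' (e 1) (e 4)" "w (e 2) (e 3) = w' (e 2) (e 3)"
    "w (e 2) (e 4) = w' (e 2) (e 4)" "w (e 3) (e 4) = w' (e 3) (e 4)"
  shows "w x y = w' x y"
proof -
  note sk = alternating_skew
  let ?B = "{e 1, e 2, e 3, e 4}"
  have swap: "w y x = w' y x \<longleftrightarrow> w x y = w' x y" for x y
    using sk[OF w, of y x] sk[OF w', of y x] by simp
  have base: "w x y = w' x y" if "x \<in> ?B" "y \<in> ?B" for x y
    using that assms(5-) by (elim insertE emptyE) (simp_all add: swap w(2) w'(2))
  have U: "UNIV \<subseteq> span ?B" using span_axis4 by simp
  show ?thesis by (rule bilinear_eq[OF w(1) w'(1) U U UNIV_I UNIV_I base])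
qed

lemma alternating_two_form_iff:
  "alternating_form 2 \<omega> \<longleftrightarrow> (\<exists>a12 a13 a14 a23 a24 a34. \<omega> = two_form a12 a13 a14 a23 a24 a34)"
proof
  assume alt: "alternating_form 2 \<omega>"
  let ?t = "two_form (\<omega> [e 1, e 2]) (\<omega> [e 1, e 3]) (\<omega> [e 1, e 4]) (\<omega> [e 2, e 3]) (\<omega> [e 2, e 4]) (\<omega> [e 3, e 4])"
  note D = alternating_formD[OF alt] and T = alternating_formD[OF alternating_two_form]
  have pair: "\<omega> [x, y] = ?t [x, y]" for x y
    by (rule bilinear_eqI_axis[OF D(2,3) T(2,3)]) (simp_all add: two_form_pair)
  have "\<omega> xs = ?t xs" for xs
  proof (cases "length xs = 2")
    case True
    then obtain x y where xs: "xs = [x, y]" by (auto simp: length_2_conv)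
    show ?thesis unfolding xs by (rule pair)
  next
    case False
    then show ?thesis using D(1) T(1) by simp
  qed
  then show "\<exists>a12 a13 a14 a23 a24 a34. \<omega> = two_form a12 a13 a14 a23 a24 a34" by blast
qed (auto simp: alternating_two_form)

text \<open>The function T is trilinear and alternating, so it vanishes once it vanishes on the increasing
  triples of basis vectors. For a form w this is the closedness condition; for \<open>w = M\<close> it is
  the Jacobi identity.\<close>

lemma closed_iff_axis:
  fixes M :: "real^4 \<Rightarrow> real^4 \<Rightarrow> real^4" and w :: "real^4 \<Rightarrow> real^4 \<Rightarrow> 'b::real_vector"
  assumes M: "bilinear M" "\<And>x. M x x = 0" and w: "bilinear w" "\<And>x. w x x = 0"
  defines "T \<equiv> \<lambda>x y z. w (M x y) z - w (M x z) y + w (M y z) x"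
  shows "(\<forall>x y z. T x y z = 0) \<longleftrightarrow> T (e 1) (e 2) (e 3) = 0 \<and> T (e 1) (e 2) (e 4) = 0
    \<and> T (e 1) (e 3) (e 4) = 0 \<and> T (e 2) (e 3) (e 4) = 0"
proof
  have sk: "M y x = - M x y" for x y
    by (rule alternating_skew[OF M])
  have swap: "T y x z = - T x y z" "T x z y = - T x y z" for x y z
    using sk[of x y] sk[of y z] by (simp_all add: T_def bilinear_lneg[OF w(1)])
  have swap0: "T y x z = 0 \<longleftrightarrow> T x y z = 0" "T x z y = 0 \<longleftrightarrow> T x y z = 0" for x y z
    by (simp_all add: swap(1)[of y x] swap(2)[of x y])
  have rep: "T x x y = 0" "T x y y = 0" for x y
    by (simp_all add: T_def M(2) bilinear_lzero[OF w(1)])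
  assume *: "T (e 1) (e 2) (e 3) = 0 \<and> T (e 1) (e 2) (e 4) = 0
    \<and> T (e 1) (e 3) (e 4) = 0 \<and> T (e 2) (e 3) (e 4) = 0"
  let ?B = "{e 1, e 2, e 3, e 4}"
  have base: "T x y z = 0" if "x \<in> ?B" "y \<in> ?B" "z \<in> ?B" for x y z
    using that * by (elim insertE emptyE) (simp_all add: swap0 rep)
  have lin: "linear (\<lambda>x. T x y z)" "linear (\<lambda>y. T x y z)" "linear (\<lambda>z. T x y z)" for x y z
    by (rule linearI; simp add: T_def bilinear_ladd[OF M(1)] bilinear_radd[OF M(1)]
      bilinear_ladd[OF w(1)] bilinear_radd[OF w(1)] bilinear_lmul[OF M(1)] bilinear_rmul[OF M(1)]
      bilinear_lmul[OF w(1)] bilinear_rmul[OF w(1)] algebra_simps)+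
  have span: "x \<in> span ?B" for x using span_axis4 by simp
  have 1: "T x y z = 0" if "y \<in> ?B" "z \<in> ?B" for x y z
    by (rule linear_eq_0_on_span[OF lin(1) _ span]) (rule base[OF _ that])
  have 2: "T x y z = 0" if "z \<in> ?B" for x y z
    by (rule linear_eq_0_on_span[OF lin(2) _ span]) (rule 1[OF _ that])
  show "\<forall>x y z. T x y z = 0"
    using linear_eq_0_on_span[OF lin(3) 2 span] by simp
qed simp

text \<open>The symplectic forms of M are described by a condition on the six coefficients, to be supplied as
  the solution Q of the four linear equations of closedness and the Pfaffian inequality.\<close>

lemma symplectic_forms_eq:
  fixes M :: "real^4 \<Rightarrow> real^4 \<Rightarrow> real^4"
  assumes M: "bilinear M" "\<And>x. M x x = 0"
    and Q: "\<And>a12 a13 a14 a23 a24 a34. let w = (\<lambda>x y. two_form a12 a13 a14 a23 a24 a34 [x, y]);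
        T = (\<lambda>x y z. w (M x y) z - w (M x z) y + w (M y z) x) in
       (T (e 1) (e 2) (e 3) = 0 \<and> T (e 1) (e 2) (e 4) = 0 \<and> T (e 1) (e 3) (e 4) = 0
       \<and> T (e 2) (e 3) (e 4) = 0) \<and> a12 * a34 - a13 * a24 + a14 * a23 \<noteq> 0
       \<longleftrightarrow> Q a12 a13 a14 a23 a24 a34"
  shows "{\<omega>. symplectic_form M \<omega>} = {\<omega>. \<exists>a12 a13 a14 a23 a24 a34.
    \<omega> = two_form a12 a13 a14 a23 a24 a34 \<and> Q a12 a13 a14 a23 a24 a34}"
proof -
  have key: "symplectic_form M (two_form a12 a13 a14 a23 a24 a34) \<longleftrightarrow> Q a12 a13 a14 a23 a24 a34"
    for a12 a13 a14 a23 a24 a34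
  proof -
    let ?t = "two_form a12 a13 a14 a23 a24 a34"
    note T = alternating_formD[OF alternating_two_form[of a12 a13 a14 a23 a24 a34]]
    have pf: "pfaffian (\<lambda>x y. ?t [x, y]) (e 1) (e 2) (e 3) (e 4) = a12 * a34 - a13 * a24 + a14 * a23"
      by (simp add: pfaffian_def two_form_pair)
    have "(\<exists>x y z u. pfaffian (\<lambda>x y. ?t [x, y]) x y z u \<noteq> 0) \<longleftrightarrow> a12 * a34 - a13 * a24 + a14 * a23 \<noteq> 0"
      using pfaffian_zero[OF T(2,4) span_axis4] pf by metis
    moreover have "dim (UNIV :: (real^4) set) = 4" by simp
    ultimately show ?thesis
      using Q[of a12 a13 a14 a23 a24 a34]
      by (simp add: symplectic_form_iff alternating_two_form closed_iff_axis[OF M T(2,3)] Let_def)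
  qed
  have form: "\<exists>a12 a13 a14 a23 a24 a34. \<omega> = two_form a12 a13 a14 a23 a24 a34"
    if "symplectic_form M \<omega>" for \<omega>
    using that alternating_two_form_iff by (simp add: symplectic_form_def)
  show ?thesis
  proof (intro set_eqI iffI; unfold mem_Collect_eq)
    fix \<omega> assume \<omega>: "symplectic_form M \<omega>"
    with form obtain a12 a13 a14 a23 a24 a34 where "\<omega> = two_form a12 a13 a14 a23 a24 a34" by blast
    with \<omega> show "\<exists>a12 a13 a14 a23 a24 a34. \<omega> = two_form a12 a13 a14 a23 a24 a34 \<and> Q a12 a13 a14 a23 a24 a34"
      using key by blast
  qed (use key in blast)
qed

section \<open>Verification of the table\<close>

lemma bracket_simps: "bracket [] x y = 0"
  "bracket ((i, j, v) # L) x y = (x $ i * y $ j - x $ j * y $ i) *\<^sub>R v + bracket L x y"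
  by (simp_all add: bracket_def)

lemma bracket_diag: "bracket L x x = 0"
  by (simp add: bracket_def sum_list_0 split_def)

lemma bilinear_bracket: "bilinear (bracket L)"
proof (induction L)
  case Nil
  then show ?case by (simp add: bilinear_def bracket_simps linear_iff)
next
  case (Cons p L)
  obtain i j v where p: "p = (i, j, v)" by (cases p)
  show ?case unfolding bilinear_def p
    by (intro conjI allI; rule linearI)
      (simp_all add: bracket_simps bilinear_ladd[OF Cons] bilinear_radd[OF Cons]
        bilinear_lmul[OF Cons] bilinear_rmul[OF Cons] algebra_simps)
qed

lemma lie_algebra_bracket:
  defines "J \<equiv> \<lambda>L x y z. bracket L (bracket L x y) z - bracket L (bracket L x z) y + bracket L (bracket L y z) x"
  assumes "J L (e 1) (e 2) (e 3) = 0 \<and> J L (e 1) (e 2) (e 4) = 0 \<and> J L (e 1) (e 3) (e 4) = 0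
    \<and> J L (e 2) (e 3) (e 4) = 0"
  shows "lie_algebra (bracket L)"
proof -
  let ?M = "bracket L"
  note sk = alternating_skew[OF bilinear_bracket bracket_diag]
  have "\<forall>x y z. J L x y z = 0"
    unfolding J_def using assms
    by (subst closed_iff_axis[OF bilinear_bracket bracket_diag bilinear_bracket bracket_diag]) simp
  moreover have "?M x (?M y z) + ?M y (?M z x) + ?M z (?M x y) = - J L x y z" for x y z
    using sk[of L x "?M y z"] sk[of L y "?M z x"] sk[of L z "?M x y"] sk[of L z x]
    by (simp add: J_def bilinear_lneg[OF bilinear_bracket] bilinear_rneg[OF bilinear_bracket])
  ultimately show ?thesis by (simp add: lie_algebra_def bilinear_bracket bracket_diag)
qed

lemmas table_defs = rh3_def rr3_def rr3'_0_def r2r2_def r2'_def n4_def r4_mu_def r4_alpha_beta_def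
  r4'_def d4_def d4'_def h4_def

lemma listed_lie_algebra:
  assumes "listed M S"
  shows "lie_algebra M"
proof -
  have L1: "lie_algebra rh3" "lie_algebra rr3'_0" "lie_algebra r2r2" "lie_algebra r2'"
    "lie_algebra n4" "lie_algebra h4"
    unfolding table_defs
    by (rule lie_algebra_bracket; simp add: bracket_simps vec_eq_iff[of _ 0] forall_4 algebra_simps)+
  have L2: "lie_algebra (rr3 l)" "lie_algebra (r4_mu l)" "lie_algebra (r4_alpha_beta l l')"
    "lie_algebra (r4' l l')" "lie_algebra (d4 l)" "lie_algebra (d4' l)" for l l'
    unfolding table_defs
    by (rule lie_algebra_bracket; simp add: bracket_simps vec_eq_iff[of _ 0] forall_4 algebra_simps)+
  show ?thesis using assms by cases (simp_all only: L1 L2)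
qed

lemma bracket_symplectic_forms_eq:
  assumes "\<And>a12 a13 a14 a23 a24 a34. let w = (\<lambda>x y. two_form a12 a13 a14 a23 a24 a34 [x, y]);
        T = (\<lambda>x y z. w (bracket L x y) z - w (bracket L x z) y + w (bracket L y z) x) in
       (T (e 1) (e 2) (e 3) = 0 \<and> T (e 1) (e 2) (e 4) = 0 \<and> T (e 1) (e 3) (e 4) = 0
       \<and> T (e 2) (e 3) (e 4) = 0) \<and> a12 * a34 - a13 * a24 + a14 * a23 \<noteq> 0
       \<longleftrightarrow> Q a12 a13 a14 a23 a24 a34"
    and "{\<omega>. \<exists>a12 a13 a14 a23 a24 a34.
      \<omega> = two_form a12 a13 a14 a23 a24 a34 \<and> Q a12 a13 a14 a23 a24 a34} = S"
  shows "{\<omega>. symplectic_form (bracket L) \<omega>} = S"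
  using symplectic_forms_eq[OF bilinear_bracket bracket_diag assms(1)] assms(2) by simp

text \<open>In each case Q is the solved form of the linear system. Where the bracket has a parameter, the
  range of the parameter is what makes the relevant coefficient (such as \<open>\<beta> + 1\<close> or \<open>\<delta>\<^sup>2 + 1\<close>) invertible.\<close>

lemma listed_symplectic_forms:
  assumes "listed M S"
  shows "{\<omega>. symplectic_form M \<omega>} = S"
  using assms
proof cases
  case rh3
  show ?thesis
    unfolding rh3(1,2) table_defs
    by (rule bracket_symplectic_forms_eq[where Q = "\<lambda>a12 a13 a14 a23 a24 a34.
      a34 = 0 \<and> a14 * a23 - a13 * a24 \<noteq> 0"],
        force simp: Let_def bracket_simps two_form_pair,
        simp add: two_form_def algebra_simps)
next
  case rr3_0
  show ?thesis
    unfolding rr3_0(1,2) table_defs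
    by (rule bracket_symplectic_forms_eq[where Q = "\<lambda>a12 a13 a14 a23 a24 a34.
      a23 = 0 \<and> a24 = 0 \<and> a12 * a34 \<noteq> 0"],
        force simp: Let_def bracket_simps two_form_pair,
        simp add: two_form_def algebra_simps)
next
  case rr3_m1
  show ?thesis
    unfolding rr3_m1(1,2) table_defs
    by (rule bracket_symplectic_forms_eq[where Q = "\<lambda>a12 a13 a14 a23 a24 a34.
      a24 = 0 \<and> a34 = 0 \<and> a14 * a23 \<noteq> 0"],
        force simp: Let_def bracket_simps two_form_pair,
        simp add: two_form_def algebra_simps)
next
  case rr3'_0
  show ?thesis
    unfolding rr3'_0(1,2) table_defs
    by (rule bracket_symplectic_forms_eq[where Q = "\<lambda>a12 a13 a14 a23 a24 a34.
      a24 = 0 \<and> a34 = 0 \<and> a14 * a23 \<noteq> 0"],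
        force simp: Let_def bracket_simps two_form_pair,
        simp add: two_form_def algebra_simps)
next
  case r2r2
  show ?thesis
    unfolding r2r2(1,2) table_defs
    by (rule bracket_symplectic_forms_eq[where Q = "\<lambda>a12 a13 a14 a23 a24 a34.
      a14 = 0 \<and> a23 = 0 \<and> a24 = 0 \<and> a12 * a34 \<noteq> 0"],
        force simp: Let_def bracket_simps two_form_pair,
        simp add: two_form_def algebra_simps)
next
  case r2'
  show ?thesis
    unfolding r2'(1,2) table_defs
    by (rule bracket_symplectic_forms_eq[where Q = "\<lambda>a12 a13 a14 a23 a24 a34.
      a34 = 0 \<and> a24 = - a13 \<and> a23 = a14 \<and> a13\<^sup>2 + a14\<^sup>2 \<noteq> 0"],
        force simp: Let_def bracket_simps two_form_pair,
        simp add: two_form_def algebra_simps)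
next
  case n4
  show ?thesis
    unfolding n4(1,2) table_defs
    by (rule bracket_symplectic_forms_eq[where Q = "\<lambda>a12 a13 a14 a23 a24 a34.
      a13 = 0 \<and> a23 = 0 \<and> a12 * a34 \<noteq> 0"],
        force simp: Let_def bracket_simps two_form_pair,
        simp add: two_form_def algebra_simps)
next
  case r4_0
  show ?thesis
    unfolding r4_0(1,2) table_defs
    by (rule bracket_symplectic_forms_eq[where Q = "\<lambda>a12 a13 a14 a23 a24 a34.
      a12 = 0 \<and> a13 = 0 \<and> a14 * a23 \<noteq> 0"],
        force simp: Let_def bracket_simps two_form_pair,
        simp add: two_form_def algebra_simps)
next
  case r4_m1
  show ?thesis
    unfolding r4_m1(1,2) table_defs
    by (rule bracket_symplectic_forms_eq[where Q = "\<lambda>a12 a13 a14 a23 a24 a34.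
      a12 = 0 \<and> a23 = 0 \<and> a13 * a24 \<noteq> 0"],
        force simp: Let_def bracket_simps two_form_pair,
        simp add: two_form_def algebra_simps)
next
  case (r4_m1_beta \<beta>)
  show ?thesis
    unfolding r4_m1_beta(1,2) table_defs
  proof (rule bracket_symplectic_forms_eq[where Q = "\<lambda>a12 a13 a14 a23 a24 a34.
      a13 = 0 \<and> a23 = 0 \<and> a12 * a34 \<noteq> 0"], goal_cases)
    case (1 a12 a13 a14 a23 a24 a34)
    have "\<beta> * a13 = - a13 \<longleftrightarrow> (\<beta> + 1) * a13 = 0" by (auto simp: algebra_simps)
    then have a13: "\<beta> * a13 = - a13 \<longleftrightarrow> a13 = 0" using r4_m1_beta(3) by simp
    show ?case using r4_m1_beta(3-)
      by (auto simp: Let_def bracket_simps two_form_pair algebra_simps a13)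
  next
    case 2
    show ?case by (simp add: two_form_def algebra_simps)
  qed
next
  case r4_m1_m1
  show ?thesis
    unfolding r4_m1_m1(1,2) table_defs
    by (rule bracket_symplectic_forms_eq[where Q = "\<lambda>a12 a13 a14 a23 a24 a34.
      a23 = 0 \<and> a12 * a34 - a13 * a24 \<noteq> 0"],
        force simp: Let_def bracket_simps two_form_pair,
        simp add: two_form_def algebra_simps)
next
  case (r4_alpha_malpha \<alpha>)
  show ?thesis
    unfolding r4_alpha_malpha(1,2) table_defs
  proof (rule bracket_symplectic_forms_eq[where Q = "\<lambda>a12 a13 a14 a23 a24 a34.
      a12 = 0 \<and> a13 = 0 \<and> a14 * a23 \<noteq> 0"], goal_cases)
    case (1 a12 a13 a14 a23 a24 a34)
    have "\<alpha> * a12 = - a12 \<longleftrightarrow> (\<alpha> + 1) * a12 = 0" by (auto simp: algebra_simps)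
    then have a12: "\<alpha> * a12 = - a12 \<longleftrightarrow> a12 = 0" using r4_alpha_malpha(3) by simp
    show ?case using r4_alpha_malpha(3-)
      by (auto simp: Let_def bracket_simps two_form_pair algebra_simps a12)
  next
    case 2
    show ?case by (simp add: two_form_def algebra_simps)
  qed
next
  case (r4'_0_delta \<delta>)
  show ?thesis
    unfolding r4'_0_delta(1,2) table_defs
  proof (rule bracket_symplectic_forms_eq[where Q = "\<lambda>a12 a13 a14 a23 a24 a34.
      a12 = 0 \<and> a13 = 0 \<and> a14 * a23 \<noteq> 0"], goal_cases)
    case (1 a12 a13 a14 a23 a24 a34)
    have "\<delta> * (\<delta> * a13) = - a13 \<longleftrightarrow> (\<delta> * \<delta> + 1) * a13 = 0" by (auto simp: algebra_simps)
    moreover have "\<delta> * \<delta> + 1 > 0" using r4'_0_delta(3) by (simp add: add_pos_pos)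
    ultimately have a13: "\<delta> * (\<delta> * a13) = - a13 \<longleftrightarrow> a13 = 0" by simp
    show ?case using r4'_0_delta(3-)
      by (auto simp: Let_def bracket_simps two_form_pair algebra_simps a13)
  next
    case 2
    show ?case by (simp add: two_form_def algebra_simps)
  qed
next
  case d4_1
  show ?thesis
    unfolding d4_1(1,2) table_defs
    by (rule bracket_symplectic_forms_eq[where Q = "\<lambda>a12 a13 a14 a23 a24 a34.
      a34 = - a12 \<and> a13 = 0 \<and> a23 = 0 \<and> a12 \<noteq> 0"],
        force simp: Let_def bracket_simps two_form_pair,
        simp add: two_form_def algebra_simps)
next
  case d4_2
  show ?thesis
    unfolding d4_2(1,2) table_defs
  proof (rule bracket_symplectic_forms_eq[where Q = "\<lambda>a12 a13 a14 a23 a24 a34.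
      a34 = - a12 \<and> a13 = 0 \<and> - (a12\<^sup>2) + a14 * a23 \<noteq> 0"], goal_cases)
    case (1 a12 a13 a14 a23 a24 a34)
    show ?case
      by (auto simp: Let_def bracket_simps two_form_pair algebra_simps power2_eq_square)
  next
    case 2
    show ?case by (simp add: two_form_def algebra_simps)
  qed
next
  case (d4_lambda l)
  show ?thesis
    unfolding d4_lambda(1,2) table_defs
  proof (rule bracket_symplectic_forms_eq[where Q = "\<lambda>a12 a13 a14 a23 a24 a34.
      a34 = - a12 \<and> a13 = 0 \<and> a23 = 0 \<and> a12 \<noteq> 0"], goal_cases)
    case (1 a12 a13 a14 a23 a24 a34)
    have "a13 = - (a13 * l) \<longleftrightarrow> (l + 1) * a13 = 0" by (auto simp: algebra_simps)
    then have a13: "a13 = - (a13 * l) \<longleftrightarrow> a13 = 0" using d4_lambda(3) by simp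
    show ?case using d4_lambda(3-)
      by (auto simp: Let_def bracket_simps two_form_pair algebra_simps a13)
  next
    case 2
    show ?case by (simp add: two_form_def algebra_simps)
  qed
next
  case (d4'_delta \<delta>)
  show ?thesis
    unfolding d4'_delta(1,2) table_defs
  proof (rule bracket_symplectic_forms_eq[where Q = "\<lambda>a12 a13 a14 a23 a24 a34.
      a34 = - \<delta> * a12 \<and> a13 = 0 \<and> a23 = 0 \<and> a12 \<noteq> 0"], goal_cases)
    case (1 a12 a13 a14 a23 a24 a34)
    have a13_a23: "a13 = 0 \<and> a23 = 0"
      if "\<delta> * (a13 * 3) = a23 * 2" "\<delta> * (a23 * 3) = - (a13 * 2)"
    proof -
      have "(9 * (\<delta> * \<delta>) + 4) * a13 = 0" using that by algebra
      moreover have "9 * (\<delta> * \<delta>) + 4 > 0" using d4'_delta(3) by (simp add: add_pos_pos)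
      ultimately show ?thesis using that by simp
    qed
    show ?case using d4'_delta(3-)
      by (auto simp: Let_def bracket_simps two_form_pair algebra_simps dest: a13_a23)
  next
    case 2
    show ?case by (simp add: two_form_def algebra_simps)
  qed
next
  case h4
  show ?thesis
    unfolding h4(1,2) table_defs
    by (rule bracket_symplectic_forms_eq[where Q = "\<lambda>a12 a13 a14 a23 a24 a34.
      a34 = - a12 \<and> a13 = 0 \<and> a23 = 0 \<and> a12 \<noteq> 0"],
        force simp: Let_def bracket_simps two_form_pair,
        simp add: two_form_def algebra_simps)
qed

lemma listed_d4: "l \<ge> 1 / 2 \<Longrightarrow> \<exists>S. listed (d4 l) S"
  using d4_1 d4_2 d4_lambda by (cases "l = 1"; cases "l = 2"; blast)

section \<open>Frames\<close>

text \<open>In dimension four a spanning quadruple is a basis. Spanning is preferred to independence as the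
  definition because a change of basis is then verified by expressing the old vectors in the new ones.\<close>

definition frame :: "'a::real_vector \<Rightarrow> 'a \<Rightarrow> 'a \<Rightarrow> 'a \<Rightarrow> bool" where
  "frame b1 b2 b3 b4 \<longleftrightarrow> span {b1, b2, b3, b4} = UNIV"

definition lincomb :: "'a::real_vector \<Rightarrow> 'a \<Rightarrow> 'a \<Rightarrow> 'a \<Rightarrow> real^4 \<Rightarrow> 'a" where
  "lincomb b1 b2 b3 b4 v = v $ 1 *\<^sub>R b1 + v $ 2 *\<^sub>R b2 + v $ 3 *\<^sub>R b3 + v $ 4 *\<^sub>R b4"

lemma linear_lincomb: "linear (lincomb b1 b2 b3 b4)"
  by (rule linearI) (simp_all add: lincomb_def algebra_simps)

lemma in_span3_iff: "x \<in> span {b1, b2, b3} \<longleftrightarrow> (\<exists>p q r. x = p *\<^sub>R b1 + q *\<^sub>R b2 + r *\<^sub>R b3)"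
  by (simp add: span_insert algebra_simps diff_eq_eq)

lemma in_span4_iff: "x \<in> span {b1, b2, b3, b4} \<longleftrightarrow>
    (\<exists>p q r s. x = p *\<^sub>R b1 + q *\<^sub>R b2 + r *\<^sub>R b3 + s *\<^sub>R b4)"
  by (simp add: span_insert algebra_simps diff_eq_eq)

lemma frame_change:
  assumes "frame b1 b2 b3 b4"
    and "b1 \<in> span {c1, c2, c3, c4}" "b2 \<in> span {c1, c2, c3, c4}"
    "b3 \<in> span {c1, c2, c3, c4}" "b4 \<in> span {c1, c2, c3, c4}"
  shows "frame c1 c2 c3 c4"
proof -
  have "span {b1, b2, b3, b4} \<subseteq> span {c1, c2, c3, c4}"
    using assms(2-) by (intro span_minimal) auto
  then show ?thesis using assms(1) by (auto simp: frame_def)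
qed

lemma span_block:
  fixes b1 b2 :: "'a::real_vector"
  assumes d: "p * s - q * r \<noteq> 0"
  shows "span (insert (p *\<^sub>R b1 + q *\<^sub>R b2) (insert (r *\<^sub>R b1 + s *\<^sub>R b2) X)) = span (insert b1 (insert b2 X))"
    (is "span ?U = span ?B")
proof
  let ?u = "p *\<^sub>R b1 + q *\<^sub>R b2" and ?v = "r *\<^sub>R b1 + s *\<^sub>R b2" and ?d = "p * s - q * r"
  show "span ?U \<subseteq> span ?B"
    by (rule span_minimal) (auto intro!: span_add span_mul intro: span_base)
  have "s *\<^sub>R ?u - q *\<^sub>R ?v \<in> span ?U" "p *\<^sub>R ?v - r *\<^sub>R ?u \<in> span ?U"
    by (intro span_diff span_mul span_base; simp)+
  moreover have "s *\<^sub>R ?u - q *\<^sub>R ?v = ?d *\<^sub>R b1" "p *\<^sub>R ?v - r *\<^sub>R ?u = ?d *\<^sub>R b2"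
    by (simp_all add: algebra_simps)
  ultimately have "?d *\<^sub>R b1 \<in> span ?U" "?d *\<^sub>R b2 \<in> span ?U" by simp_all
  then have "b1 \<in> span ?U" "b2 \<in> span ?U"
    using d span_mul[of "?d *\<^sub>R b1" ?U "1 / ?d"] span_mul[of "?d *\<^sub>R b2" ?U "1 / ?d"] by simp_all
  then show "span ?B \<subseteq> span ?U" by (intro span_minimal) (auto intro: span_base)
qed

lemma frame_block:
  assumes "frame b1 b2 b3 b4" "p * s - q * r \<noteq> 0"
  shows "frame (p *\<^sub>R b1 + q *\<^sub>R b2) (r *\<^sub>R b1 + s *\<^sub>R b2) b3 b4"
  using assms(1) unfolding frame_def span_block[OF assms(2)] .

lemma frame_scale:
  assumes F: "frame b1 b2 b3 b4" and "k \<noteq> 0"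
  shows "frame b1 b2 b3 (k *\<^sub>R b4)"
proof (intro frame_change[OF F])
  have "(1 / k) *\<^sub>R k *\<^sub>R b4 \<in> span {b1, b2, b3, k *\<^sub>R b4}" by (intro span_mul span_base) simp
  then show "b4 \<in> span {b1, b2, b3, k *\<^sub>R b4}" using \<open>k \<noteq> 0\<close> by simp
qed (auto intro: span_base)

lemma frame_add:
  assumes F: "frame b1 b2 b3 b4" and x: "x \<in> span {b1, b2, b3}"
  shows "frame b1 b2 b3 (b4 + x)"
proof (intro frame_change[OF F])
  have "x \<in> span {b1, b2, b3, b4 + x}" using x span_mono[of "{b1, b2, b3}" "{b1, b2, b3, b4 + x}"] by auto
  then have "(b4 + x) - x \<in> span {b1, b2, b3, b4 + x}" by (intro span_diff) (auto intro: span_base)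
  then show "b4 \<in> span {b1, b2, b3, b4 + x}" by simp
qed (auto intro: span_base)

lemma frame_perm:
  assumes "frame b1 b2 b3 b4"
  shows "frame b2 b1 b3 b4" "frame b1 b3 b2 b4" "frame b1 b2 b4 b3"
  using assms by (simp_all add: frame_def insert_commute)

lemmas linear_rules = linear_add linear_diff linear_neg linear_cmul linear_0

lemma frame_update:
  assumes "frame b1 b2 b3 b4" and "k \<noteq> 0"
  shows "frame b1 b2 b3 (k *\<^sub>R b4 + (p *\<^sub>R b1 + q *\<^sub>R b2 + r *\<^sub>R b3))"
  by (rule frame_add[OF frame_scale[OF assms]]) (auto simp: in_span3_iff)

lemma frame_rotate: "frame b1 b2 b3 b4 \<Longrightarrow> frame b2 b3 b4 b1"
  by (simp add: frame_def insert_commute)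

lemma frame_lincomb:
  fixes b1 b2 b3 b4 :: "real^4"
  assumes "frame b1 b2 b3 b4"
  shows "bij (lincomb b1 b2 b3 b4)"
proof -
  have "surj (lincomb b1 b2 b3 b4)"
  proof (unfold surj_def, intro allI)
    fix x
    have "x \<in> span {b1, b2, b3, b4}" using assms by (simp add: frame_def)
    then obtain p q r s where x: "x = p *\<^sub>R b1 + q *\<^sub>R b2 + r *\<^sub>R b3 + s *\<^sub>R b4"
      by (auto simp: in_span4_iff)
    have "x = lincomb b1 b2 b3 b4 (p *\<^sub>R e 1 + q *\<^sub>R e 2 + r *\<^sub>R e 3 + s *\<^sub>R e 4)"
      by (simp add: lincomb_def x)
    then show "\<exists>v. x = lincomb b1 b2 b3 b4 v" by blast
  qed
  then show ?thesis
    using linear_surjective_imp_injective[OF linear_lincomb, of b1 b2 b3 b4] by (simp add: bij_def)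
qed

text \<open>The dual basis of a frame. Applying it to vector identities turns them into equations between
  structure constants, and it computes the trace of an endomorphism in any frame.\<close>

lemma frame_coordinates:
  fixes b1 b2 b3 b4 :: "real^4"
  assumes "frame b1 b2 b3 b4"
  obtains c1 c2 c3 c4 :: "real^4 \<Rightarrow> real" where "linear c1" "linear c2" "linear c3" "linear c4"
    "c1 b1 = 1" "c1 b2 = 0" "c1 b3 = 0" "c1 b4 = 0"
    "c2 b1 = 0" "c2 b2 = 1" "c2 b3 = 0" "c2 b4 = 0"
    "c3 b1 = 0" "c3 b2 = 0" "c3 b3 = 1" "c3 b4 = 0"
    "c4 b1 = 0" "c4 b2 = 0" "c4 b3 = 0" "c4 b4 = 1"
    "\<And>f. linear f \<Longrightarrow> trace (matrix f) = c1 (f b1) + c2 (f b2) + c3 (f b3) + c4 (f b4)"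
proof -
  let ?g = "lincomb b1 b2 b3 b4"
  have bij: "bij ?g" by (rule frame_lincomb[OF assms])
  have lin: "linear (inv ?g)"
    using inj_linear_imp_inv_linear[OF linear_lincomb] bij by (simp add: bij_def)
  have ig: "inv ?g (?g v) = v" for v using bij by (simp add: bij_def)
  have b: "?g (e 1) = b1" "?g (e 2) = b2" "?g (e 3) = b3" "?g (e 4) = b4"
    by (simp_all add: lincomb_def)
  then have ib: "inv ?g b1 = e 1" "inv ?g b2 = e 2" "inv ?g b3 = e 3" "inv ?g b4 = e 4"
    by (metis ig)+
  have l: "linear (\<lambda>x. inv ?g x $ i)" for i
    using linear_compose[OF lin, of "\<lambda>v. v $ i"] by (simp add: o_def linear_iff)
  have "trace (matrix f) = inv ?g (f b1) $ 1 + inv ?g (f b2) $ 2 + inv ?g (f b3) $ 3 + inv ?g (f b4) $ 4"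
    if f: "linear f" for f
  proof -
    have gi: "?g \<circ> inv ?g = id" using bij by (auto simp: bij_def surj_f_inv_f)
    have "matrix f = matrix (f \<circ> (?g \<circ> inv ?g))" using gi by simp
    also have "\<dots> = matrix (f \<circ> ?g) ** matrix (inv ?g)"
      using matrix_compose[OF lin linear_compose[OF linear_lincomb f]] by (simp add: o_assoc)
    finally have "trace (matrix f) = trace (matrix (inv ?g) ** matrix (f \<circ> ?g))"
      using trace_mul_sym by metis
    also have "matrix (inv ?g) ** matrix (f \<circ> ?g) = matrix (inv ?g \<circ> (f \<circ> ?g))"
      using matrix_compose[OF linear_compose[OF linear_lincomb f] lin] by simp
    also have "trace \<dots> = inv ?g (f b1) $ 1 + inv ?g (f b2) $ 2 + inv ?g (f b3) $ 3 + inv ?g (f b4) $ 4"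
      by (simp add: trace_def matrix_def sum_4 b)
    finally show ?thesis .
  qed
  then show ?thesis
    by (intro that[OF l[of 1] l[of 2] l[of 3] l[of 4]]) (simp_all add: ib)
qed

text \<open>A Lie algebra is isomorphic to an algebra of the table as soon as some frame satisfies its bracket
  relations.\<close>

lemma lie_isomorphic_bracketI:
  fixes br :: "real^4 \<Rightarrow> real^4 \<Rightarrow> real^4"
  assumes br: "bilinear br" "\<And>x. br x x = 0" and F: "frame b1 b2 b3 b4"
    and "br b1 b2 = lincomb b1 b2 b3 b4 (bracket L (e 1) (e 2))"
    "br b1 b3 = lincomb b1 b2 b3 b4 (bracket L (e 1) (e 3))"
    "br b1 b4 = lincomb b1 b2 b3 b4 (bracket L (e 1) (e 4))"
    "br b2 b3 = lincomb b1 b2 b3 b4 (bracket L (e 2) (e 3))"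
    "br b2 b4 = lincomb b1 b2 b3 b4 (bracket L (e 2) (e 4))"
    "br b3 b4 = lincomb b1 b2 b3 b4 (bracket L (e 3) (e 4))"
  shows "lie_isomorphic br (bracket L)"
proof -
  let ?g = "lincomb b1 b2 b3 b4"
  note lin = linear_lincomb[of b1 b2 b3 b4]
  have b: "?g (e 1) = b1" "?g (e 2) = b2" "?g (e 3) = b3" "?g (e 4) = b4"
    by (simp_all add: lincomb_def)
  have bij: "bij ?g" by (rule frame_lincomb[OF F])
  have b1: "bilinear (\<lambda>x y. br (?g x) (?g y))"
    unfolding bilinear_def
    by (intro conjI allI; rule linearI)
      (simp_all add: linear_add[OF lin] linear_cmul[OF lin] bilinear_ladd[OF br(1)]
        bilinear_radd[OF br(1)] bilinear_lmul[OF br(1)] bilinear_rmul[OF br(1)])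
  have b2: "bilinear (\<lambda>x y. ?g (bracket L x y))"
    unfolding bilinear_def
    by (intro conjI allI; rule linearI)
      (simp_all add: linear_add[OF lin] linear_cmul[OF lin] bilinear_ladd[OF bilinear_bracket]
        bilinear_radd[OF bilinear_bracket] bilinear_lmul[OF bilinear_bracket]
        bilinear_rmul[OF bilinear_bracket])
  have hom: "br (?g x) (?g y) = ?g (bracket L x y)" for x y
    by (rule bilinear_eqI_axis[OF b1 br(2) b2]) (simp_all add: bracket_diag linear_0[OF lin] b assms(4-))
  have lini: "linear (inv ?g)"
    using inj_linear_imp_inv_linear[OF lin] bij by (simp add: bij_def)
  have gi: "?g (inv ?g x) = x" and ig: "inv ?g (?g v) = v" for x v
    using bij by (simp_all add: bij_def surj_f_inv_f)
  have "inv ?g (br x y) = bracket L (inv ?g x) (inv ?g y)" for x y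
    using hom[of "inv ?g x" "inv ?g y"] by (simp add: gi ig)
  then show ?thesis
    unfolding lie_isomorphic_def using lini bij_imp_bij_inv[OF bij] by blast
qed

section \<open>A unimodular ideal of codimension one\<close>

lemma linear_expand_axis4:
  fixes f :: "real^4 \<Rightarrow> 'b::real_vector"
  assumes "linear f"
  shows "f x = x $ 1 *\<^sub>R f (e 1) + x $ 2 *\<^sub>R f (e 2) + x $ 3 *\<^sub>R f (e 3) + x $ 4 *\<^sub>R f (e 4)"
proof -
  have "x = x $ 1 *\<^sub>R e 1 + x $ 2 *\<^sub>R e 2 + x $ 3 *\<^sub>R e 3 + x $ 4 *\<^sub>R e 4"
    by (simp add: vec_eq_iff forall_4)
  then have "f x = f (x $ 1 *\<^sub>R e 1 + x $ 2 *\<^sub>R e 2 + x $ 3 *\<^sub>R e 3 + x $ 4 *\<^sub>R e 4)" by simp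
  then show ?thesis by (simp only: linear_add[OF assms] linear_cmul[OF assms])
qed

text \<open>The pairing is the wedge pairing of 2-forms, with the 2-forms split into two complementary triples of
  coefficients. Swapping the triples turns it into the inner product, so an isotropic range and its
  swapped copy would be orthogonal, and two orthogonal four-dimensional subspaces do not fit into
  dimension six.\<close>

lemma no_isotropic_embedding:
  fixes A :: "real^4 \<Rightarrow> (real^3) \<times> (real^3)"
  assumes A: "linear A" "inj A"
  shows "\<exists>x y. fst (A x) \<bullet> snd (A y) + snd (A x) \<bullet> fst (A y) \<noteq> 0"
proof (rule ccontr)
  assume "\<not> ?thesis"
  then have iso: "snd (A x) \<bullet> fst (A y) + fst (A x) \<bullet> snd (A y) = 0" for x y
    by (simp add: add.commute)
  let ?J = "\<lambda>p. (snd p, fst p) :: (real^3) \<times> (real^3)"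
  let ?V = "range A" and ?W = "range (?J \<circ> A)"
  have "linear ?J" by (rule linearI) simp_all
  then have lin: "linear (?J \<circ> A)" by (rule linear_compose[OF A(1)])
  have "inj ?J" by (rule injI) (simp add: prod_eq_iff)
  then have inj: "inj (?J \<circ> A)" by (rule inj_compose[OF _ A(2)])
  have dims: "dim ?V = 4" "dim ?W = 4"
    using dim_image_eq[OF A(1), of UNIV] dim_image_eq[OF lin, of UNIV] A(2) inj by simp_all
  have "subspace ?W" by (rule linear_subspace_image[OF lin subspace_UNIV])
  then have "dim {y \<in> UNIV. \<forall>x\<in>?W. orthogonal x y} + dim ?W = dim (UNIV :: ((real^3) \<times> (real^3)) set)"
    by (rule dim_subspace_orthogonal_to_vectors) simp_all
  moreover have "?V \<subseteq> {y \<in> UNIV. \<forall>x\<in>?W. orthogonal x y}"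
    using iso by (auto simp: orthogonal_def inner_prod_def)
  then have "dim ?V \<le> dim {y \<in> UNIV. \<forall>x\<in>?W. orthogonal x y}" by (rule dim_subset)
  ultimately show False using dims by simp
qed

locale lie4 =
  fixes br :: "real^4 \<Rightarrow> real^4 \<Rightarrow> real^4"
  assumes lie: "lie_algebra br"
begin

lemma bil: "bilinear br" and diag [simp]: "br x x = 0"
  and jacobi: "br x (br y z) + br y (br z x) + br z (br x y) = 0"
  using lie by (simp_all add: lie_algebra_def)

lemma skew: "br y x = - br x y"
  by (rule alternating_skew[OF bil diag])

lemmas br_simps = bilinear_ladd[OF bil] bilinear_radd[OF bil] bilinear_lmul[OF bil]
  bilinear_rmul[OF bil] bilinear_lneg[OF bil] bilinear_rneg[OF bil] bilinear_lzero[OF bil]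
  bilinear_rzero[OF bil] bilinear_lsub[OF bil] bilinear_rsub[OF bil]

lemma linear_br: "linear (br x)" "linear (\<lambda>x. br x y)"
  using bil by (simp_all add: bilinear_def)

lemma jacobi_derivation: "br x (br y z) = br (br x y) z + br y (br x z)"
  using jacobi[of x y z] skew[of z "br x y"] skew[of z x]
  by (simp add: br_simps algebra_simps eq_neg_iff_add_eq_0)

definition tr_ad :: "real^4 \<Rightarrow> real" where
  "tr_ad x = trace (matrix (br x))"

lemma tr_ad_eq: "tr_ad x = br x (e 1) $ 1 + br x (e 2) $ 2 + br x (e 3) $ 3 + br x (e 4) $ 4"
  by (simp add: tr_ad_def trace_def matrix_def sum_4)

lemma linear_tr_ad: "linear tr_ad"
  by (rule linearI) (simp_all add: tr_ad_eq br_simps algebra_simps)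

lemma tr_ad_bracket: "tr_ad (br x y) = 0"
proof -
  let ?C = "\<lambda>x y. trace (matrix (br x) ** matrix (br y))"
  have "?C x y = br x (br y (e 1)) $ 1 + br x (br y (e 2)) $ 2 + br x (br y (e 3)) $ 3 + br x (br y (e 4)) $ 4"
    for x y
    by (simp add: matrix_compose[OF linear_br(1) linear_br(1), symmetric])
      (simp add: trace_def matrix_def sum_4)
  then have "tr_ad (br x y) = ?C x y - ?C y x"
    using jacobi_derivation[of x y] by (simp add: tr_ad_eq)
  then show ?thesis using trace_mul_sym[of "matrix (br x)" "matrix (br y)"] by simp
qed

text \<open>Let F and F' be the differentials of the 1-forms w and v, up to sign. Then \<open>F \<and> F'\<close> is the differential
  of a 3-form, and such differentials vanish on a unimodular algebra of dimension four. In
  coordinates, \<open>F \<and> F'\<close> is the combination of the numbers \<open>G m\<close> with coefficients \<open>v $ m\<close>; the Jacobi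
  identity for the three basis vectors other than \<open>e m\<close> reduces \<open>G m\<close> to multiples of traces.\<close>

lemma unimodular_isotropic:
  assumes tr: "\<And>x. tr_ad x = 0"
  shows "(w \<bullet> br (e 1) (e 2)) * (v \<bullet> br (e 3) (e 4)) + (w \<bullet> br (e 3) (e 4)) * (v \<bullet> br (e 1) (e 2))
    - (w \<bullet> br (e 1) (e 3)) * (v \<bullet> br (e 2) (e 4)) - (w \<bullet> br (e 2) (e 4)) * (v \<bullet> br (e 1) (e 3))
    + (w \<bullet> br (e 1) (e 4)) * (v \<bullet> br (e 2) (e 3)) + (w \<bullet> br (e 2) (e 3)) * (v \<bullet> br (e 1) (e 4)) = 0"
proof -
  define F where "F i j = w \<bullet> br (e i) (e j)" for i j
  define c where "c i j m = br (e i) (e j) $ m" for i j m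
  have Fs: "F i j = - F j i" for i j using skew[of "e i" "e j"] by (simp add: F_def)
  have cs: "c i j m = - c j i m" for i j m using skew[of "e i" "e j"] by (simp add: c_def)
  have F0: "F i i = 0" and c0: "c i i m = 0" for i m by (simp_all add: F_def c_def)
  have exp: "w \<bullet> br (br (e i) (e j)) (e k) = c i j 1 * F 1 k + c i j 2 * F 2 k + c i j 3 * F 3 k + c i j 4 * F 4 k"
    for i j k
  proof -
    have "linear (\<lambda>x. w \<bullet> br x (e k))" by (rule linearI) (simp_all add: br_simps inner_add_right)
    from linear_expand_axis4[OF this, of "br (e i) (e j)"] show ?thesis by (simp add: F_def c_def)
  qed
  have jac: "w \<bullet> br (br (e i) (e j)) (e k) + w \<bullet> br (br (e j) (e k)) (e i) + w \<bullet> br (br (e k) (e i)) (e j) = 0" for i j k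
    using arg_cong[OF jacobi[of "e i" "e j" "e k"], of "\<lambda>x. w \<bullet> x"]
      skew[of "e i" "br (e j) (e k)"] skew[of "e j" "br (e k) (e i)"] skew[of "e k" "br (e i) (e j)"]
    by (simp add: inner_add_right inner_diff_right)
  have trc: "c i 1 1 + c i 2 2 + c i 3 3 + c i 4 4 = 0" for i using tr[of "e i"] by (simp add: tr_ad_eq c_def)
  define G where "G m = F 1 2 * c 3 4 m + F 3 4 * c 1 2 m - F 1 3 * c 2 4 m - F 2 4 * c 1 3 m
     + F 1 4 * c 2 3 m + F 2 3 * c 1 4 m" for m
  note flips = cs[of 2 1] cs[of 3 1] cs[of 4 1] cs[of 3 2] cs[of 4 2] cs[of 4 3]
    Fs[of 2 1] Fs[of 3 1] Fs[of 4 1] Fs[of 3 2] Fs[of 4 2] Fs[of 4 3] F0 c0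
  note J = jac[unfolded exp] 
  note t = trc[of 1, unfolded flips] trc[of 2, unfolded flips] trc[of 3, unfolded flips] trc[of 4, unfolded flips]
  have s1: "c 1 2 1 = c 2 3 3 + c 2 4 4" "c 1 3 1 = c 3 4 4 - c 2 3 2" "c 1 4 1 = - c 2 4 2 - c 3 4 3"
    using t by linarith+
  have G1: "G 1 = 0"
    using J[of 2 3 4, unfolded flips] unfolding G_def s1 by (simp add: algebra_simps)
  have s2: "c 1 2 2 = - c 1 3 3 - c 1 4 4" "c 2 3 2 = c 3 4 4 - c 1 3 1" "c 2 4 2 = - c 1 4 1 - c 3 4 3"
    using t by linarith+
  have G2: "G 2 = 0"
    using J[of 1 3 4, unfolded flips] unfolding G_def s2 by (simp add: algebra_simps)
  have s3: "c 1 3 3 = - c 1 2 2 - c 1 4 4" "c 2 3 3 = c 1 2 1 - c 2 4 4" "c 3 4 3 = - c 1 4 1 - c 2 4 2"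
    using t by linarith+
  have G3: "G 3 = 0"
    using J[of 1 2 4, unfolded flips] unfolding G_def s3 by (simp add: algebra_simps)
  have s4: "c 1 4 4 = - c 1 2 2 - c 1 3 3" "c 2 4 4 = c 1 2 1 - c 2 3 3" "c 3 4 4 = c 1 3 1 + c 2 3 2"
    using t by linarith+
  have G4: "G 4 = 0"
    using J[of 1 2 3, unfolded flips] unfolding G_def s4 by (simp add: algebra_simps)
  have G: "v $ 1 * G 1 + v $ 2 * G 2 + v $ 3 * G 3 + v $ 4 * G 4 = 0" using G1 G2 G3 G4 by simp
  have v: "v \<bullet> br (e i) (e j) = v $ 1 * c i j 1 + v $ 2 * c i j 2 + v $ 3 * c i j 3 + v $ 4 * c i j 4" for i j
    by (simp add: inner_vec_def sum_4 c_def)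
  have "F 1 2 * (v \<bullet> br (e 3) (e 4)) + F 3 4 * (v \<bullet> br (e 1) (e 2))
    - F 1 3 * (v \<bullet> br (e 2) (e 4)) - F 2 4 * (v \<bullet> br (e 1) (e 3))
    + F 1 4 * (v \<bullet> br (e 2) (e 3)) + F 2 3 * (v \<bullet> br (e 1) (e 4))
    = v $ 1 * G 1 + v $ 2 * G 2 + v $ 3 * G 3 + v $ 4 * G 4"
    unfolding G_def v by (simp only: ring_distribs ac_simps diff_conv_add_uminus minus_add_distrib
      mult_minus_left mult_minus_right minus_minus)
  then show ?thesis unfolding G F_def .
qed

text \<open>If the derived algebra were everything, the differential would embed the 1-forms as a
  four-dimensional isotropic space of 2-forms.\<close>

lemma not_perfect_if_unimodular:
  assumes tr: "\<And>x. tr_ad x = 0"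
  shows "\<exists>n. n \<noteq> 0 \<and> (\<forall>x y. n \<bullet> br x y = 0)"
proof (rule ccontr)
  assume np: "\<not> ?thesis"
  define A :: "real^4 \<Rightarrow> (real^3) \<times> (real^3)" where "A w =
    (vector [w \<bullet> br (e 1) (e 2), w \<bullet> br (e 1) (e 3), w \<bullet> br (e 1) (e 4)],
     vector [w \<bullet> br (e 3) (e 4), - (w \<bullet> br (e 2) (e 4)), w \<bullet> br (e 2) (e 3)])" for w
  have lin: "linear A"
    by (rule linearI) (simp_all add: A_def vec_eq_iff forall_3 inner_add_left)
  have "w = 0" if "A w = 0" for w
  proof -
    have b: "bilinear (\<lambda>x y. w \<bullet> br x y)"
      unfolding bilinear_def by (intro conjI allI; rule linearI) (simp_all add: br_simps inner_add_right)
    have b0: "bilinear (\<lambda>x y::real^4. 0::real)" by (simp add: bilinear_def linear_iff)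
    have "w \<bullet> br x y = 0" for x y
      by (rule bilinear_eqI_axis[OF b _ b0])
        (use that in \<open>simp_all add: A_def zero_prod_def vec_eq_iff forall_3\<close>)
    with np show ?thesis by blast
  qed
  then have "inj A" using lin by (simp add: linear_injective_0)
  then obtain w v where "fst (A w) \<bullet> snd (A v) + snd (A w) \<bullet> fst (A v) \<noteq> 0"
    using no_isotropic_embedding[OF lin] by blast
  then show False
    using unimodular_isotropic[OF tr, of w v] by (simp add: A_def inner_vec_def sum_3 algebra_simps)
qed

text \<open>The functional given by n vanishes on brackets, so its kernel is an ideal; unless all traces
  vanish, n is the trace functional itself.\<close>

lemma unimodular_ideal:
  "\<exists>n. n \<noteq> 0 \<and> (\<forall>x y. n \<bullet> br x y = 0) \<and> (\<forall>x. n \<bullet> x = 0 \<longrightarrow> tr_ad x = 0)"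
proof (cases "\<forall>x. tr_ad x = 0")
  case True
  then show ?thesis using not_perfect_if_unimodular by auto
next
  case False
  then obtain x where x: "tr_ad x \<noteq> 0" by blast
  let ?n = "adjoint tr_ad 1"
  have n: "?n \<bullet> y = tr_ad y" for y
    unfolding inner_commute[of ?n] adjoint_works[OF linear_tr_ad] by simp
  have "?n \<noteq> 0"
  proof
    assume "?n = 0"
    then show False using n[of x] x by simp
  qed
  then show ?thesis using n tr_ad_bracket by metis
qed

lemma adapted_frame:
  obtains b1 b2 b3 b4 where "frame b1 b2 b3 b4" "\<And>x y. br x y \<in> span {b1, b2, b3}"
    "\<And>x. x \<in> span {b1, b2, b3} \<Longrightarrow> tr_ad x = 0"
proof -
  obtain n where n: "n \<noteq> 0" "\<And>x y. n \<bullet> br x y = 0" "\<And>x. n \<bullet> x = 0 \<Longrightarrow> tr_ad x = 0"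
    using unimodular_ideal by auto
  let ?H = "{x. n \<bullet> x = 0}"
  have sub: "subspace ?H" by (rule subspace_hyperplane)
  obtain B where B: "B \<subseteq> ?H" "independent B" "?H \<subseteq> span B" "card B = dim ?H"
    by (rule basis_exists)
  have "card B = 3" using B(4) dim_hyperplane[OF n(1)] by simp
  then obtain b1 b2 b3 where b: "B = {b1, b2, b3}" unfolding card_3_iff by blast
  have H: "span {b1, b2, b3} = ?H"
    using B(1,3) span_minimal[OF _ sub, of B] b by auto
  have "x \<in> span {b1, b2, b3, n}" for x
  proof -
    let ?k = "(n \<bullet> x) / (n \<bullet> n)"
    have "x - ?k *\<^sub>R n \<in> span {b1, b2, b3}" unfolding H using n(1) by (simp add: inner_diff_right)
    then have "x - ?k *\<^sub>R n \<in> span {b1, b2, b3, n}"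
      by (rule subsetD[OF span_mono, rotated]) auto
    moreover have "?k *\<^sub>R n \<in> span {b1, b2, b3, n}" by (intro span_mul span_base) simp
    ultimately have "(x - ?k *\<^sub>R n) + ?k *\<^sub>R n \<in> span {b1, b2, b3, n}" by (rule span_add)
    then show ?thesis by simp
  qed
  then have "frame b1 b2 b3 n" by (auto simp: frame_def)
  then show ?thesis by (rule that) (use n H in auto)
qed

end

section \<open>The unimodular ideal of a symplectic Lie algebra is not perfect\<close>

text \<open>Here S describes the bracket on a unimodular ideal, D (with entries d) the derivation given by a
  complementary vector, q and p the symplectic form on the ideal and between the ideal and the
  complement. The equations E say \<open>D S + S D\<^sup>T = t S\<close>, which is the derivation property, and the
  equations P say \<open>S p = D q - t q\<close>, which is closedness; \<open>p \<bullet> q\<close> is the Pfaffian. If S were invertible,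
  taking the trace of the first equation against the inverse of S would give \<open>2 t = 3 t\<close>, so \<open>t = 0\<close>
  and \<open>D S\<close> is skew. With \<open>q = S y\<close> it follows that \<open>p \<bullet> q = y \<bullet> (D S y) = 0\<close>.\<close>

lemma symmetric3_kernel:
  fixes s11 s12 s13 s22 s23 s33 d11 d12 d13 d21 d22 d23 d31 d32 d33 p1 p2 p3 q1 q2 q3 :: real
  defines "t \<equiv> d11 + d22 + d33"
  assumes E11: "2 * (d11 * s11 + d12 * s12 + d13 * s13) = t * s11"
    and E22: "2 * (d21 * s12 + d22 * s22 + d23 * s23) = t * s22"
    and E33: "2 * (d31 * s13 + d32 * s23 + d33 * s33) = t * s33"
    and E12: "(d11 * s12 + d12 * s22 + d13 * s23) + (d21 * s11 + d22 * s12 + d23 * s13) = t * s12"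
    and E13: "(d11 * s13 + d12 * s23 + d13 * s33) + (d31 * s11 + d32 * s12 + d33 * s13) = t * s13"
    and E23: "(d21 * s13 + d22 * s23 + d23 * s33) + (d31 * s12 + d32 * s22 + d33 * s23) = t * s23"
    and P1: "s11 * p1 + s12 * p2 + s13 * p3 = d11 * q1 + d12 * q2 + d13 * q3 - t * q1"
    and P2: "s12 * p1 + s22 * p2 + s23 * p3 = d21 * q1 + d22 * q2 + d23 * q3 - t * q2"
    and P3: "s13 * p1 + s23 * p2 + s33 * p3 = d31 * q1 + d32 * q2 + d33 * q3 - t * q3"
    and nd: "p1 * q1 + p2 * q2 + p3 * q3 \<noteq> 0"
  shows "\<exists>n1 n2 n3. (n1 \<noteq> 0 \<or> n2 \<noteq> 0 \<or> n3 \<noteq> 0) \<and> s11 * n1 + s12 * n2 + s13 * n3 = 0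
    \<and> s12 * n1 + s22 * n2 + s23 * n3 = 0 \<and> s13 * n1 + s23 * n2 + s33 * n3 = 0"
proof (rule ccontr)
  assume nk: "\<not> ?thesis"
  define S :: "real^3^3" where
    "S = vector [vector [s11, s12, s13], vector [s12, s22, s23], vector [s13, s23, s33]]"
  have Sv: "(S *v x) $ 1 = s11 * x $ 1 + s12 * x $ 2 + s13 * x $ 3"
    "(S *v x) $ 2 = s12 * x $ 1 + s22 * x $ 2 + s23 * x $ 3"
    "(S *v x) $ 3 = s13 * x $ 1 + s23 * x $ 2 + s33 * x $ 3" for x
    by (simp_all add: S_def matrix_vector_mult_def sum_3)
  have ker: "x = 0" if "S *v x = 0" for x
  proof -
    have "(S *v x) $ 1 = 0" "(S *v x) $ 2 = 0" "(S *v x) $ 3 = 0" using that by simp_all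
    then have "x $ 1 = 0 \<and> x $ 2 = 0 \<and> x $ 3 = 0" using nk unfolding Sv by blast
    then show ?thesis by (simp add: vec_eq_iff forall_3)
  qed
  then have "\<exists>B. B ** S = mat 1" by (simp add: matrix_left_invertible_ker)
  then have inv: "invertible S" by (simp add: invertible_left_inverse)
  define a11 a22 a33 a12 a13 a23 where "a11 = s22 * s33 - s23 * s23" and "a22 = s11 * s33 - s13 * s13"
    and "a33 = s11 * s22 - s12 * s12" and "a12 = s13 * s23 - s12 * s33"
    and "a13 = s12 * s23 - s13 * s22" and "a23 = s12 * s13 - s11 * s23"
  note adj = a11_def a22_def a33_def a12_def a13_def a23_def
  define \<Delta> where "\<Delta> = s11 * a11 + s12 * a12 + s13 * a13"
  have "det S = \<Delta>" by (simp add: det_3 S_def \<Delta>_def adj algebra_simps)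
  then have \<Delta>: "\<Delta> \<noteq> 0" using inv invertible_det_nz by metis
  \<comment> \<open>The pairing of the equations E with the adjugate of S.\<close>
  have "2 * (t * \<Delta>) = a11 * (2 * (d11 * s11 + d12 * s12 + d13 * s13))
      + a22 * (2 * (d21 * s12 + d22 * s22 + d23 * s23))
      + a33 * (2 * (d31 * s13 + d32 * s23 + d33 * s33))
      + 2 * a12 * ((d11 * s12 + d12 * s22 + d13 * s23) + (d21 * s11 + d22 * s12 + d23 * s13))
      + 2 * a13 * ((d11 * s13 + d12 * s23 + d13 * s33) + (d31 * s11 + d32 * s12 + d33 * s13))
      + 2 * a23 * ((d21 * s13 + d22 * s23 + d23 * s33) + (d31 * s12 + d32 * s22 + d33 * s23))"
    unfolding \<Delta>_def adj t_def by algebra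
  also have "\<dots> = t * (a11 * s11 + a22 * s22 + a33 * s33 + 2 * a12 * s12 + 2 * a13 * s13 + 2 * a23 * s23)"
    unfolding E11 E22 E33 E12 E13 E23 by algebra
  also have "\<dots> = 3 * (t * \<Delta>)" unfolding \<Delta>_def adj by algebra
  finally have t: "t = 0" using \<Delta> by simp
  obtain y where y: "S *v y = vector [q1, q2, q3]"
    using inv unfolding invertible_def by (metis matrix_vector_mul_assoc matrix_vector_mul_lid)
  define y1 y2 y3 where "y1 = y $ 1" and "y2 = y $ 2" and "y3 = y $ 3"
  have q: "q1 = s11 * y1 + s12 * y2 + s13 * y3" "q2 = s12 * y1 + s22 * y2 + s23 * y3"
    "q3 = s13 * y1 + s23 * y2 + s33 * y3"
    using arg_cong[OF y, of "\<lambda>v. v $ 1"] arg_cong[OF y, of "\<lambda>v. v $ 2"] arg_cong[OF y, of "\<lambda>v. v $ 3"]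
    unfolding Sv by (simp_all add: y1_def y2_def y3_def)
  have "p1 * q1 + p2 * q2 + p3 * q3 = y1 * (s11 * p1 + s12 * p2 + s13 * p3)
      + y2 * (s12 * p1 + s22 * p2 + s23 * p3) + y3 * (s13 * p1 + s23 * p2 + s33 * p3)"
    unfolding q by algebra
  also have "\<dots> = y1 * (d11 * q1 + d12 * q2 + d13 * q3)
      + y2 * (d21 * q1 + d22 * q2 + d23 * q3) + y3 * (d31 * q1 + d32 * q2 + d33 * q3)"
    unfolding P1 P2 P3 t by simp
  \<comment> \<open>The quadratic form of the symmetric part of D S at y.\<close>
  finally have "2 * (p1 * q1 + p2 * q2 + p3 * q3) = y1 * y1 * (2 * (d11 * s11 + d12 * s12 + d13 * s13))
      + y2 * y2 * (2 * (d21 * s12 + d22 * s22 + d23 * s23))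
      + y3 * y3 * (2 * (d31 * s13 + d32 * s23 + d33 * s33))
      + 2 * (y1 * y2) * ((d11 * s12 + d12 * s22 + d13 * s23) + (d21 * s11 + d22 * s12 + d23 * s13))
      + 2 * (y1 * y3) * ((d11 * s13 + d12 * s23 + d13 * s33) + (d31 * s11 + d32 * s12 + d33 * s13))
      + 2 * (y2 * y3) * ((d21 * s13 + d22 * s23 + d23 * s33) + (d31 * s12 + d32 * s22 + d33 * s23))"
    unfolding q by algebra
  also have "\<dots> = 0" unfolding E11 E22 E33 E12 E13 E23 t by simp
  finally show False using nd by simp
qed

locale symplectic_lie4 = lie4 +
  fixes w :: "real^4 \<Rightarrow> real^4 \<Rightarrow> real"
  assumes bil_w: "bilinear w" and diag_w [simp]: "w x x = 0"
    and closed: "w (br x y) z + w (br y z) x + w (br z x) y = 0"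
    and nondegenerate: "\<exists>x y z u. pfaffian w x y z u \<noteq> 0"
begin

lemma skew_w: "w y x = - w x y"
  by (rule alternating_skew[OF bil_w diag_w])

lemmas w_simps = bilinear_ladd[OF bil_w] bilinear_radd[OF bil_w] bilinear_lmul[OF bil_w]
  bilinear_rmul[OF bil_w] bilinear_lneg[OF bil_w] bilinear_rneg[OF bil_w] bilinear_lzero[OF bil_w]
  bilinear_rzero[OF bil_w] bilinear_lsub[OF bil_w] bilinear_rsub[OF bil_w]

lemma pfaffian_frame:
  assumes "frame b1 b2 b3 b4"
  shows "w b1 b2 * w b3 b4 - w b1 b3 * w b2 b4 + w b1 b4 * w b2 b3 \<noteq> 0"
  using pfaffian_zero[OF bil_w skew_w, of b1 b2 b3 b4] assms nondegenerate
  unfolding frame_def pfaffian_def by blast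

text \<open>The symmetry of the structure matrix S is unimodularity of the ideal. A kernel vector of S is a
  functional on the ideal that vanishes on its brackets.\<close>

lemma imperfect_ideal:
  assumes F: "frame b1 b2 b3 b4" and h: "\<And>x y. br x y \<in> span {b1, b2, b3}"
    and tr: "\<And>x. x \<in> span {b1, b2, b3} \<Longrightarrow> tr_ad x = 0"
  shows "\<exists>\<nu> :: real^4 \<Rightarrow> real. linear \<nu> \<and> (\<nu> b1 \<noteq> 0 \<or> \<nu> b2 \<noteq> 0 \<or> \<nu> b3 \<noteq> 0) \<and>
    \<nu> (br b1 b2) = 0 \<and> \<nu> (br b2 b3) = 0 \<and> \<nu> (br b3 b1) = 0"
proof -
  obtain c1 c2 c3 c4 :: "real^4 \<Rightarrow> real" where lin: "linear c1" "linear c2" "linear c3" "linear c4"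
    and c: "c1 b1 = 1" "c1 b2 = 0" "c1 b3 = 0" "c1 b4 = 0"
    "c2 b1 = 0" "c2 b2 = 1" "c2 b3 = 0" "c2 b4 = 0"
    "c3 b1 = 0" "c3 b2 = 0" "c3 b3 = 1" "c3 b4 = 0"
    "c4 b1 = 0" "c4 b2 = 0" "c4 b3 = 0" "c4 b4 = 1"
    and trace: "\<And>f. linear f \<Longrightarrow> trace (matrix f) = c1 (f b1) + c2 (f b2) + c3 (f b3) + c4 (f b4)"
    using frame_coordinates[OF F] by blast
  note lins = linear_add[OF lin(1)] linear_add[OF lin(2)] linear_add[OF lin(3)] linear_add[OF lin(4)]
    linear_cmul[OF lin(1)] linear_cmul[OF lin(2)] linear_cmul[OF lin(3)] linear_cmul[OF lin(4)]
    linear_neg[OF lin(1)] linear_neg[OF lin(2)] linear_neg[OF lin(3)] linear_neg[OF lin(4)]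
    linear_diff[OF lin(1)] linear_diff[OF lin(2)] linear_diff[OF lin(3)] linear_diff[OF lin(4)]
    linear_0[OF lin(1)] linear_0[OF lin(2)] linear_0[OF lin(3)] linear_0[OF lin(4)]
  obtain s11 s21 s31 where S1: "br b2 b3 = s11 *\<^sub>R b1 + s21 *\<^sub>R b2 + s31 *\<^sub>R b3"
    using h[of b2 b3] unfolding in_span3_iff by blast
  obtain s12 s22 s32 where S2: "br b3 b1 = s12 *\<^sub>R b1 + s22 *\<^sub>R b2 + s32 *\<^sub>R b3"
    using h[of b3 b1] unfolding in_span3_iff by blast
  obtain s13 s23 s33 where S3: "br b1 b2 = s13 *\<^sub>R b1 + s23 *\<^sub>R b2 + s33 *\<^sub>R b3"
    using h[of b1 b2] unfolding in_span3_iff by blast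
  obtain d11 d21 d31 where D1: "br b4 b1 = d11 *\<^sub>R b1 + d21 *\<^sub>R b2 + d31 *\<^sub>R b3"
    using h[of b4 b1] unfolding in_span3_iff by blast
  obtain d12 d22 d32 where D2: "br b4 b2 = d12 *\<^sub>R b1 + d22 *\<^sub>R b2 + d32 *\<^sub>R b3"
    using h[of b4 b2] unfolding in_span3_iff by blast
  obtain d13 d23 d33 where D3: "br b4 b3 = d13 *\<^sub>R b1 + d23 *\<^sub>R b2 + d33 *\<^sub>R b3"
    using h[of b4 b3] unfolding in_span3_iff by blast
  have flip: "br b3 b2 = - br b2 b3" "br b1 b3 = - br b3 b1" "br b2 b1 = - br b1 b2"
    "br b1 b4 = - br b4 b1" "br b2 b4 = - br b4 b2" "br b3 b4 = - br b4 b3" by (rule skew)+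
  have b: "b1 \<in> span {b1, b2, b3}" "b2 \<in> span {b1, b2, b3}" "b3 \<in> span {b1, b2, b3}"
    by (auto intro: span_base)
  have sym: "s32 = s23" "s31 = s13" "s21 = s12"
    using tr[OF b(1)] tr[OF b(2)] tr[OF b(3)]
    by (simp_all add: tr_ad_def trace[OF linear_br(1)] flip S1 S2 S3 D1 D2 D3 lins c)
  have J: "br b4 (br b1 b2) = br (br b4 b1) b2 + br b1 (br b4 b2)"
    "br b4 (br b2 b3) = br (br b4 b2) b3 + br b2 (br b4 b3)"
    "br b4 (br b3 b1) = br (br b4 b3) b1 + br b3 (br b4 b1)"
    by (rule jacobi_derivation)+
  note comp = arg_cong[OF J(1), of c1] arg_cong[OF J(1), of c2] arg_cong[OF J(1), of c3]
    arg_cong[OF J(2), of c1] arg_cong[OF J(2), of c2] arg_cong[OF J(2), of c3]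
    arg_cong[OF J(3), of c1] arg_cong[OF J(3), of c2] arg_cong[OF J(3), of c3]
  note eqs = comp[unfolded S1 S2 S3 D1 D2 D3 br_simps flip diag lins c]
  define q1 q2 q3 p1 p2 p3 where "q1 = w b2 b3" and "q2 = w b3 b1" and "q3 = w b1 b2"
    and "p1 = w b1 b4" and "p2 = w b2 b4" and "p3 = w b3 b4"
  note pq = q1_def q2_def q3_def p1_def p2_def p3_def
  have flipw: "w b3 b2 = - w b2 b3" "w b1 b3 = - w b3 b1" "w b2 b1 = - w b1 b2"
    "w b4 b1 = - w b1 b4" "w b4 b2 = - w b2 b4" "w b4 b3 = - w b3 b4" by (rule skew_w)+
  note cl = closed[of b1 b2 b4, unfolded flip S3 D1 D2 w_simps flipw diag_w]
    closed[of b2 b3 b4, unfolded flip S1 D3 D2 w_simps flipw diag_w]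
    closed[of b3 b1 b4, unfolded flip S2 D1 D3 w_simps flipw diag_w]
  have "\<exists>n1 n2 n3. (n1 \<noteq> 0 \<or> n2 \<noteq> 0 \<or> n3 \<noteq> 0) \<and> s11 * n1 + s12 * n2 + s13 * n3 = 0
    \<and> s12 * n1 + s22 * n2 + s23 * n3 = 0 \<and> s13 * n1 + s23 * n2 + s33 * n3 = 0"
  proof (rule symmetric3_kernel[of d11 s11 d12 s12 d13 s13 d22 d33 d21 s22 d23 s23 d31 d32 s33 p1 p2 p3 q1 q2 q3])
    show "p1 * q1 + p2 * q2 + p3 * q3 \<noteq> 0"
      using pfaffian_frame[OF F] unfolding pq flipw by (simp add: algebra_simps)
  qed (use eqs sym cl in \<open>simp_all add: pq algebra_simps\<close>)
  then obtain n1 n2 n3 where n: "n1 \<noteq> 0 \<or> n2 \<noteq> 0 \<or> n3 \<noteq> 0" "s11 * n1 + s12 * n2 + s13 * n3 = 0"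
    "s12 * n1 + s22 * n2 + s23 * n3 = 0" "s13 * n1 + s23 * n2 + s33 * n3 = 0" by blast
  let ?n = "\<lambda>x. n1 * c1 x + n2 * c2 x + n3 * c3 x"
  have "linear ?n" by (rule linearI) (simp_all add: lins algebra_simps)
  moreover have "?n b1 \<noteq> 0 \<or> ?n b2 \<noteq> 0 \<or> ?n b3 \<noteq> 0" using n(1) by (simp add: c)
  moreover have "?n (br b1 b2) = 0 \<and> ?n (br b2 b3) = 0 \<and> ?n (br b3 b1) = 0"
    using n(2-4) by (simp add: S1 S2 S3 lins c sym algebra_simps)
  ultimately show ?thesis by blast
qed

end

section \<open>Traceless 2 by 2 matrices\<close>

text \<open>The matrix with rows \<open>(a, b)\<close> and \<open>(c, - a)\<close> squares to \<open>a\<^sup>2 + b c\<close> times the identity. The sign of this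
  number decides the case; \<open>(p, q)\<close> and \<open>(r, s)\<close> are the coordinates of the new basis vectors.\<close>

lemma traceless2_normal_form:
  fixes a b c :: real
  obtains (zero) "a = 0" "b = 0" "c = 0"
  | (nilpotent) p q r s where "p * s - q * r \<noteq> 0" "a * p + b * q = 0" "c * p - a * q = 0"
      "a * r + b * s = p" "c * r - a * s = q"
  | (hyperbolic) p q r s k where "p * s - q * r \<noteq> 0" "k > 0" "a * p + b * q = k * p" "c * p - a * q = k * q"
      "a * r + b * s = - k * r" "c * r - a * s = - k * s"
  | (elliptic) p q r s k where "p * s - q * r \<noteq> 0" "k > 0" "a * p + b * q = k * r" "c * p - a * q = k * s"
      "a * r + b * s = - k * p" "c * r - a * s = - k * q"
proof -
  let ?D = "a * a + b * c"
  consider "?D = 0" | "?D > 0" | "?D < 0" by linarith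
  then show ?thesis
  proof cases
    case 1
    show ?thesis
    proof (cases "c = 0")
      case True
      then have a: "a = 0" using 1 by simp
      show ?thesis
      proof (cases "b = 0")
        case False
        then show ?thesis using nilpotent[of b 1 0 0] a True by simp
      qed (use zero a True in simp)
    next
      case False
      then show ?thesis using nilpotent[of a 0 c 1] 1 by (simp add: algebra_simps)
    qed
  next
    case 2
    define k where "k = sqrt ?D"
    have k: "k > 0" "k * k = ?D" using 2 by (simp_all add: k_def)
    show ?thesis
    proof (cases "b = 0")
      case False
      show ?thesis
        by (rule hyperbolic[of b "- k - a" "k - a" b k]) (use False k in \<open>simp_all add: algebra_simps\<close>)
    next
      case True
      then have "\<bar>a\<bar> * \<bar>a\<bar> = k * k" using k by simp
      then have ka: "k = \<bar>a\<bar>" using k(1) by (metis abs_ge_zero less_le power2_eq_imp_eq power2_eq_square)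
      show ?thesis
      proof (cases "a > 0")
        case a: True
        show ?thesis by (rule hyperbolic[of "2 * a" 1 c 0 k]) (use a k ka True in simp_all)
      next
        case False
        then have "a < 0" "k = - a" using ka k by simp_all
        then show ?thesis by (intro hyperbolic[of 0 c 1 "2 * a" k]) (use k True in simp_all)
      qed
    qed
  next
    case 3
    define k where "k = sqrt (- ?D)"
    have k: "k > 0" "k * k = - ?D" using 3 by (simp_all add: k_def)
    have "c \<noteq> 0"
    proof
      assume "c = 0"
      then show False using 3 by (simp add: not_less)
    qed
    then show ?thesis
      by (intro elliptic[of 1 "c / k" 0 "a / k" k]) (use k in \<open>simp_all add: field_simps\<close>)
  qed
qed

section \<open>Ideals on which the normal form is hyperbolic or elliptic\<close>

context lie4
begin

abbreviation in_table :: bool where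
  "in_table \<equiv> \<exists>M S. listed M S \<and> lie_isomorphic br M"

text \<open>The Jacobi identity makes the action of b on the plane of u and v diagonal, like that of a. Adding to
  b a multiple of a and a vector of the plane makes b act on the plane as a scalar t and commute
  with a. If \<open>t \<noteq> 0\<close>, the vectors \<open>(b/t \<plusminus> a)/2\<close> act on one coordinate axis each, which exhibits two
  copies of the affine algebra.\<close>

lemma hyperbolic_case:
  assumes F: "frame u v a b" and uv: "br u v = 0" and au: "br a u = u" and av: "br a v = - v"
    and h: "\<And>x. br b x \<in> span {u, v, a}"
  shows in_table
proof -
  obtain c1 c2 c3 c4 :: "real^4 \<Rightarrow> real" where lin: "linear c1" "linear c2" "linear c3" "linear c4"
    and c: "c1 u = 1" "c1 v = 0" "c1 a = 0" "c1 b = 0"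
    "c2 u = 0" "c2 v = 1" "c2 a = 0" "c2 b = 0"
    "c3 u = 0" "c3 v = 0" "c3 a = 1" "c3 b = 0"
    using frame_coordinates[OF F] by metis
  note lins = linear_rules[OF lin(1)] linear_rules[OF lin(2)] linear_rules[OF lin(3)]
  obtain x1 x2 x3 where bu: "br b u = x1 *\<^sub>R u + x2 *\<^sub>R v + x3 *\<^sub>R a" using h unfolding in_span3_iff by blast
  obtain y1 y2 y3 where bv: "br b v = y1 *\<^sub>R u + y2 *\<^sub>R v + y3 *\<^sub>R a" using h unfolding in_span3_iff by blast
  obtain z1 z2 z3 where ba: "br b a = z1 *\<^sub>R u + z2 *\<^sub>R v + z3 *\<^sub>R a" using h unfolding in_span3_iff by blast
  have flip: "br v u = 0" "br u a = - u" "br v a = v" "br u b = - br b u" "br v b = - br b v" "br a b = - br b a"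
    using skew[of v u] skew[of u a] skew[of v a] uv au av skew[of u b] skew[of v b] skew[of a b] by simp_all
  note J = jacobi_derivation[of b a u, unfolded au av bu bv ba br_simps flip uv diag]
    jacobi_derivation[of b a v, unfolded au av bu bv ba br_simps flip uv diag]
  have z: "z3 = 0" "x2 = 0" "x3 = 0" "y1 = 0" "y3 = 0"
    using arg_cong[OF J(1), of c1] arg_cong[OF J(1), of c2] arg_cong[OF J(1), of c3]
      arg_cong[OF J(2), of c1] arg_cong[OF J(2), of c2] arg_cong[OF J(2), of c3]
    by (simp_all add: lins c)
  define t where "t = (x1 + y2) / 2"
  \<comment> \<open>The term in a balances the two eigenvalues, the terms in u and v cancel the bracket of b with a.\<close>
  define b' where "b' = 1 *\<^sub>R b + (z1 *\<^sub>R u + (- z2) *\<^sub>R v + ((y2 - x1) / 2) *\<^sub>R a)"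
  have F': "frame u v a b'" unfolding b'_def by (rule frame_update[OF F]) simp
  have b': "br b' u = t *\<^sub>R u" "br b' v = t *\<^sub>R v" "br b' a = 0"
    unfolding b'_def t_def by (simp_all add: br_simps bu bv ba flip uv au av z field_simps scaleR_left_distrib[symmetric] scaleR_left_diff_distrib[symmetric])
  show ?thesis
  proof (cases "t = 0")
    case True
    have "frame a u v b'" using F' by (simp add: frame_def insert_commute)
    then have "lie_isomorphic br (rr3 (- 1))" unfolding table_defs
      by (rule lie_isomorphic_bracketI[OF bil diag])
        (simp_all add: lincomb_def bracket_simps au av uv b' True skew[of u b'] skew[of v b'] skew[of a b'])
    then show ?thesis using rr3_m1 by blast
  next
    case False
    define p q where "p = (1 / (2 * t)) *\<^sub>R b' + (0 *\<^sub>R u + 0 *\<^sub>R v + (1 / 2) *\<^sub>R a)"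
      and "q = (- 1) *\<^sub>R a + (1 *\<^sub>R p + 0 *\<^sub>R u + 0 *\<^sub>R v)"
    have "frame u v a p" unfolding p_def by (rule frame_update[OF F']) (use False in simp)
    then have "frame p u v a" by (simp add: frame_def insert_commute)
    then have "frame p u v q" unfolding q_def by (rule frame_update) simp
    then have F'': "frame p u q v" by (simp add: frame_def insert_commute)
    have pq: "br p u = u" "br p v = 0" "br q u = 0" "br q v = v" "br p q = 0"
      using False by (simp_all add: p_def q_def br_simps b' au av flip skew[of a b'] scaleR_left_distrib[symmetric])
    have "lie_isomorphic br r2r2" unfolding table_defs
      by (rule lie_isomorphic_bracketI[OF bil diag F''])
        (simp_all add: lincomb_def bracket_simps pq uv skew[of u q] skew[of u p] skew[of v p] skew[of v q])
    then show ?thesis using r2r2 by blast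
  qed
qed

text \<open>As in the hyperbolic case, b can be corrected so that it commutes with a and acts on the plane as a
  scalar. If the scalar is not zero, the plane is a complex line on which the real and imaginary
  units act.\<close>

lemma elliptic_case:
  assumes F: "frame u v a b" and uv: "br u v = 0" and au: "br a u = v" and av: "br a v = - u"
    and h: "\<And>x. br b x \<in> span {u, v, a}"
  shows in_table
proof -
  obtain c1 c2 c3 c4 :: "real^4 \<Rightarrow> real" where lin: "linear c1" "linear c2" "linear c3" "linear c4"
    and c: "c1 u = 1" "c1 v = 0" "c1 a = 0" "c1 b = 0"
    "c2 u = 0" "c2 v = 1" "c2 a = 0" "c2 b = 0"
    "c3 u = 0" "c3 v = 0" "c3 a = 1" "c3 b = 0"
    using frame_coordinates[OF F] by metis
  note lins = linear_rules[OF lin(1)] linear_rules[OF lin(2)] linear_rules[OF lin(3)]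
  obtain x1 x2 x3 where bu: "br b u = x1 *\<^sub>R u + x2 *\<^sub>R v + x3 *\<^sub>R a" using h unfolding in_span3_iff by blast
  obtain y1 y2 y3 where bv: "br b v = y1 *\<^sub>R u + y2 *\<^sub>R v + y3 *\<^sub>R a" using h unfolding in_span3_iff by blast
  obtain z1 z2 z3 where ba: "br b a = z1 *\<^sub>R u + z2 *\<^sub>R v + z3 *\<^sub>R a" using h unfolding in_span3_iff by blast
  have flip: "br v u = 0" "br u a = - v" "br v a = u" "br u b = - br b u" "br v b = - br b v" "br a b = - br b a"
    using skew[of v u] skew[of u a] skew[of v a] uv au av skew[of u b] skew[of v b] skew[of a b] by simp_all
  note J = jacobi_derivation[of b a u, unfolded au av bu bv ba br_simps flip uv diag]
    jacobi_derivation[of b a v, unfolded au av bu bv ba br_simps flip uv diag]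
  have z: "z3 = 0" "x3 = 0" "y3 = 0" "y1 = - x2" "y2 = x1"
    using arg_cong[OF J(1), of c1] arg_cong[OF J(1), of c2] arg_cong[OF J(1), of c3]
      arg_cong[OF J(2), of c1] arg_cong[OF J(2), of c2] arg_cong[OF J(2), of c3]
    by (simp_all add: lins c)
  \<comment> \<open>The term in a cancels the rotation, the terms in u and v cancel the bracket of b with a.\<close>
  define b' where "b' = 1 *\<^sub>R b + (z2 *\<^sub>R u + (- z1) *\<^sub>R v + (- x2) *\<^sub>R a)"
  have F': "frame u v a b'" unfolding b'_def by (rule frame_update[OF F]) simp
  have b': "br b' u = x1 *\<^sub>R u" "br b' v = x1 *\<^sub>R v" "br b' a = 0"
    unfolding b'_def by (simp_all add: br_simps bu bv ba flip uv au av z)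
  show ?thesis
  proof (cases "x1 = 0")
    case True
    have "frame a v u b'" using F' by (simp add: frame_def insert_commute)
    then have "lie_isomorphic br rr3'_0" unfolding table_defs
      by (rule lie_isomorphic_bracketI[OF bil diag])
        (simp_all add: lincomb_def bracket_simps au av uv flip b' True skew[of u b'] skew[of v b'] skew[of a b'])
    then show ?thesis using rr3'_0 by blast
  next
    case False
    define p where "p = (1 / x1) *\<^sub>R b' + (0 *\<^sub>R u + 0 *\<^sub>R v + 0 *\<^sub>R a)"
    have "frame u v a p" unfolding p_def by (rule frame_update[OF F']) (use False in simp)
    then have F'': "frame p a u v" by (simp add: frame_def insert_commute)
    have p: "br p u = u" "br p v = v" "br p a = 0"
      using False by (simp_all add: p_def br_simps b')
    have "lie_isomorphic br r2'" unfolding table_defs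
      by (rule lie_isomorphic_bracketI[OF bil diag F''])
        (simp_all add: lincomb_def bracket_simps uv p au av)
    then show ?thesis using r2' by blast
  qed
qed

end

section \<open>Heisenberg ideals\<close>

context symplectic_lie4
begin

text \<open>Inner derivations remove the components along z, and the action on z is then the trace of the
  action on the quotient by z. If this trace is nonzero it is scaled to 1, and the half-identity plus
  a traceless normal form yields \<open>d4\<close>, \<open>h4\<close> and \<open>d4'\<close>. If it vanishes, closedness of the symplectic form
  shows that the action is not invertible: otherwise z would be in the radical of the form.\<close>

lemma heisenberg_case:
  assumes F: "frame x y z b" and xy: "br x y = z" and xz: "br x z = 0" and yz: "br y z = 0"
    and h: "\<And>v. br b v \<in> span {x, y, z}"
  shows in_table
proof -
  obtain c1 c2 c3 c4 :: "real^4 \<Rightarrow> real" where lin: "linear c1" "linear c2" "linear c3" "linear c4"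
    and c: "c1 x = 1" "c1 y = 0" "c1 z = 0" "c1 b = 0"
    "c2 x = 0" "c2 y = 1" "c2 z = 0" "c2 b = 0"
    "c3 x = 0" "c3 y = 0" "c3 z = 1" "c3 b = 0"
    using frame_coordinates[OF F] by metis
  note lins = linear_rules[OF lin(1)] linear_rules[OF lin(2)] linear_rules[OF lin(3)]
  obtain \<alpha> \<gamma> m where bx: "br b x = \<alpha> *\<^sub>R x + \<gamma> *\<^sub>R y + m *\<^sub>R z" using h unfolding in_span3_iff by blast
  obtain \<beta> \<delta> n where b_y: "br b y = \<beta> *\<^sub>R x + \<delta> *\<^sub>R y + n *\<^sub>R z" using h unfolding in_span3_iff by blast
  have flip: "br y x = - z" "br z x = 0" "br z y = 0"
    using skew[of y x] skew[of z x] skew[of z y] xy xz yz by simp_all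
  have bz: "br b z = (\<alpha> + \<delta>) *\<^sub>R z"
    using jacobi_derivation[of b x y] by (simp add: xy bx b_y br_simps xz yz flip scaleR_left_distrib)
  \<comment> \<open>The inner derivations of x and y send y to z and x to - z; they cancel m and n.\<close>
  define b' where "b' = 1 *\<^sub>R b + ((- n) *\<^sub>R x + m *\<^sub>R y + 0 *\<^sub>R z)"
  have F': "frame x y z b'" unfolding b'_def by (rule frame_update[OF F]) simp
  have b': "br b' x = \<alpha> *\<^sub>R x + \<gamma> *\<^sub>R y" "br b' y = \<beta> *\<^sub>R x + \<delta> *\<^sub>R y" "br b' z = (\<alpha> + \<delta>) *\<^sub>R z"
    unfolding b'_def by (simp_all add: br_simps bx b_y bz xy xz yz flip)
  have block: "frame (p *\<^sub>R x + q *\<^sub>R y) (r *\<^sub>R x + s *\<^sub>R y) (d *\<^sub>R z) (k *\<^sub>R b')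
      \<and> br (p *\<^sub>R x + q *\<^sub>R y) (r *\<^sub>R x + s *\<^sub>R y) = (p * s - q * r) *\<^sub>R z"
    if "p * s - q * r \<noteq> 0" "d \<noteq> 0" "k \<noteq> 0" for p q r s d k
  proof -
    have 1: "frame (p *\<^sub>R x + q *\<^sub>R y) (r *\<^sub>R x + s *\<^sub>R y) z (k *\<^sub>R b')"
      by (rule frame_scale[OF frame_block[OF F' that(1)] that(3)])
    have "frame (p *\<^sub>R x + q *\<^sub>R y) (r *\<^sub>R x + s *\<^sub>R y) (k *\<^sub>R b') (d *\<^sub>R z)"
      by (rule frame_scale[OF frame_perm(3)[OF 1] that(2)])
    then show ?thesis using frame_perm(3) by (simp add: br_simps xy flip algebra_simps)
  qed
  show ?thesis
  proof (cases "\<alpha> + \<delta> = 0")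
    case False
    define k where "k = 1 / (\<alpha> + \<delta>)"
    have k: "k \<noteq> 0" "k * (\<alpha> + \<delta>) = 1" using False by (simp_all add: k_def)
    define b2 where "b2 = k *\<^sub>R b'"
    \<comment> \<open>Subtracting half the identity from the scaled matrix of trace 1 leaves a traceless matrix.\<close>
    define A where "A = k * \<alpha> - 1 / 2"
    have kd: "k * \<delta> = 1 / 2 - A" using k(2) by (simp add: A_def algebra_simps)
    have comb: "br b2 (p *\<^sub>R x + q *\<^sub>R y) = (p / 2 + (A * p + (k * \<beta>) * q)) *\<^sub>R x + (q / 2 + ((k * \<gamma>) * p - A * q)) *\<^sub>R y" for p q
    proof -
      have "br b2 (p *\<^sub>R x + q *\<^sub>R y) = ((k * \<alpha>) * p + (k * \<beta>) * q) *\<^sub>R x + ((k * \<gamma>) * p + (k * \<delta>) * q) *\<^sub>R y"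
        by (simp add: b2_def br_simps b' algebra_simps)
      also have "k * \<alpha> = A + 1 / 2" by (simp add: A_def)
      finally show ?thesis unfolding kd by (simp add: algebra_simps)
    qed
    have b2z: "br b2 (d *\<^sub>R z) = d *\<^sub>R z" for d using k(2) by (simp add: b2_def br_simps b')
    show ?thesis
    proof (cases rule: traceless2_normal_form[of A "k * \<beta>" "k * \<gamma>"])
      case zero
      have b2: "br b2 x = (1 / 2) *\<^sub>R x" "br b2 y = (1 / 2) *\<^sub>R y" 
        using comb[of 1 0] comb[of 0 1] zero by simp_all
      have F2: "frame x y z b2" using block[of 1 1 0 0 1 k] k(1) by (simp add: b2_def)
      have "lie_isomorphic br (d4 (1 / 2))" unfolding table_defs
        by (rule lie_isomorphic_bracketI[OF bil diag F2])
          (simp_all add: lincomb_def bracket_simps xy xz yz b2 skew[of x b2] skew[of y b2] skew[of z b2] b2z[of 1, simplified])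
      then show ?thesis using listed_d4[of "1 / 2"] by auto
    next
      case (nilpotent p q r s)
      define u v z' where "u = p *\<^sub>R x + q *\<^sub>R y" and "v = r *\<^sub>R x + s *\<^sub>R y" and "z' = (p * s - q * r) *\<^sub>R z"
      have F2: "frame u v z' b2" and uv: "br u v = z'"
        using block[OF nilpotent(1) nilpotent(1) k(1)] by (simp_all add: u_def v_def z'_def b2_def)
      have zz: "br u z' = 0" "br v z' = 0" by (simp_all add: u_def v_def z'_def br_simps xz yz)
      have b2: "br b2 u = (1 / 2) *\<^sub>R u" "br b2 v = u + (1 / 2) *\<^sub>R v" "br b2 z' = z'"
        unfolding u_def v_def z'_def comb b2z using nilpotent(2-) by (simp_all add: algebra_simps)
      have "lie_isomorphic br h4" unfolding table_defs
        by (rule lie_isomorphic_bracketI[OF bil diag F2])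
          (simp_all add: lincomb_def bracket_simps uv zz b2 skew[of u b2] skew[of v b2] skew[of z' b2])
      then show ?thesis using h4 by blast
    next
      case (hyperbolic p q r s l)
      define u v z' where "u = p *\<^sub>R x + q *\<^sub>R y" and "v = r *\<^sub>R x + s *\<^sub>R y" and "z' = (p * s - q * r) *\<^sub>R z"
      have F2: "frame u v z' b2" and uv: "br u v = z'"
        using block[OF hyperbolic(1) hyperbolic(1) k(1)] by (simp_all add: u_def v_def z'_def b2_def)
      have zz: "br u z' = 0" "br v z' = 0" by (simp_all add: u_def v_def z'_def br_simps xz yz)
      have b2: "br b2 u = (1 / 2 + l) *\<^sub>R u" "br b2 v = (1 - (1 / 2 + l)) *\<^sub>R v" "br b2 z' = z'"
        unfolding u_def v_def z'_def comb b2z hyperbolic(3-) by (simp_all add: algebra_simps)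
      have "lie_isomorphic br (d4 (1 / 2 + l))" unfolding table_defs
        by (rule lie_isomorphic_bracketI[OF bil diag F2])
          (simp_all add: lincomb_def bracket_simps uv zz b2 skew[of u b2] skew[of v b2] skew[of z' b2] algebra_simps)
      then show ?thesis using listed_d4[of "1 / 2 + l"] hyperbolic(2) by auto
    next
      case (elliptic p q r s l)
      define u v z' where "u = p *\<^sub>R x + q *\<^sub>R y" and "v = r *\<^sub>R x + s *\<^sub>R y" and "z' = (- (p * s - q * r)) *\<^sub>R z"
      define b3 where "b3 = (k / l) *\<^sub>R b'"
      have b3: "br b3 w = (1 / l) *\<^sub>R br b2 w" for w by (simp add: b3_def b2_def br_simps)
      have "frame u v z' b3" and uv: "br v u = z'"
        using block[OF elliptic(1), of "- (p * s - q * r)" "k / l"] elliptic(1,2) k(1) skew[of v u]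
        by (simp_all add: u_def v_def z'_def b3_def algebra_simps)
      then have F3: "frame v u z' b3" by (simp add: frame_def insert_commute)
      have zz: "br u z' = 0" "br v z' = 0" by (simp_all add: u_def v_def z'_def br_simps xz yz)
      have E: "br b2 u = (1 / 2) *\<^sub>R u + l *\<^sub>R v" "br b2 v = (1 / 2) *\<^sub>R v - l *\<^sub>R u" "br b2 z' = z'"
        unfolding u_def v_def z'_def comb b2z elliptic(3-) by (simp_all add: algebra_simps)
      have b3': "br b3 u = (1 / l / 2) *\<^sub>R u + v" "br b3 v = (1 / l / 2) *\<^sub>R v - u" "br b3 z' = (1 / l) *\<^sub>R z'"
        using elliptic(2) by (simp_all add: b3 E algebra_simps)
      have "lie_isomorphic br (d4' (1 / l))" unfolding table_defs
        by (rule lie_isomorphic_bracketI[OF bil diag F3])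
          (simp_all add: lincomb_def bracket_simps uv zz b3' skew[of u b3] skew[of v b3] skew[of z' b3] algebra_simps)
      then show ?thesis using d4'_delta[of "1 / l"] elliptic(2) by auto
    qed
  next
    case True
    then have \<delta>: "\<delta> = - \<alpha>" by simp
    have comb: "br b' (p *\<^sub>R x + q *\<^sub>R y) = (\<alpha> * p + \<beta> * q) *\<^sub>R x + (\<gamma> * p - \<alpha> * q) *\<^sub>R y" for p q
      by (simp add: br_simps b' \<delta> algebra_simps)
    have bz': "br b' z = 0" using b'(3) True by simp
    show ?thesis
    proof (cases rule: traceless2_normal_form[of \<alpha> \<beta> \<gamma>])
      case zero
      have "lie_isomorphic br rh3" unfolding table_defs
        by (rule lie_isomorphic_bracketI[OF bil diag F'])
          (simp_all add: lincomb_def bracket_simps xy xz yz b' bz' zero \<delta> skew[of x b'] skew[of y b'] skew[of z b'])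
      then show ?thesis using rh3 by blast
    next
      case (nilpotent p q r s)
      define u v z' where "u = p *\<^sub>R x + q *\<^sub>R y" and "v = r *\<^sub>R x + s *\<^sub>R y" and "z' = (p * s - q * r) *\<^sub>R z"
      have F2: "frame u v z' b'" and uv: "br u v = z'"
        using block[OF nilpotent(1) nilpotent(1), of 1] by (simp_all add: u_def v_def z'_def)
      have zz: "br u z' = 0" "br v z' = 0" by (simp_all add: u_def v_def z'_def br_simps xz yz)
      have b2: "br b' u = 0" "br b' v = u" "br b' z' = 0"
        unfolding u_def v_def z'_def comb nilpotent(2-) by (simp_all add: br_simps bz')
      have F3: "frame b' (- u) z' v"
        using frame_scale[OF frame_rotate[OF F2], of "- 1"] by (simp add: frame_def insert_commute)
      have "lie_isomorphic br n4" unfolding table_defs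
        by (rule lie_isomorphic_bracketI[OF bil diag F3])
          (simp_all add: lincomb_def bracket_simps br_simps uv zz b2 skew[of u b'] skew[of v b'] skew[of z' b'] skew[of v u] skew[of z' v] )
      then show ?thesis using n4 by blast
    next
      case (hyperbolic p q r s l)
      define u v z' where "u = p *\<^sub>R x + q *\<^sub>R y" and "v = r *\<^sub>R x + s *\<^sub>R y" and "z' = (p * s - q * r) *\<^sub>R z"
      have F2: "frame u v z' b'" and uv: "br u v = z'"
        using block[OF hyperbolic(1) hyperbolic(1), of 1] by (simp_all add: u_def v_def z'_def)
      have zz: "br u z' = 0" "br v z' = 0" by (simp_all add: u_def v_def z'_def br_simps xz yz)
      have b2: "br b' u = l *\<^sub>R u" "br b' v = (- l) *\<^sub>R v" "br b' z' = 0"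
        unfolding u_def v_def z'_def comb hyperbolic(3-) by (simp_all add: br_simps bz' algebra_simps)
      have "w u z' = 0" "w v z' = 0" "w z' b' = 0"
        using closed[of u z' b'] closed[of v z' b'] closed[of u v b'] hyperbolic(2) skew[of v b'] skew[of z' b'] skew_w[of v u]
        by (simp_all add: zz uv b2 w_simps)
      then show ?thesis using pfaffian_frame[OF F2] by simp
    next
      case (elliptic p q r s l)
      define u v z' where "u = p *\<^sub>R x + q *\<^sub>R y" and "v = r *\<^sub>R x + s *\<^sub>R y" and "z' = (p * s - q * r) *\<^sub>R z"
      have F2: "frame u v z' b'" and uv: "br u v = z'"
        using block[OF elliptic(1) elliptic(1), of 1] by (simp_all add: u_def v_def z'_def)
      have zz: "br u z' = 0" "br v z' = 0" by (simp_all add: u_def v_def z'_def br_simps xz yz)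
      have b2: "br b' u = l *\<^sub>R v" "br b' v = (- l) *\<^sub>R u" "br b' z' = 0"
        unfolding u_def v_def z'_def comb elliptic(3-) by (simp_all add: br_simps bz' algebra_simps)
      have "w u z' = 0" "w v z' = 0" "w z' b' = 0"
        using closed[of u z' b'] closed[of v z' b'] closed[of u v b'] elliptic(2) skew[of v b'] skew[of z' b'] skew_w[of v u]
        by (simp_all add: zz uv b2 w_simps)
      then show ?thesis using pfaffian_frame[OF F2] by simp
    qed
  qed
qed

end

section \<open>Abelian ideals\<close>

lemma frame_exchange:
  assumes F: "frame b1 b2 b3 b4" and Q: "Q = q1 *\<^sub>R b1 + q2 *\<^sub>R b2 + q3 *\<^sub>R b3" "Q \<noteq> 0"
  obtains x y where "frame x y Q b4" "{x, y} \<subseteq> {b1, b2, b3}"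
proof -
  consider "q1 \<noteq> 0" | "q2 \<noteq> 0" | "q3 \<noteq> 0"
    using Q by (cases "q1 = 0"; cases "q2 = 0"; simp)
  then show ?thesis
  proof cases
    case 1
    have "frame b2 b3 b4 (q1 *\<^sub>R b1 + (q2 *\<^sub>R b2 + q3 *\<^sub>R b3 + 0 *\<^sub>R b4))"
      by (rule frame_update[OF frame_rotate[OF F] 1])
    then have "frame b2 b3 Q b4" using Q by (simp add: frame_def insert_commute add_ac)
    then show ?thesis by (rule that) simp
  next
    case 2
    have "frame b1 b3 b4 (q2 *\<^sub>R b2 + (q1 *\<^sub>R b1 + q3 *\<^sub>R b3 + 0 *\<^sub>R b4))"
      by (rule frame_update[OF _ 2]) (use F in \<open>simp add: frame_def insert_commute\<close>)
    then have "frame b1 b3 Q b4" using Q by (simp add: frame_def insert_commute add_ac)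
    then show ?thesis by (rule that) simp
  next
    case 3
    have "frame b1 b2 b4 (q3 *\<^sub>R b3 + (q1 *\<^sub>R b1 + q2 *\<^sub>R b2 + 0 *\<^sub>R b4))"
      by (rule frame_update[OF _ 3]) (use F in \<open>simp add: frame_def insert_commute\<close>)
    then have "frame b1 b2 Q b4" using Q by (simp add: frame_def insert_commute add_ac)
    then show ?thesis by (rule that) simp
  qed
qed

context lie4
begin

text \<open>The first of four lemmas on an abelian ideal with an eigenvector q of the complementary vector b,
  one for each normal form of the action on the quotient by q. The components m and n along q are
  removed by adding multiples of q to u and v whenever the eigenvalue t differs from those on the
  quotient.\<close>

lemma almost_abelian_zero_case:
  assumes F: "frame u v q b" and ab: "br u v = 0" "br u q = 0" "br v q = 0"
    and bu: "br b u = m *\<^sub>R q" and bv: "br b v = n *\<^sub>R q" and bq: "br b q = t *\<^sub>R q"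
    and nonab: "\<exists>x y. br x y \<noteq> 0"
  shows in_table
proof -
  have rh3_if: in_table if F: "frame x y q b" and xy: "br x y = 0" "br x q = 0" "br y q = 0"
      and bx: "br b x = m *\<^sub>R q" "m \<noteq> 0" and b_y: "br b y = n *\<^sub>R q" and b_q: "br b q = 0" for x y m n
  proof -
    define y' where "y' = 1 *\<^sub>R y + ((- n / m) *\<^sub>R x + 0 *\<^sub>R (m *\<^sub>R q) + 0 *\<^sub>R b)"
    have "frame x (m *\<^sub>R q) b y"
      using frame_scale[of x b y q m] F bx(2) by (simp add: frame_def insert_commute)
    then have "frame x (m *\<^sub>R q) b y'" 
      unfolding y'_def using frame_update[of x "m *\<^sub>R q" b y 1 "- n / m" 0 0] by simp
    then have F': "frame b x (m *\<^sub>R q) y'" by (simp add: frame_def insert_commute)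
    have "br b y' = 0" "br x y' = 0" "br q y' = 0"
      using bx skew[of q x] skew[of q y] by (simp_all add: y'_def br_simps b_y xy)
    then have "lie_isomorphic br rh3" unfolding table_defs
      by (intro lie_isomorphic_bracketI[OF bil diag F'])
        (simp_all add: lincomb_def bracket_simps br_simps bx b_q xy)
    then show ?thesis using rh3 by blast
  qed
  have vu: "br v u = 0" using ab(1) skew[of v u] by simp
  show ?thesis
  proof (cases "t = 0")
    case False
    define u' where "u' = 1 *\<^sub>R u + ((- m / t) *\<^sub>R q + 0 *\<^sub>R v + 0 *\<^sub>R b)"
    define v' where "v' = 1 *\<^sub>R v + ((- n / t) *\<^sub>R q + 0 *\<^sub>R u' + 0 *\<^sub>R b)"
    have "frame q v b u'" unfolding u'_def
      by (rule frame_update) (use F in \<open>simp_all add: frame_def insert_commute\<close>)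
    then have "frame q u' b v" by (simp add: frame_def insert_commute)
    then have "frame q u' b v'" unfolding v'_def by (rule frame_update) simp
    then have "frame q u' v' ((1 / t) *\<^sub>R b)"
      using frame_scale[of q u' v' b "1 / t"] False by (simp add: frame_def insert_commute)
    then have F': "frame ((1 / t) *\<^sub>R b) q u' v'" by (simp add: frame_def insert_commute)
    have "lie_isomorphic br (rr3 0)" unfolding table_defs
      by (rule lie_isomorphic_bracketI[OF bil diag F'])
        (use False in \<open>simp_all add: lincomb_def bracket_simps u'_def v'_def br_simps bu bv bq ab vu skew[of q u] skew[of q v]\<close>)
    then show ?thesis using rr3_0 by blast
  next
    case True
    consider "m \<noteq> 0" | "n \<noteq> 0" | "m = 0" "n = 0" by blast
    then show ?thesis
    proof cases
      case 1
      then show ?thesis using rh3_if[OF F ab bu 1 bv] bq True by simp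
    next
      case 2
      then show ?thesis using rh3_if[OF frame_perm(1)[OF F] vu ab(3,2) bv 2 bu] bq True by simp
    next
      case 3
      have "br x y = 0" for x y
      proof -
        obtain x1 x2 x3 x4 y1 y2 y3 y4 where "x = x1 *\<^sub>R u + x2 *\<^sub>R v + x3 *\<^sub>R q + x4 *\<^sub>R b"
          "y = y1 *\<^sub>R u + y2 *\<^sub>R v + y3 *\<^sub>R q + y4 *\<^sub>R b"
          using F unfolding frame_def by (metis UNIV_I in_span4_iff)
        then show ?thesis using 3 True
          by (simp add: br_simps ab bu bv bq skew[of v u] skew[of q u] skew[of q v] skew[of u b] skew[of v b] skew[of q b])
      qed
      then show ?thesis using nonab by blast
    qed
  qed
qed

lemma almost_abelian_nilpotent_case:
  assumes F: "frame u v q b" and ab: "br u v = 0" "br u q = 0" "br v q = 0"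
    and bu: "br b u = m *\<^sub>R q" and bv: "br b v = u + n *\<^sub>R q" and bq: "br b q = t *\<^sub>R q"
  shows in_table
proof -
  note flip = skew[of v u] skew[of q u] skew[of q v] skew[of u b] skew[of v b] skew[of q b]
  show ?thesis
  proof (cases "t = 0")
    case False
    define u' where "u' = (1 / t) *\<^sub>R u + ((- m / (t * t)) *\<^sub>R q + 0 *\<^sub>R v + 0 *\<^sub>R b)"
    define v' where "v' = 1 *\<^sub>R v + ((- (m / t + n) / t) *\<^sub>R q + 0 *\<^sub>R u' + 0 *\<^sub>R b)"
    have "frame q v b u'" unfolding u'_def
      by (rule frame_update) (use F False in \<open>simp_all add: frame_def insert_commute\<close>)
    then have "frame q u' b v" by (simp add: frame_def insert_commute)
    then have "frame q u' b v'" unfolding v'_def by (rule frame_update) simp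
    then have F': "frame q u' v' ((1 / t) *\<^sub>R b)"
      using frame_scale[of q u' v' b "1 / t"] False by (simp add: frame_def insert_commute)
    have bu': "br b u' = 0" using False by (simp add: u'_def br_simps bu bq)
    have "br b v' = u + (n + (- (m / t + n) / t) * t) *\<^sub>R q"
      by (simp add: v'_def br_simps bv bu' bq scaleR_left_distrib)
    also have "n + (- (m / t + n) / t) * t = t * (- m / (t * t))" using False by simp
    finally have bv': "br b v' = t *\<^sub>R u'" using False by (simp add: u'_def scaleR_right_distrib scaleR_right_diff_distrib)
    have ab': "br u' v' = 0" "br q u' = 0" "br q v' = 0"
      by (simp_all add: u'_def v'_def br_simps ab flip)
    have "lie_isomorphic br (r4_mu 0)" unfolding table_defs
      by (rule lie_isomorphic_bracketI[OF bil diag F'])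
        (use False in \<open>simp_all add: lincomb_def bracket_simps br_simps bu' bv' bq ab' skew[of u' b] skew[of v' b] skew[of q b]\<close>)
    then show ?thesis using r4_0 by blast
  next
    case True
    define u' where "u' = 1 *\<^sub>R u + (n *\<^sub>R q + 0 *\<^sub>R v + 0 *\<^sub>R b)"
    have "frame q v b u'" unfolding u'_def
      by (rule frame_update) (use F in \<open>simp_all add: frame_def insert_commute\<close>)
    then have F': "frame v b u' q" by (simp add: frame_def insert_commute)
    show ?thesis
    proof (cases "m = 0")
      case m: True
      have F'': "frame b v u' q" using F' by (simp add: frame_def insert_commute)
      have "lie_isomorphic br rh3" unfolding table_defs
        by (rule lie_isomorphic_bracketI[OF bil diag F''])
          (simp_all add: lincomb_def bracket_simps u'_def br_simps bu bv bq ab flip True m)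
      then show ?thesis using rh3 by blast
    next
      case False
      have F'': "frame v u' (m *\<^sub>R q) b"
        using frame_scale[OF F' False] by (simp add: frame_def insert_commute)
      have "lie_isomorphic br n4" unfolding table_defs
        by (rule lie_isomorphic_bracketI[OF bil diag F''])
          (simp_all add: lincomb_def bracket_simps u'_def br_simps bu bv bq ab flip True)
      then show ?thesis using n4 by blast
    qed
  qed
qed

text \<open>The eigenvalues are \<open>1, - 1, t\<close>. Since \<open>t \<ge> 0\<close>, only \<open>t = 1\<close> can produce a Jordan block. Otherwise the
  matrix is diagonalizable, and for \<open>t \<noteq> 0\<close> it is scaled by an eigenvalue of largest modulus so that
  the parameter lands in the range of the table.\<close>

lemma almost_abelian_hyperbolic_case:
  assumes F: "frame u v q b" and ab: "br u v = 0" "br u q = 0" "br v q = 0"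
    and bu: "br b u = u + m *\<^sub>R q" and bv: "br b v = - v + n *\<^sub>R q" and bq: "br b q = t *\<^sub>R q"
    and t: "t \<ge> 0"
  shows in_table
proof -
  note flip = skew[of v u] skew[of q u] skew[of q v] skew[of u b] skew[of v b] skew[of q b]
  define v' where "v' = 1 *\<^sub>R v + ((- n / (t + 1)) *\<^sub>R q + 0 *\<^sub>R u + 0 *\<^sub>R b)"
  have "n + (- n / (t + 1)) * t = n / (t + 1)" using t by (simp add: field_simps)
  then have bv': "br b v' = - v'"
    using t by (simp add: v'_def br_simps bv bq scaleR_left_distrib[symmetric] algebra_simps)
  have ab': "br u v' = 0" "br v' q = 0" by (simp_all add: v'_def br_simps ab)
  have "frame q u b v'" unfolding v'_def
    by (rule frame_update) (use F in \<open>simp_all add: frame_def insert_commute\<close>)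
  then have F1: "frame u v' q b" by (simp add: frame_def insert_commute)
  note flip' = skew[of v' u] skew[of q v'] skew[of v' b]
  show ?thesis
  proof (cases "t = 1 \<and> m \<noteq> 0")
    case True
    then have "frame v' u b ((- m) *\<^sub>R q)"
      using frame_scale[of v' u b q "- m"] F1 by (simp add: frame_def insert_commute)
    then have "frame v' u ((- m) *\<^sub>R q) ((- 1) *\<^sub>R b)"
      using frame_scale[of v' u "(- m) *\<^sub>R q" b "- 1"] by (simp add: frame_def insert_commute)
    then have F2: "frame v' ((- m) *\<^sub>R q) u ((- 1) *\<^sub>R b)" by (simp add: frame_def insert_commute)
    have "lie_isomorphic br (r4_mu (- 1))" unfolding table_defs
      by (rule lie_isomorphic_bracketI[OF bil diag F2])
        (use True in \<open>simp_all add: lincomb_def bracket_simps br_simps bu bv' bq ab ab' flip flip'\<close>)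
    then show ?thesis using r4_m1 by blast
  next
    case False
    define u' where "u' = 1 *\<^sub>R u + ((m / (1 - t)) *\<^sub>R q + 0 *\<^sub>R v' + 0 *\<^sub>R b)"
    have "m + m / (1 - t) * t = m / (1 - t)" using False by (cases "t = 1") (simp_all add: field_simps)
    then have bu': "br b u' = u'"
      by (simp add: u'_def br_simps bu bq scaleR_left_distrib[symmetric])
    have ab'': "br u' v' = 0" "br u' q = 0"
      using skew[of q v'] by (simp_all add: u'_def br_simps ab ab')
    have "frame q v' b u'" unfolding u'_def
      by (rule frame_update) (use F1 in \<open>simp_all add: frame_def insert_commute\<close>)
    then have F2: "frame v' u' q b" by (simp add: frame_def insert_commute)
    note flip'' = skew[of v' u'] skew[of q u'] skew[of u' b] skew[of q v'] skew[of v' b] skew[of q b]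
    consider "t = 0" | "0 < t" "t \<le> 1" | "t > 1" using t by linarith
    then show ?thesis
    proof cases
      case 1
      have F3: "frame b u' v' q" using F2 by (simp add: frame_def insert_commute)
      have "lie_isomorphic br (rr3 (- 1))" unfolding table_defs
        by (rule lie_isomorphic_bracketI[OF bil diag F3])
          (simp_all add: lincomb_def bracket_simps br_simps bu' bv' bq ab' ab'' flip'' 1)
      then show ?thesis using rr3_m1 by blast
    next
      case 2
      have F3: "frame v' u' q ((- 1) *\<^sub>R b)" by (rule frame_scale[OF F2]) simp
      have "lie_isomorphic br (r4_alpha_beta (- 1) (- t))" unfolding table_defs
        by (rule lie_isomorphic_bracketI[OF bil diag F3])
          (simp_all add: lincomb_def bracket_simps br_simps bu' bv' bq ab' ab'' flip'')
      moreover have "\<exists>S. listed (r4_alpha_beta (- 1) (- t)) S"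
        using 2 r4_m1_beta[of "- t"] r4_m1_m1 by (cases "t = 1") auto
      ultimately show ?thesis by blast
    next
      case 3
      have F3: "frame v' u' q ((1 / t) *\<^sub>R b)" by (rule frame_scale[OF F2]) (use 3 in simp)
      then have F4: "frame q v' u' ((1 / t) *\<^sub>R b)" by (simp add: frame_def insert_commute)
      have "lie_isomorphic br (r4_alpha_beta (- 1 / t) (- (- 1 / t)))" unfolding table_defs
        by (rule lie_isomorphic_bracketI[OF bil diag F4])
          (use 3 in \<open>simp_all add: lincomb_def bracket_simps br_simps bu' bv' bq ab' ab'' flip''\<close>)
      moreover have "\<exists>S. listed (r4_alpha_beta (- 1 / t) (- (- 1 / t))) S"
        using 3 r4_alpha_malpha[of "- 1 / t"] by auto
      ultimately show ?thesis by blast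
    qed
  qed
qed

text \<open>The eigenvalue t is real and those on the quotient are not, so the components along q can always be
  removed; s and r solve the corresponding two linear equations.\<close>

lemma almost_abelian_elliptic_case:
  assumes F: "frame u v q b" and ab: "br u v = 0" "br u q = 0" "br v q = 0"
    and bu: "br b u = v + m *\<^sub>R q" and bv: "br b v = - u + n *\<^sub>R q" and bq: "br b q = t *\<^sub>R q"
  shows in_table
proof -
  note flip = skew[of v u] skew[of q u] skew[of q v] skew[of u b] skew[of v b] skew[of q b]
  have pos: "1 + t * t > 0" by (simp add: add_pos_nonneg)
  define s where "s = - (n + m * t) / (1 + t * t)"
  define r where "r = m + s * t"
  have s: "n + r * t = - s"
  proof -
    have "s * (1 + t * t) = - (n + m * t)" using pos by (simp add: s_def)
    then show ?thesis by (simp add: r_def algebra_simps)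
  qed
  define u' where "u' = 1 *\<^sub>R u + (s *\<^sub>R q + 0 *\<^sub>R v + 0 *\<^sub>R b)"
  define v' where "v' = 1 *\<^sub>R v + (r *\<^sub>R q + 0 *\<^sub>R u' + 0 *\<^sub>R b)"
  have "frame q v b u'" unfolding u'_def
    by (rule frame_update) (use F in \<open>simp_all add: frame_def insert_commute\<close>)
  then have "frame q u' b v" by (simp add: frame_def insert_commute)
  then have "frame q u' b v'" unfolding v'_def by (rule frame_update) simp
  then have F': "frame q u' v' b" by (simp add: frame_def insert_commute)
  have "br b u' = v + (m + s * t) *\<^sub>R q" by (simp add: u'_def br_simps bu bq algebra_simps)
  then have bu': "br b u' = v'" by (simp add: v'_def r_def)
  have "br b v' = - u + (n + r * t) *\<^sub>R q" by (simp add: v'_def br_simps bv bq algebra_simps)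
  then have bv': "br b v' = - u'" by (simp add: u'_def s)
  have ab': "br u' v' = 0" "br u' q = 0" "br v' q = 0"
    by (simp_all add: u'_def v'_def br_simps ab flip)
  note flip' = skew[of v' u'] skew[of q u'] skew[of u' b] skew[of q v'] skew[of v' b] skew[of q b]
  consider "t = 0" | "t > 0" | "t < 0" by linarith
  then show ?thesis
  proof cases
    case 1
    have F'': "frame b v' u' q" using F' by (simp add: frame_def insert_commute)
    have "lie_isomorphic br rr3'_0" unfolding table_defs
      by (rule lie_isomorphic_bracketI[OF bil diag F''])
        (simp_all add: lincomb_def bracket_simps br_simps bu' bv' bq ab' flip' 1)
    then show ?thesis using rr3'_0 by blast
  next
    case 2
    have F'': "frame q v' u' ((1 / t) *\<^sub>R b)"
      using frame_scale[OF F', of "1 / t"] 2 by (simp add: frame_def insert_commute)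
    have "lie_isomorphic br (r4' 0 (1 / t))" unfolding table_defs
      by (rule lie_isomorphic_bracketI[OF bil diag F''])
        (use 2 in \<open>simp_all add: lincomb_def bracket_simps br_simps bu' bv' bq ab' flip'\<close>)
    then show ?thesis using r4'_0_delta[of "1 / t"] 2 by auto
  next
    case 3
    have F'': "frame q u' v' ((1 / t) *\<^sub>R b)"
      using frame_scale[OF F', of "1 / t"] 3 by (simp add: frame_def insert_commute)
    have "lie_isomorphic br (r4' 0 (- 1 / t))" unfolding table_defs
      by (rule lie_isomorphic_bracketI[OF bil diag F''])
        (use 3 in \<open>simp_all add: lincomb_def bracket_simps br_simps bu' bv' bq ab' flip'\<close>)
    then show ?thesis using r4'_0_delta[of "- 1 / t"] 3 by auto
  qed
qed

end

context symplectic_lie4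
begin

text \<open>Let q be the vector that represents the restriction of w to the ideal through the volume form of the
  frame. Closedness says that q is an eigenvector of the action of b4 whose eigenvalue is the trace of
  that action. In a frame containing q the remaining diagonal entries therefore sum to zero.\<close>

lemma eigenvector_frame:
  assumes F: "frame b1 b2 b3 b4" and ab: "br b1 b2 = 0" "br b1 b3 = 0" "br b2 b3 = 0"
    and h: "\<And>x. br b4 x \<in> span {b1, b2, b3}"
  obtains x y q a b c m n t where "frame x y q b4" "br x y = 0" "br x q = 0" "br y q = 0"
    "br b4 x = a *\<^sub>R x + c *\<^sub>R y + m *\<^sub>R q" "br b4 y = b *\<^sub>R x - a *\<^sub>R y + n *\<^sub>R q"
    "br b4 q = t *\<^sub>R q"
proof -
  obtain c1 c2 c3 c4 :: "real^4 \<Rightarrow> real" where lin: "linear c1" "linear c2" "linear c3" "linear c4"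
    and c: "c1 b1 = 1" "c1 b2 = 0" "c1 b3 = 0" "c1 b4 = 0"
    "c2 b1 = 0" "c2 b2 = 1" "c2 b3 = 0" "c2 b4 = 0"
    "c3 b1 = 0" "c3 b2 = 0" "c3 b3 = 1" "c3 b4 = 0"
    "c4 b1 = 0" "c4 b2 = 0" "c4 b3 = 0" "c4 b4 = 1"
    and trace: "\<And>f. linear f \<Longrightarrow> trace (matrix f) = c1 (f b1) + c2 (f b2) + c3 (f b3) + c4 (f b4)"
    using frame_coordinates[OF F] by blast
  note lins = linear_rules[OF lin(1)] linear_rules[OF lin(2)] linear_rules[OF lin(3)] linear_rules[OF lin(4)]
  obtain d11 d21 d31 where D1: "br b4 b1 = d11 *\<^sub>R b1 + d21 *\<^sub>R b2 + d31 *\<^sub>R b3"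
    using h[of b1] unfolding in_span3_iff by blast
  obtain d12 d22 d32 where D2: "br b4 b2 = d12 *\<^sub>R b1 + d22 *\<^sub>R b2 + d32 *\<^sub>R b3"
    using h[of b2] unfolding in_span3_iff by blast
  obtain d13 d23 d33 where D3: "br b4 b3 = d13 *\<^sub>R b1 + d23 *\<^sub>R b2 + d33 *\<^sub>R b3"
    using h[of b3] unfolding in_span3_iff by blast
  have flip: "br b2 b1 = 0" "br b3 b1 = 0" "br b3 b2 = 0"
    using ab skew[of b2 b1] skew[of b3 b1] skew[of b3 b2] by simp_all
  have t: "tr_ad b4 = d11 + d22 + d33"
    by (simp add: tr_ad_def trace[OF linear_br(1)] D1 D2 D3 lins c)
  note fl = skew[of b1 b4] skew[of b2 b4] skew[of b3 b4]
  have flipw: "w b3 b2 = - w b2 b3" "w b3 b1 = - w b1 b3" "w b2 b1 = - w b1 b2" by (rule skew_w)+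
  define q where "q = w b2 b3 *\<^sub>R b1 + (- w b1 b3) *\<^sub>R b2 + w b1 b2 *\<^sub>R b3"
  have q0: "q \<noteq> 0"
  proof
    assume "q = 0"
    then have "c1 q = 0" "c2 q = 0" "c3 q = 0" by (simp_all add: lins)
    then show False using pfaffian_frame[OF F] by (simp add: q_def lins c)
  qed
  note cl = closed[of b1 b2 b4] closed[of b1 b3 b4] closed[of b2 b3 b4]
  have bq: "br b4 q = tr_ad b4 *\<^sub>R q"
  proof -
    have e: "d11 * w b2 b3 - d12 * w b1 b3 + d13 * w b1 b2 = (d11 + d22 + d33) * w b2 b3"
      "d21 * w b2 b3 - d22 * w b1 b3 + d23 * w b1 b2 = - (d11 + d22 + d33) * w b1 b3"
      "d31 * w b2 b3 - d32 * w b1 b3 + d33 * w b1 b2 = (d11 + d22 + d33) * w b1 b2"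
      using cl by (simp_all add: ab fl D1 D2 D3 w_simps flipw algebra_simps)
    have "br b4 q = (d11 * w b2 b3 - d12 * w b1 b3 + d13 * w b1 b2) *\<^sub>R b1
      + (d21 * w b2 b3 - d22 * w b1 b3 + d23 * w b1 b2) *\<^sub>R b2
      + (d31 * w b2 b3 - d32 * w b1 b3 + d33 * w b1 b2) *\<^sub>R b3"
      by (simp add: q_def br_simps D1 D2 D3 algebra_simps)
    then show ?thesis unfolding e t q_def by (simp add: algebra_simps)
  qed
  obtain x y where F': "frame x y q b4" and xy: "{x, y} \<subseteq> {b1, b2, b3}"
    by (rule frame_exchange[OF F q_def q0])
  have comm: "br x' y' = 0" if "x' \<in> {b1, b2, b3}" "y' \<in> {b1, b2, b3}" for x' y'
    using that ab flip by auto
  then have ab': "br x y = 0" "br x q = 0" "br y q = 0"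
    using xy by (simp_all add: q_def br_simps)
  have c4: "c4 x' = 0" if "x' \<in> {b1, b2, b3}" for x' using that c by auto
  have dec: "\<exists>p r s. br b4 v = p *\<^sub>R x + r *\<^sub>R y + s *\<^sub>R q" for v
  proof -
    obtain p r s k where v: "br b4 v = p *\<^sub>R x + r *\<^sub>R y + s *\<^sub>R q + k *\<^sub>R b4"
      using F' unfolding frame_def by (metis UNIV_I in_span4_iff)
    have "c4 (br b4 v) = 0"
      using h[of v] unfolding in_span3_iff by (auto simp: lins c)
    moreover have "c4 (br b4 v) = k" using c4 xy unfolding v by (simp add: lins c q_def)
    ultimately show ?thesis using v by auto
  qed
  obtain a cc m where bx: "br b4 x = a *\<^sub>R x + cc *\<^sub>R y + m *\<^sub>R q" using dec by blast
  obtain b d n where b_y: "br b4 y = b *\<^sub>R x + d *\<^sub>R y + n *\<^sub>R q" using dec by blast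
  obtain c1 c2 c3 c4 :: "real^4 \<Rightarrow> real" where lin: "linear c1" "linear c2" "linear c3" "linear c4"
    and c: "c1 x = 1" "c1 y = 0" "c1 q = 0" "c1 b4 = 0"
    "c2 x = 0" "c2 y = 1" "c2 q = 0" "c2 b4 = 0"
    "c3 x = 0" "c3 y = 0" "c3 q = 1" "c3 b4 = 0"
    and trace: "\<And>f. linear f \<Longrightarrow> trace (matrix f) = c1 (f x) + c2 (f y) + c3 (f q) + c4 (f b4)"
    using frame_coordinates[OF F'] by metis
  note lins = linear_rules[OF lin(1)] linear_rules[OF lin(2)] linear_rules[OF lin(3)] linear_rules[OF lin(4)]
  have "tr_ad b4 = a + d + tr_ad b4"
    using trace[OF linear_br(1), of b4] unfolding tr_ad_def[symmetric] by (simp add: bx b_y bq lins c)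
  then have "d = - a" by simp
  then have "br b4 y = b *\<^sub>R x - a *\<^sub>R y + n *\<^sub>R q" using b_y by simp
  then show ?thesis by (rule that[OF F' ab' bx _ bq])
qed

text \<open>In the hyperbolic case, exchanging u and v while negating the complementary vector changes the sign
  of the third eigenvalue, which may therefore be taken nonnegative.\<close>

lemma abelian_ideal_case:
  assumes F: "frame b1 b2 b3 b4" and ab: "br b1 b2 = 0" "br b1 b3 = 0" "br b2 b3 = 0"
    and h: "\<And>x. br b4 x \<in> span {b1, b2, b3}" and nonab: "\<exists>x y. br x y \<noteq> 0"
  shows in_table
proof -
  obtain x y z a b c m n t where F': "frame x y z b4" and ab': "br x y = 0" "br x z = 0" "br y z = 0"
    and bx: "br b4 x = a *\<^sub>R x + c *\<^sub>R y + m *\<^sub>R z" and b_y: "br b4 y = b *\<^sub>R x - a *\<^sub>R y + n *\<^sub>R z"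
    and bz: "br b4 z = t *\<^sub>R z"
    by (rule eigenvector_frame[OF F ab h])
  have comb: "br b4 (p *\<^sub>R x + q *\<^sub>R y) = (a * p + b * q) *\<^sub>R x + (c * p - a * q) *\<^sub>R y + (m * p + n * q) *\<^sub>R z" for p q
    by (simp add: br_simps bx b_y algebra_simps)
  have ab2: "br (p *\<^sub>R x + q *\<^sub>R y) (r *\<^sub>R x + s *\<^sub>R y) = 0" "br (p *\<^sub>R x + q *\<^sub>R y) z = 0" for p q r s
    using skew[of y x] by (simp_all add: br_simps ab')
  show ?thesis
  proof (cases rule: traceless2_normal_form[of a b c])
    case zero
    then show ?thesis using almost_abelian_zero_case[OF F' ab' _ _ bz nonab, of m n] bx b_y by simp
  next
    case (nilpotent p q r s)
    show ?thesis
      by (rule almost_abelian_nilpotent_case[OF frame_block[OF F' nilpotent(1)] ab2 ab2(2) _ _ bz,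
          of "m * p + n * q" "m * r + n * s"];
          unfold comb nilpotent(2-); simp)
  next
    case (hyperbolic p q r s k)
    define u v M N where "u = p *\<^sub>R x + q *\<^sub>R y" and "v = r *\<^sub>R x + s *\<^sub>R y"
      and "M = m * p + n * q" and "N = m * r + n * s"
    have uv: "frame u v z b4" "br u v = 0" "br u z = 0" "br v z = 0"
      unfolding u_def v_def using frame_block[OF F' hyperbolic(1)] ab2 by simp_all
    have bu: "br b4 u = k *\<^sub>R u + M *\<^sub>R z" and bv: "br b4 v = - k *\<^sub>R v + N *\<^sub>R z"
      unfolding u_def v_def M_def N_def comb hyperbolic(3-) by (simp_all add: algebra_simps)
    note k = hyperbolic(2)
    show ?thesis
    proof (cases "t \<ge> 0")
      case True
      have F2: "frame u v z ((1 / k) *\<^sub>R b4)" by (rule frame_scale[OF uv(1)]) (use k in simp)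
      show ?thesis
        by (rule almost_abelian_hyperbolic_case[OF F2 uv(2-), of "M / k" "N / k" "t / k"])
          (use k True in \<open>simp_all add: br_simps bu bv bz algebra_simps\<close>)
    next
      case False
      have "frame u v z ((- 1 / k) *\<^sub>R b4)" by (rule frame_scale[OF uv(1)]) (use k in simp)
      then have F2: "frame v u z ((- 1 / k) *\<^sub>R b4)" by (rule frame_perm)
      show ?thesis
        by (rule almost_abelian_hyperbolic_case[OF F2 _ uv(4,3), of "- N / k" "- M / k" "- t / k"])
          (use k False uv(2) skew[of v u] in \<open>simp_all add: br_simps bu bv bz algebra_simps divide_nonpos_pos\<close>)
    qed
  next
    case (elliptic p q r s k)
    define u v M N where "u = p *\<^sub>R x + q *\<^sub>R y" and "v = r *\<^sub>R x + s *\<^sub>R y"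
      and "M = m * p + n * q" and "N = m * r + n * s"
    have uv: "frame u v z b4" "br u v = 0" "br u z = 0" "br v z = 0"
      unfolding u_def v_def using frame_block[OF F' elliptic(1)] ab2 by simp_all
    have bu: "br b4 u = k *\<^sub>R v + M *\<^sub>R z" and bv: "br b4 v = - k *\<^sub>R u + N *\<^sub>R z"
      unfolding u_def v_def M_def N_def comb elliptic(3-) by (simp_all add: algebra_simps)
    note k = elliptic(2)
    have F2: "frame u v z ((1 / k) *\<^sub>R b4)" by (rule frame_scale[OF uv(1)]) (use k in simp)
    show ?thesis
      by (rule almost_abelian_elliptic_case[OF F2 uv(2-), of "M / k" "N / k" "t / k"])
        (use k in \<open>simp_all add: br_simps bu bv bz algebra_simps\<close>)
  qed
qed

section \<open>The classification\<close>

text \<open>The plane is the kernel of the functional from \<open>imperfect_ideal\<close> inside the unimodular ideal. Its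
  vectors and the complement have adjoint trace zero; this makes the plane abelian and the action of
  \<open>a3\<close> on it traceless.\<close>

lemma abelian_plane:
  obtains a1 a2 a3 b4 \<alpha> \<beta> \<gamma> where "frame a1 a2 a3 b4" "\<And>x y. br x y \<in> span {a1, a2, a3}"
    "br a1 a2 = 0" "br a3 a1 = \<alpha> *\<^sub>R a1 + \<gamma> *\<^sub>R a2" "br a3 a2 = \<beta> *\<^sub>R a1 - \<alpha> *\<^sub>R a2"
proof -
  obtain b1 b2 b3 b4 where F: "frame b1 b2 b3 b4" and h: "\<And>x y. br x y \<in> span {b1, b2, b3}"
    and tr: "\<And>x. x \<in> span {b1, b2, b3} \<Longrightarrow> tr_ad x = 0"
    using adapted_frame by metis
  obtain \<nu> :: "real^4 \<Rightarrow> real" where lin: "linear \<nu>" and nz: "\<nu> b1 \<noteq> 0 \<or> \<nu> b2 \<noteq> 0 \<or> \<nu> b3 \<noteq> 0"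
    and \<nu>: "\<nu> (br b1 b2) = 0" "\<nu> (br b2 b3) = 0" "\<nu> (br b3 b1) = 0"
    using imperfect_ideal[OF F h tr] by blast
  have "\<exists>d1 d2 d3. frame d1 d2 d3 b4 \<and> span {d1, d2, d3} = span {b1, b2, b3} \<and> \<nu> d3 \<noteq> 0
    \<and> \<nu> (br d1 d2) = 0 \<and> \<nu> (br d2 d3) = 0 \<and> \<nu> (br d3 d1) = 0"
    using nz
  proof (elim disjE)
    assume "\<nu> b1 \<noteq> 0"
    then show ?thesis using F \<nu>
      by (intro exI[of _ b2] exI[of _ b3] exI[of _ b1]) (simp add: frame_def insert_commute)
  next
    assume "\<nu> b2 \<noteq> 0"
    then show ?thesis using F \<nu>
      by (intro exI[of _ b3] exI[of _ b1] exI[of _ b2]) (simp add: frame_def insert_commute)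
  next
    assume "\<nu> b3 \<noteq> 0"
    then show ?thesis using F \<nu> by blast
  qed
  then obtain d1 d2 a3 where F1: "frame d1 d2 a3 b4" and sp: "span {d1, d2, a3} = span {b1, b2, b3}"
    and n3: "\<nu> a3 \<noteq> 0" and \<nu>': "\<nu> (br d1 d2) = 0" "\<nu> (br d2 a3) = 0" "\<nu> (br a3 d1) = 0" by blast
  note lins = linear_rules[OF lin]
  define a1 a2 where "a1 = 1 *\<^sub>R d1 + ((- \<nu> d1 / \<nu> a3) *\<^sub>R a3 + 0 *\<^sub>R d2 + 0 *\<^sub>R b4)"
    and "a2 = 1 *\<^sub>R d2 + ((- \<nu> d2 / \<nu> a3) *\<^sub>R a3 + 0 *\<^sub>R a1 + 0 *\<^sub>R b4)"
  have "frame a3 d2 b4 a1" unfolding a1_def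
    by (rule frame_update) (use F1 in \<open>simp_all add: frame_def insert_commute\<close>)
  then have "frame a3 a1 b4 d2" by (simp add: frame_def insert_commute)
  then have "frame a3 a1 b4 a2" unfolding a2_def by (rule frame_update) simp
  then have F2: "frame a1 a2 a3 b4" by (simp add: frame_def insert_commute)
  have \<nu>a: "\<nu> a1 = 0" "\<nu> a2 = 0" using n3 by (simp_all add: a1_def a2_def lins)
  have "{d1, d2, a3} \<subseteq> span {a1, a2, a3}"
  proof -
    have "d1 = 1 *\<^sub>R a1 + 0 *\<^sub>R a2 + (\<nu> d1 / \<nu> a3) *\<^sub>R a3"
      "d2 = 0 *\<^sub>R a1 + 1 *\<^sub>R a2 + (\<nu> d2 / \<nu> a3) *\<^sub>R a3" by (simp_all add: a1_def a2_def)
    then have "d1 \<in> span {a1, a2, a3}" "d2 \<in> span {a1, a2, a3}" unfolding in_span3_iff by blast+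
    then show ?thesis by (simp add: span_base)
  qed
  then have sub: "span {b1, b2, b3} \<subseteq> span {a1, a2, a3}" unfolding sp[symmetric] by (intro span_minimal) auto
  then have h2: "br x y \<in> span {a1, a2, a3}" for x y using h by blast
  have "{a1, a2, a3} \<subseteq> span {d1, d2, a3}"
  proof -
    have "a1 = 1 *\<^sub>R d1 + 0 *\<^sub>R d2 + (- \<nu> d1 / \<nu> a3) *\<^sub>R a3"
      "a2 = 0 *\<^sub>R d1 + 1 *\<^sub>R d2 + (- \<nu> d2 / \<nu> a3) *\<^sub>R a3" by (simp_all add: a1_def a2_def)
    then have "a1 \<in> span {d1, d2, a3}" "a2 \<in> span {d1, d2, a3}" unfolding in_span3_iff by blast+
    then show ?thesis by (simp add: span_base)
  qed
  then have tr2: "tr_ad a1 = 0" "tr_ad a2 = 0" "tr_ad a3 = 0" using tr unfolding sp by auto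
  have plane: "\<exists>p q. x = p *\<^sub>R a1 + q *\<^sub>R a2" if x_in: "x \<in> span {a1, a2, a3}" and \<nu>x: "\<nu> x = 0" for x
  proof -
    obtain p q r where x: "x = p *\<^sub>R a1 + q *\<^sub>R a2 + r *\<^sub>R a3" using x_in unfolding in_span3_iff by blast
    have "r = 0" using \<nu>x n3 by (simp add: x lins \<nu>a)
    then show ?thesis using x by auto
  qed
  have \<nu>br: "\<nu> (br a1 a2) = 0" "\<nu> (br a3 a1) = 0" "\<nu> (br a3 a2) = 0"
    using \<nu>' skew[of a3 d2] skew[of d1 a3] by (simp_all add: a1_def a2_def br_simps lins)
  obtain x y where a12: "br a1 a2 = x *\<^sub>R a1 + y *\<^sub>R a2" using plane[OF h2 \<nu>br(1)] by blast
  obtain \<alpha> \<gamma> where a31: "br a3 a1 = \<alpha> *\<^sub>R a1 + \<gamma> *\<^sub>R a2" using plane[OF h2 \<nu>br(2)] by blast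
  obtain \<beta> \<delta> where a32: "br a3 a2 = \<beta> *\<^sub>R a1 + \<delta> *\<^sub>R a2" using plane[OF h2 \<nu>br(3)] by blast
  obtain c1 c2 c3 c4 :: "real^4 \<Rightarrow> real" where lin': "linear c1" "linear c2" "linear c3" "linear c4"
    and c: "c1 a1 = 1" "c1 a2 = 0" "c1 a3 = 0" "c1 b4 = 0"
    "c2 a1 = 0" "c2 a2 = 1" "c2 a3 = 0" "c2 b4 = 0"
    "c3 a1 = 0" "c3 a2 = 0" "c3 a3 = 1" "c3 b4 = 0"
    "c4 a1 = 0" "c4 a2 = 0" "c4 a3 = 0" "c4 b4 = 1"
    and trace: "\<And>f. linear f \<Longrightarrow> trace (matrix f) = c1 (f a1) + c2 (f a2) + c3 (f a3) + c4 (f b4)"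
    using frame_coordinates[OF F2] by blast
  note lins' = linear_rules[OF lin'(1)] linear_rules[OF lin'(2)] linear_rules[OF lin'(3)] linear_rules[OF lin'(4)]
  have c4: "c4 (br v u) = 0" for v u
    using h2[of v u] unfolding in_span3_iff by (auto simp: lins' c)
  have "y = 0" "x = 0" "\<delta> = - \<alpha>"
    using tr2 skew[of a2 a1] skew[of a1 a3] skew[of a2 a3]
    by (simp_all add: tr_ad_def trace[OF linear_br(1)] c4 a12 a31 a32 lins' c)
  then show ?thesis using that[OF F2 h2, of \<alpha> \<gamma> \<beta>] a12 a31 a32 by simp
qed

lemma classification:
  assumes nonab: "\<exists>x y. br x y \<noteq> 0"
  shows in_table
proof -
  obtain a1 a2 a3 b \<alpha> \<beta> \<gamma> where F: "frame a1 a2 a3 b" and h: "\<And>x y. br x y \<in> span {a1, a2, a3}"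
    and a12: "br a1 a2 = 0" and a31: "br a3 a1 = \<alpha> *\<^sub>R a1 + \<gamma> *\<^sub>R a2" and a32: "br a3 a2 = \<beta> *\<^sub>R a1 - \<alpha> *\<^sub>R a2"
    using abelian_plane by metis
  have comb: "br a3 (p *\<^sub>R a1 + q *\<^sub>R a2) = (\<alpha> * p + \<beta> * q) *\<^sub>R a1 + (\<gamma> * p - \<alpha> * q) *\<^sub>R a2" for p q
    by (simp add: br_simps a31 a32 algebra_simps)
  have ab: "br (p *\<^sub>R a1 + q *\<^sub>R a2) (r *\<^sub>R a1 + s *\<^sub>R a2) = 0" for p q r s
    using skew[of a2 a1] by (simp add: br_simps a12)
  show ?thesis
  proof (cases rule: traceless2_normal_form[of \<alpha> \<beta> \<gamma>])
    case zero
    then have "br a1 a3 = 0" "br a2 a3 = 0" using a31 a32 skew[of a1 a3] skew[of a2 a3] by simp_all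
    then show ?thesis using abelian_ideal_case[OF F a12 _ _ h nonab] by simp
  next
    case (nilpotent p q r s)
    define u v where "u = p *\<^sub>R a1 + q *\<^sub>R a2" and "v = r *\<^sub>R a1 + s *\<^sub>R a2"
    have F2: "frame a3 v u b" 
      using frame_block[OF F nilpotent(1)] unfolding u_def v_def by (simp add: frame_def insert_commute)
    have h2: "br b x \<in> span {a3, v, u}" for x
      using h span_block[OF nilpotent(1), of a1 a2 "{a3}"] unfolding u_def v_def by (simp add: insert_commute)
    show ?thesis
    proof (rule heisenberg_case[OF F2 _ _ _ h2])
      show "br a3 v = u" "br a3 u = 0" unfolding u_def v_def comb nilpotent(2-) by simp_all
      show "br v u = 0" unfolding u_def v_def by (rule ab)
    qed
  next
    case (hyperbolic p q r s k)
    define u v a where "u = p *\<^sub>R a1 + q *\<^sub>R a2" and "v = r *\<^sub>R a1 + s *\<^sub>R a2" and "a = (1 / k) *\<^sub>R a3"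
    have k: "1 / k \<noteq> 0" using hyperbolic(2) by simp
    have F2: "frame u v a b"
      using frame_perm(3)[OF frame_scale[OF frame_perm(3)[OF frame_block[OF F hyperbolic(1)]] k]]
      unfolding u_def v_def a_def .
    have "a3 = k *\<^sub>R a" using k by (simp add: a_def)
    then have "a3 \<in> span {u, v, a}" by (simp add: span_mul span_base)
    then have "span {u, v, a3} \<subseteq> span {u, v, a}" by (intro span_minimal) (auto intro: span_base)
    then have h2: "br b x \<in> span {u, v, a}" for x
      using h span_block[OF hyperbolic(1), of a1 a2 "{a3}"] unfolding u_def v_def by blast
    show ?thesis
    proof (rule hyperbolic_case[OF F2 _ _ _ h2])
      have "br a3 u = k *\<^sub>R u" "br a3 v = - k *\<^sub>R v"
        unfolding u_def v_def comb hyperbolic(3-) by (simp_all add: algebra_simps)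
      then show "br a u = u" "br a v = - v" using k by (simp_all add: a_def br_simps)
      show "br u v = 0" unfolding u_def v_def by (rule ab)
    qed
  next
    case (elliptic p q r s k)
    define u v a where "u = p *\<^sub>R a1 + q *\<^sub>R a2" and "v = r *\<^sub>R a1 + s *\<^sub>R a2" and "a = (1 / k) *\<^sub>R a3"
    have k: "1 / k \<noteq> 0" using elliptic(2) by simp
    have F2: "frame u v a b"
      using frame_perm(3)[OF frame_scale[OF frame_perm(3)[OF frame_block[OF F elliptic(1)]] k]]
      unfolding u_def v_def a_def .
    have "a3 = k *\<^sub>R a" using k by (simp add: a_def)
    then have "a3 \<in> span {u, v, a}" by (simp add: span_mul span_base)
    then have "span {u, v, a3} \<subseteq> span {u, v, a}" by (intro span_minimal) (auto intro: span_base)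
    then have h2: "br b x \<in> span {u, v, a}" for x
      using h span_block[OF elliptic(1), of a1 a2 "{a3}"] unfolding u_def v_def by blast
    show ?thesis
    proof (rule elliptic_case[OF F2 _ _ _ h2])
      have "br a3 u = k *\<^sub>R v" "br a3 v = - k *\<^sub>R u"
        unfolding u_def v_def comb elliptic(3-) by (simp_all add: algebra_simps)
      then show "br a u = v" "br a v = - u" using k by (simp_all add: a_def br_simps)
      show "br u v = 0" unfolding u_def v_def by (rule ab)
    qed
  qed
qed

end

text \<open>Identifies the given Lie algebra with one on \<open>\<real>\<^sup>4\<close>, where matrices and traces are available.\<close>

lemma real4_coordinates:
  assumes "dim (UNIV :: 'a::real_vector set) = 4"
  obtains f :: "real^4 \<Rightarrow> 'a::real_vector" and g where "linear f" "linear g" "\<And>x. f (g x) = x" "\<And>v. g (f v) = v"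
proof -
  obtain B :: "'a::real_vector set" where B: "independent B" "UNIV \<subseteq> span B"
    and "card B = dim (UNIV :: 'a::real_vector set)"
    by (rule basis_exists[of "UNIV :: 'a::real_vector set"])
  then have "card B = Suc (Suc (Suc (Suc 0)))" using assms by simp
  then obtain b1 b2 b3 b4 where b: "B = {b1, b2, b3, b4}" and dist: "distinct [b1, b2, b3, b4]"
    unfolding card_Suc_eq by auto
  let ?f = "lincomb b1 b2 b3 b4"
  define h where "h x = (if x = b1 then e 1 else if x = b2 then e 2 else if x = b3 then e 3 else e 4)" for x
  obtain g where g: "linear g" "\<And>x. x \<in> B \<Longrightarrow> g x = h x"
    using linear_independent_extend[OF B(1), of h] by blast
  have gb: "g b1 = e 1" "g b2 = e 2" "g b3 = e 3" "g b4 = e 4"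
    using dist by (auto simp: g(2) b h_def)
  have gf: "g (?f v) = v" for v
    by (simp add: lincomb_def linear_rules[OF g(1)] gb vec_eq_iff forall_4)
  have "?f (g x) = x" for x
  proof -
    have "x \<in> span {b1, b2, b3, b4}" using B(2) b by auto
    then obtain p q r s where "x = p *\<^sub>R b1 + q *\<^sub>R b2 + r *\<^sub>R b3 + s *\<^sub>R b4"
      unfolding in_span4_iff by blast
    then show ?thesis by (simp add: linear_rules[OF g(1)] gb lincomb_def)
  qed
  then show ?thesis by (rule that[OF linear_lincomb g(1) _ gf])
qed

theorem proposition2p4:
  fixes br :: "'a::real_vector \<Rightarrow> 'a \<Rightarrow> 'a"
  assumes "lie_algebra br"
    and "dim (UNIV :: 'a set) = 4"
    and "\<not> abelian br"
    and "symplectic br"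
  shows "(\<exists>M S. listed M S \<and> lie_isomorphic br M) \<and>
         (\<forall>M S. listed M S \<longrightarrow> lie_algebra M \<and> {\<omega>. symplectic_form M \<omega>} = S)"
proof (intro conjI allI impI)
  obtain f :: "real^4 \<Rightarrow> 'a" and g where f: "linear f" and g: "linear g"
    and fg: "\<And>x. f (g x) = x" and gf: "\<And>v. g (f v) = v"
    using real4_coordinates[OF assms(2)] by metis
  have br: "bilinear br" "\<And>x. br x x = 0"
    and jac: "\<And>x y z. br x (br y z) + br y (br z x) + br z (br x y) = 0"
    using assms(1) by (simp_all add: lie_algebra_def)
  obtain \<omega> where \<omega>: "symplectic_form br \<omega>" using assms(4) by (auto simp: symplectic_def)
  then have alt: "alternating_form 2 \<omega>"
    and cl: "\<And>x y z. \<omega> [br x y, z] - \<omega> [br x z, y] + \<omega> [br y z, x] = 0"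
    and nd: "\<exists>x y z u. pfaffian (\<lambda>x y. \<omega> [x, y]) x y z u \<noteq> 0"
    unfolding symplectic_form_iff[OF assms(2)] by auto
  note alt = alternating_formD[OF alt]
  define br' where "br' x y = g (br (f x) (f y))" for x y
  define w where "w x y = \<omega> [f x, f y]" for x y
  have bil: "bilinear (\<lambda>x y. h (k (f x) (f y)))" if "linear h" "bilinear k"
    for h :: "'b::real_vector \<Rightarrow> 'c::real_vector" and k
    unfolding bilinear_def
    by (intro conjI allI; rule linearI)
      (simp_all add: linear_rules[OF f] linear_rules[OF that(1)] bilinear_ladd[OF that(2)]
        bilinear_radd[OF that(2)] bilinear_lmul[OF that(2)] bilinear_rmul[OF that(2)])
  interpret symplectic_lie4 br' w
  proof
    have "g (br x (br y z)) + g (br y (br z x)) + g (br z (br x y)) = 0" for x y z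
      using arg_cong[OF jac[of x y z], of g] by (simp add: linear_rules[OF g])
    moreover have "br' = (\<lambda>x y. g (br (f x) (f y)))" by (simp add: br'_def fun_eq_iff)
    ultimately show "lie_algebra br'"
      using bil[OF g br(1)] by (simp add: lie_algebra_def br'_def fg br(2) linear_0[OF g])
    show "bilinear w" unfolding w_def using bil[OF linear_id alt(2)] by simp
    show "w x x = 0" for x by (simp add: w_def alt(3))
    show "w (br' x y) z + w (br' y z) x + w (br' z x) y = 0" for x y z
      using cl[of "f x" "f y" "f z"] bilinear_lneg[OF alt(2), of "br (f x) (f z)" "f y"]
        alternating_skew[OF br, of "f z" "f x"]
      by (simp add: w_def br'_def fg)
    obtain x y z u where "pfaffian (\<lambda>x y. \<omega> [x, y]) x y z u \<noteq> 0" using nd by blast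
    then have "pfaffian w (g x) (g y) (g z) (g u) \<noteq> 0" by (simp add: pfaffian_def w_def fg)
    then show "\<exists>x y z u. pfaffian w x y z u \<noteq> 0" by blast
  qed
  obtain x y where "br x y \<noteq> 0" using assms(3) by (auto simp: abelian_def)
  moreover have "f (br' (g x) (g y)) = br x y" by (simp add: br'_def fg)
  ultimately have "br' (g x) (g y) \<noteq> 0" using linear_0[OF f] by auto
  then obtain M S where M: "listed M S" "lie_isomorphic br' M" using classification by blast
  then obtain \<phi> where \<phi>: "linear \<phi>" "bij \<phi>" "\<And>x y. \<phi> (br' x y) = M (\<phi> x) (\<phi> y)"
    by (auto simp: lie_isomorphic_def)
  have "bij g" using fg gf by (intro bij_betw_byWitness[where f' = f]) auto
  then have "bij (\<phi> \<circ> g)" using \<phi>(2) by (rule bij_comp)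
  moreover have "linear (\<phi> \<circ> g)" by (rule linear_compose[OF g \<phi>(1)])
  moreover have "(\<phi> \<circ> g) (br x y) = M ((\<phi> \<circ> g) x) ((\<phi> \<circ> g) y)" for x y
    using \<phi>(3)[of "g x" "g y"] by (simp add: br'_def fg)
  ultimately have "lie_isomorphic br M" unfolding lie_isomorphic_def by blast
  then show "\<exists>M S. listed M S \<and> lie_isomorphic br M" using M(1) by blast
next
  fix M S assume "listed M S"
  then show "lie_algebra M" "{\<omega>. symplectic_form M \<omega>} = S"
    by (rule listed_lie_algebra, rule listed_symplectic_forms)
qed

end
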